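(* Let $n\ge 2$, let $F\in\mathbb{Z}[x_1,\dots,x_n]$ be a non-singular homogeneous polynomial, let $V_F$ be the hypersurface $F(\mathbf{x})=0$, and let $p$ be a prime such that $F$ is non-singular modulo $p$. For $\mathbf{h}\in\mathbb{Z}^n$ define \[S(\mathbf{h};p^2)=\sum_{\mathbf{x}\in V_F(\mathbb{Z}/p^2\mathbb{Z})}\exp\!\left(\frac{h_1x_1+\cdots+h_nx_n}{p^2}\right),\qquad \exp(t):=e^{2\pi i t},\] where $V_F(\mathbb{Z}/p^2\mathbb{Z})=\{\mathbf{x}\in(\mathbb{Z}/p^2\mathbb{Z})^n: F(\mathbf{x})\equiv 0 \pmod{p^2}\}$. For $\mathbf{h}\in\mathbb{F}_p^n$ let $W_{F,\mathbf{h}}$ be the affine variety over $\mathbb{F}_p$ defined by the equations \[F(\mathbf{y})=0,\qquad h_i\frac{\partial F}{\partial x_j}(\mathbf{y})=h_j\frac{\partial F}{\partial x_i}(\mathbf{y})\quad (1\le i,j\le n,\ i\ne j),\] and for $j\ge 0$ let $\mathcal{G}_{F,j}=\{\mathbf{h}\in\mathbb{F}_p^n:\dim(W_{F,\mathbf{h}})\ge j\}$. Then the sets $\mathcal{G}_{F,j}$ are varieties satisfying $\mathcal{G}_{F,0}=\mathbb{A}^n_{\mathbb{F}_p}\supseteq\mathcal{G}_{F,1}\supseteq\cdots\supseteq\mathcal{G}_{F,n}$, the codimension of each $\mathcal{G}_{F,j}$ is at least $j$, and \[S(\mathbf{h};p^2)=O_F\!\left(p^{\,n+j-2}\right)\]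 whenever the reduction of $\mathbf{h}$ modulo $p$ does not lie in $\mathcal{G}_{F,j}(\mathbb{F}_p)$.
   Context: A homogeneous polynomial $F$ is called non-singular (over a field $K$) if the projective hypersurface $\{F=0\}$ is smooth, i.e. the gradient $\nabla F$ does not vanish at any nonzero point of $\{F=0\}$ over the algebraic closure of $K$; "non-singular modulo $p$" means this holds for the reduction of $F$ over $\mathbb{F}_p$. Dimensions of varieties are taken geometrically (over the algebraic closure), with the empty variety having dimension $-1$. The implied constant in $O_F$ depends only on $F$ (not on $p$ or $\mathbf{h}$).
   Formalization: The equality G_{F,0} = A^n is claimed only when deg F ≥ 2; it is false in degrees 0 and 1 (for F = x_1 and h = (0,1,0,…,0), W_{F,h} is empty, so h is not in G_{F,0}). All other claims are kept for every degree. *)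

theory Defs
  imports
    "HOL-Algebra.Algebraic_Closure_Type"
    "HOL-Number_Theory.Residues"
    "HOL-Analysis.Analysis"
begin

section \<open>Polynomials in finitely many variables over a ring\<close>

text \<open>Polynomials are the indexed polynomials of \<^theory>\<open>HOL-Algebra.Indexed_Polynomials\<close>: a monomial
  is the multiset of its letters (here the variables \<open>1, \<dots>, n\<close>), a polynomial maps monomials to
  coefficients. Membership in \<open>polys R n\<close> entails finite support.\<close>

definition polys :: "('a, 'b) ring_scheme \<Rightarrow> nat \<Rightarrow> (nat multiset \<Rightarrow> 'a) set"
  where "polys R n = ring.indexed_pset R {1..n} (carrier R)"

definition poly_value :: "('a, 'b) ring_scheme \<Rightarrow> (nat multiset \<Rightarrow> 'a) \<Rightarrow> (nat \<Rightarrow> 'a) \<Rightarrow> 'a"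
  where "poly_value R P x =
    (\<Oplus>\<^bsub>R\<^esub>m\<in>{m. P m \<noteq> \<zero>\<^bsub>R\<^esub>}. P m \<otimes>\<^bsub>R\<^esub> (\<Otimes>\<^bsub>R\<^esub>i\<in>set_mset m. x i [^]\<^bsub>R\<^esub> count m i))"

definition partial :: "('a, 'b) ring_scheme \<Rightarrow> nat \<Rightarrow> (nat multiset \<Rightarrow> 'a) \<Rightarrow> (nat multiset \<Rightarrow> 'a)"
  where "partial R i P = (\<lambda>m. [Suc (count m i)] \<cdot>\<^bsub>R\<^esub> P (add_mset i m))"

definition homogeneous :: "nat \<Rightarrow> (nat multiset \<Rightarrow> 'a::zero) \<Rightarrow> bool"
  where "homogeneous d P \<longleftrightarrow> (\<forall>m. P m \<noteq> 0 \<longrightarrow> size m = d)"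

definition affine_space :: "('a, 'b) ring_scheme \<Rightarrow> nat \<Rightarrow> (nat \<Rightarrow> 'a) set"
  where "affine_space R n = {1..n} \<rightarrow>\<^sub>E carrier R"

definition zero_locus ::
    "('a, 'b) ring_scheme \<Rightarrow> nat \<Rightarrow> (nat multiset \<Rightarrow> 'a) set \<Rightarrow> (nat \<Rightarrow> 'a) set"
  where "zero_locus R n S = {x \<in> affine_space R n. \<forall>P\<in>S. poly_value R P x = \<zero>\<^bsub>R\<^esub>}"


section \<open>Zariski-closed sets and their dimension\<close>

text \<open>In this section \<open>L\<close> is meant to be an algebraically closed field.\<close>

definition zariski_closed :: "('a, 'b) ring_scheme \<Rightarrow> nat \<Rightarrow> (nat \<Rightarrow> 'a) set \<Rightarrow> bool"
  where "zariski_closed L n Z \<longleftrightarrow> (\<exists>S \<subseteq> polys L n. Z = zero_locus L n S)"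

definition irreducible_closed :: "('a, 'b) ring_scheme \<Rightarrow> nat \<Rightarrow> (nat \<Rightarrow> 'a) set \<Rightarrow> bool"
  where "irreducible_closed L n Y \<longleftrightarrow>
    zariski_closed L n Y \<and> Y \<noteq> {} \<and>
    (\<forall>A B. zariski_closed L n A \<and> zariski_closed L n B \<and> Y = A \<union> B \<longrightarrow> Y = A \<or> Y = B)"

text \<open>Krull dimension of a closed set: the supremum of the lengths of chains
  \<open>Y 0 \<subset> \<dots> \<subset> Y k\<close> of irreducible closed subsets. It is extended real valued so that the
  supremum is meaningful without knowing beforehand that it is finite.\<close>

definition dimension :: "('a, 'b) ring_scheme \<Rightarrow> nat \<Rightarrow> (nat \<Rightarrow> 'a) set \<Rightarrow> ereal"
  where "dimension L n Z =
    (if Z = {} then -1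
     else SUP k \<in> {k. \<exists>Y. (\<forall>i\<le>k. irreducible_closed L n (Y i) \<and> Y i \<subseteq> Z) \<and> (\<forall>i<k. Y i \<subset> Y (Suc i))}.
            ereal (real k))"

definition codimension :: "('a, 'b) ring_scheme \<Rightarrow> nat \<Rightarrow> (nat \<Rightarrow> 'a) set \<Rightarrow> ereal"
  where "codimension L n Z = (if Z = {} then \<infinity> else ereal (real n) - dimension L n Z)"


section \<open>Varieties over a field, through their geometric points\<close>

text \<open>The library's algebraic closure of \<open>K\<close> contains \<open>K\<close> via \<^const>\<open>ring.indexed_const\<close>;
  \<open>extend_scalars\<close> applies this embedding to the coefficients of a polynomial over \<open>K\<close>.\<close>

definition extend_scalars ::
    "'a ring \<Rightarrow> (nat multiset \<Rightarrow> 'a) \<Rightarrow> (nat multiset \<Rightarrow> (('a list \<times> nat) multiset \<Rightarrow> 'a))"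
  where "extend_scalars K P = (\<lambda>m. ring.indexed_const K (P m))"

definition variety_over :: "'a ring \<Rightarrow> nat \<Rightarrow> (nat \<Rightarrow> (('a list \<times> nat) multiset \<Rightarrow> 'a)) set \<Rightarrow> bool"
  where "variety_over K n Z \<longleftrightarrow>
    (\<exists>S \<subseteq> polys K n. Z = zero_locus (field.alg_closure K) n (extend_scalars K ` S))"

definition nonsingular :: "'a ring \<Rightarrow> nat \<Rightarrow> (nat multiset \<Rightarrow> 'a) \<Rightarrow> bool"
  where "nonsingular K n P \<longleftrightarrow>
    (let L = field.alg_closure K; P' = extend_scalars K P in
      \<forall>x \<in> zero_locus L n {P'}. (\<exists>i\<in>{1..n}. x i \<noteq> \<zero>\<^bsub>L\<^esub>) \<longrightarrow>
        (\<exists>i\<in>{1..n}. poly_value L (partial L i P') x \<noteq> \<zero>\<^bsub>L\<^esub>))"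


section \<open>Reductions of an integral polynomial, and the exponential sum\<close>

abbreviation int_ring :: "int ring" where "int_ring \<equiv> ring_of_type_algebra"
abbreviation rat_field :: "rat ring" where "rat_field \<equiv> ring_of_type_algebra"
abbreviation F_p :: "nat \<Rightarrow> int ring" where "F_p p \<equiv> residue_ring (int p)"

type_synonym F_p_bar = "(int list \<times> nat) multiset \<Rightarrow> int"

abbreviation F_p_closure :: "nat \<Rightarrow> F_p_bar ring"
  where "F_p_closure p \<equiv> field.alg_closure (F_p p)"

definition reduce_mod :: "nat \<Rightarrow> (nat multiset \<Rightarrow> int) \<Rightarrow> (nat multiset \<Rightarrow> int)"
  where "reduce_mod q F = (\<lambda>m. F m mod int q)"

definition reduce_point :: "nat \<Rightarrow> nat \<Rightarrow> (nat \<Rightarrow> int) \<Rightarrow> (nat \<Rightarrow> F_p_bar)"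
  where "reduce_point n p h = (\<lambda>i\<in>{1..n}. ring.indexed_const (F_p p) (h i mod int p))"

text \<open>Elements of the ring of integers modulo \<open>q\<close> are their representatives in \<open>{0..q - 1}\<close>;
  the summand does not depend on this choice.\<close>

definition exp_sum :: "nat \<Rightarrow> (nat multiset \<Rightarrow> int) \<Rightarrow> (nat \<Rightarrow> int) \<Rightarrow> nat \<Rightarrow> complex"
  where "exp_sum n F h q =
    (\<Sum>x \<in> zero_locus (residue_ring (int q)) n {reduce_mod q F}.
       exp (2 * of_real pi * \<i> * (of_int (\<Sum>i=1..n. h i * x i) / of_nat q)))"


section \<open>The varieties \<open>W\<close> and \<open>\<G>\<close>\<close>

definition W :: "nat \<Rightarrow> nat \<Rightarrow> (nat multiset \<Rightarrow> int) \<Rightarrow> (nat \<Rightarrow> F_p_bar) \<Rightarrow> (nat \<Rightarrow> F_p_bar) set"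
  where "W n p F h =
    (let L = F_p_closure p; F' = extend_scalars (F_p p) (reduce_mod p F) in
      {y \<in> zero_locus L n {F'}.
         \<forall>i\<in>{1..n}. \<forall>j\<in>{1..n}. i \<noteq> j \<longrightarrow>
           h i \<otimes>\<^bsub>L\<^esub> poly_value L (partial L j F') y = h j \<otimes>\<^bsub>L\<^esub> poly_value L (partial L i F') y})"

text \<open>The set of geometric points of \<open>\<G>\<close>: \<open>h\<close> ranges over the affine space over the algebraic
  closure, so that codimension is meaningful; the points over the prime field are those of the
  form \<open>reduce_point n p h\<close>.\<close>

definition G :: "nat \<Rightarrow> nat \<Rightarrow> (nat multiset \<Rightarrow> int) \<Rightarrow> nat \<Rightarrow> (nat \<Rightarrow> F_p_bar) set"
  where "G n p F j =
    {h \<in> affine_space (F_p_closure p) n. dimension (F_p_closure p) n (W n p F h) \<ge> ereal (real j)}"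

end

theory Submission
  imports Defs "HOL-Library.Poly_Mapping" "HOL-Library.Multiset_Order"
begin

text \<open>Everything rests on Hilbert functions. For an ideal \<open>I\<close> in variables \<open>V\<close>, let \<open>HF I t\<close> be the number of
  monomials of degree at most \<open>t\<close> that are not leading monomials of \<open>I\<close>. There is a dichotomy: either
  \<open>HF I t\<close> is at least the number of monomials of degree at most \<open>t\<close> in \<open>j\<close> variables for all \<open>t\<close>, or it grows at
  most like \<open>t\<close> to the power \<open>j - 1\<close>, with a constant depending only on \<open>card V\<close> and on the first \<open>t\<close> violating the bound.
  For homogeneous \<open>I\<close> over an algebraically closed field the first alternative means that the zeros of \<open>I\<close>
  have dimension at least \<open>j\<close>.

  The fibre \<open>W h\<close> is the zero set of a homogeneous ideal. For each \<open>t\<close>, the lower bound on its Hilbert function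
  is a condition on the rank of a matrix whose entries are integral polynomials in \<open>h\<close>. Hence \<open>\<G> j\<close> is defined by
  integral polynomials, independent of \<open>p\<close>. By a noetherian argument over the integers, finitely many \<open>t\<close>
  suffice for all \<open>p\<close> at once. So if \<open>h\<close> is not in \<open>\<G> j\<close>, then the upper bound on the Hilbert function of \<open>W h\<close>
  holds with a uniform constant, and since Hilbert functions bound the number of points with coordinates in a
  finite set, \<open>W h\<close> has at most a constant times \<open>p\<close> to the power \<open>j - 1\<close> points over the prime field.

  Writing \<open>x = a + p b\<close>, the sum over \<open>b\<close> is a sum of a character over an affine hyperplane with normal vector
  \<open>\<nabla>F(a)\<close>. It vanishes unless \<open>h\<close> is parallel to \<open>\<nabla>F(a)\<close>, that is unless \<open>a\<close> lies on \<open>W h\<close>. The bound on the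
  codimension holds because, off the origin, the incidence variety of all \<open>(h, y)\<close> with \<open>y\<close> in \<open>W h\<close> is
  parametrised by the \<open>n\<close>-dimensional set of pairs of a scalar and a point of \<open>F = 0\<close>.\<close>

section \<open>Multivariate polynomials and evaluation\<close>

text \<open>The ideal generated by the equations of \<open>W h\<close> need not be radical. Hence
  the lower bound on Hilbert functions is proved for every ideal that vanishes on the top of a
  chain, so that dimension can be read off the equations as they stand. The comparison with a chain
  first yields a bound only along the multiples of some unknown \<open>e\<close>; the dichotomy
  turns it into the exact bound for all \<open>t\<close>, a condition in which no chain occurs any
  more.

  The exponent \<open>n + j - 2\<close> is \<open>(j - 1) + (n - 1)\<close>: each point
  \<open>a\<close> of \<open>W h\<close> contributes at most \<open>p ^ (n - 1)\<close>, the number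
  of points \<open>b\<close> on a hyperplane. The origin is the exception, because the gradient may
  vanish there. It contributes up to \<open>p ^ n\<close>, but only if \<open>p\<close> divides
  \<open>h\<close>. Then \<open>W h\<close> is all of \<open>F = 0\<close>, which contains a line
  because \<open>n \<ge> 2\<close>; so \<open>j \<ge> 2\<close>, and \<open>p ^ n\<close> is
  absorbed.

  A further obstacle is that the algebraic closure of the prime field is a record depending on
  \<open>p\<close>, whereas the algebra is carried out for types of a class and has to be
  transferred.\<close>

type_synonym 'a mpoly = "nat multiset \<Rightarrow>\<^sub>0 'a"

abbreviation coef :: "('m \<Rightarrow>\<^sub>0 'a::zero) \<Rightarrow> 'm \<Rightarrow> 'a" where "coef \<equiv> Poly_Mapping.lookup"
abbreviation supp :: "('m \<Rightarrow>\<^sub>0 'a::zero) \<Rightarrow> 'm set" where "supp \<equiv> Poly_Mapping.keys"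
abbreviation mon :: "'m \<Rightarrow> 'a::zero \<Rightarrow> ('m \<Rightarrow>\<^sub>0 'a)" where "mon \<equiv> Poly_Mapping.single"
abbreviation Cst :: "'a::zero \<Rightarrow> 'a mpoly" where "Cst \<equiv> mon {#}"
abbreviation Var :: "nat \<Rightarrow> 'a::zero_neq_one mpoly" where "Var i \<equiv> mon {#i#} 1"

lemma poly_eq_sum_mon: "f = (\<Sum>m\<in>supp f. mon m (coef f m))"
  by (rule poly_mapping_eqI)
    (simp add: lookup_sum lookup_single when_def sum.delta in_keys_iff)

lemma mpoly_induct [case_names zero add]:
  assumes "P 0" and "\<And>m c f. P f \<Longrightarrow> P (mon m c + f)"
  shows "P (f :: 'm \<Rightarrow>\<^sub>0 'a::comm_monoid_add)"
proof -
  have "P (\<Sum>m\<in>A. mon m (coef f m))" if "finite A" for A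
    using that by induction (auto intro: assms)
  then show ?thesis using poly_eq_sum_mon[of f] by (metis finite_keys)
qed

definition coeff_hom :: "('a::comm_ring_1 \<Rightarrow> 'b::comm_ring_1) \<Rightarrow> bool"
  where "coeff_hom \<phi> \<longleftrightarrow> \<phi> 0 = 0 \<and> \<phi> 1 = 1 \<and> (\<forall>a b. \<phi> (a + b) = \<phi> a + \<phi> b) \<and> (\<forall>a b. \<phi> (a * b) = \<phi> a * \<phi> b)"

text \<open>Coefficients pass through \<open>\<phi>\<close>, so that the same rules cover evaluation
  at a point, integral polynomials at a point of any ring, and substitution of univariate
  polynomials.\<close>

definition hom_eval :: "('a::comm_ring_1 \<Rightarrow> 'b::comm_ring_1) \<Rightarrow> (nat \<Rightarrow> 'b) \<Rightarrow> 'a mpoly \<Rightarrow> 'b"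
  where "hom_eval \<phi> x f = (\<Sum>m\<in>supp f. \<phi> (coef f m) * (\<Prod>i\<in>#m. x i))"

lemma coeff_homD:
  assumes "coeff_hom \<phi>"
  shows "\<phi> 0 = 0" "\<phi> 1 = 1" "\<phi> (a + b) = \<phi> a + \<phi> b" "\<phi> (a * b) = \<phi> a * \<phi> b"
  using assms by (auto simp: coeff_hom_def)

lemma coeff_hom_id [simp]: "coeff_hom (\<lambda>a. a)"
  and coeff_hom_of_int [simp]: "coeff_hom (of_int :: int \<Rightarrow> 'a::comm_ring_1)"
  and coeff_hom_Cst [simp]: "coeff_hom (Cst :: 'a \<Rightarrow> 'a::comm_ring_1 mpoly)"
  and coeff_hom_Cst_of_int [simp]: "coeff_hom (\<lambda>c. Cst (of_int c) :: 'a::comm_ring_1 mpoly)"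
  by (auto simp: coeff_hom_def single_add mult_single)

lemma hom_eval_superset:
  assumes "finite A" "supp f \<subseteq> A" "\<phi> 0 = 0"
  shows "hom_eval \<phi> x f = (\<Sum>m\<in>A. \<phi> (coef f m) * (\<Prod>i\<in>#m. x i))"
  unfolding hom_eval_def using assms by (intro sum.mono_neutral_left) (auto simp: in_keys_iff)

context
  fixes \<phi> :: "'a::comm_ring_1 \<Rightarrow> 'b::comm_ring_1"
  assumes hom: "coeff_hom \<phi>"
begin

lemma hom_eval_0 [simp]: "hom_eval \<phi> x 0 = 0"
  by (simp add: hom_eval_def)

lemma hom_eval_mon [simp]: "hom_eval \<phi> x (mon m c) = \<phi> c * (\<Prod>i\<in>#m. x i)"
  using coeff_homD[OF hom] by (subst hom_eval_superset[of "{m}"]) auto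

lemma hom_eval_1 [simp]: "hom_eval \<phi> x 1 = 1"
  using hom_eval_mon[of x 0 1] coeff_homD[OF hom] by simp

lemma hom_eval_add [simp]: "hom_eval \<phi> x (f + g) = hom_eval \<phi> x f + hom_eval \<phi> x g"
proof -
  have A: "finite (supp f \<union> supp g)" "supp (f + g) \<subseteq> supp f \<union> supp g"
    by (auto simp: Poly_Mapping.keys_add)
  show ?thesis using coeff_homD[OF hom] A
    by (simp add: hom_eval_superset[of "supp f \<union> supp g"] lookup_add algebra_simps sum.distrib)
qed

lemma hom_eval_sum [simp]: "hom_eval \<phi> x (sum g A) = (\<Sum>a\<in>A. hom_eval \<phi> x (g a))"
  by (induction A rule: infinite_finite_induct) auto

lemma hom_eval_mon_mult: "hom_eval \<phi> x (mon m c * g) = hom_eval \<phi> x (mon m c) * hom_eval \<phi> x g"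
  using coeff_homD[OF hom]
  by (induction g rule: mpoly_induct) (auto simp: distrib_left mult_single algebra_simps)

lemma hom_eval_mult [simp]: "hom_eval \<phi> x (f * g) = hom_eval \<phi> x f * hom_eval \<phi> x g"
  by (induction f rule: mpoly_induct) (auto simp: distrib_right hom_eval_mon_mult)

lemma hom_eval_minus [simp]: "hom_eval \<phi> x (- f) = - hom_eval \<phi> x f"
  using hom_eval_add[of x f "- f"] by (simp add: add_eq_0_iff)

lemma hom_eval_diff [simp]: "hom_eval \<phi> x (f - g) = hom_eval \<phi> x f - hom_eval \<phi> x g"
  using hom_eval_add[of x f "- g"] by simp

lemma hom_eval_prod [simp]: "hom_eval \<phi> x (prod g A) = (\<Prod>a\<in>A. hom_eval \<phi> x (g a))"
  by (induction A rule: infinite_finite_induct) auto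

lemma hom_eval_power [simp]: "hom_eval \<phi> x (f ^ k) = hom_eval \<phi> x f ^ k"
  by (induction k) auto

lemma hom_eval_prod_mset [simp]: "hom_eval \<phi> x (\<Prod>i\<in>#m. g i) = (\<Prod>i\<in>#m. hom_eval \<phi> x (g i))"
  by (induction m) auto

end

abbreviation ev :: "(nat \<Rightarrow> 'a::comm_ring_1) \<Rightarrow> 'a mpoly \<Rightarrow> 'a" where "ev \<equiv> hom_eval (\<lambda>a. a)"
abbreviation iev :: "(nat \<Rightarrow> 'a::comm_ring_1) \<Rightarrow> int mpoly \<Rightarrow> 'a" where "iev \<equiv> hom_eval of_int"
abbreviation subst :: "(nat \<Rightarrow> 'a::comm_ring_1 mpoly) \<Rightarrow> 'a mpoly \<Rightarrow> 'a mpoly" where "subst \<equiv> hom_eval Cst"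

lemma ev_Var_Cst [simp]: "ev x (Var i) = x i" "ev x (Cst c) = c"
  by auto

section \<open>Leading monomials\<close>

text \<open>The degree is compared first, so that reduction modulo an ideal never raises it. Ties
  are broken by the multiset order, which is total here and compatible with addition.\<close>

definition mless :: "nat multiset \<Rightarrow> nat multiset \<Rightarrow> bool"
  where "mless a b \<longleftrightarrow> size a < size b \<or> size a = size b \<and> a < b"

definition mle :: "nat multiset \<Rightarrow> nat multiset \<Rightarrow> bool"
  where "mle a b \<longleftrightarrow> mless a b \<or> a = b"

lemma wf_mless: "wf {(a, b). mless a b}"
proof -
  have "{(a, b). mless a b} = inv_image (less_than <*lex*> {(a, b). a < b}) (\<lambda>a. (size a, a))"
    by (auto simp: mless_def)
  then show ?thesis using wf_less_multiset by auto
qed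

lemma mless_trans: "mless a b \<Longrightarrow> mless b c \<Longrightarrow> mless a c"
  and mless_irrefl: "\<not> mless a a"
  and mless_linear: "mless a b \<or> a = b \<or> mless b a"
  and mless_add: "mless a b \<Longrightarrow> mless (c + a) (c + b)"
  by (auto simp: mless_def)

lemma mle_refl [simp]: "mle a a"
  by (simp add: mle_def)

lemma mle_trans: "mle a b \<Longrightarrow> mle b c \<Longrightarrow> mle a c"
  unfolding mle_def using mless_trans by blast

lemma mle_antisym: "mle a b \<Longrightarrow> mle b a \<Longrightarrow> a = b"
  unfolding mle_def using mless_trans mless_irrefl by blast

lemma mle_size: "mle a b \<Longrightarrow> size a \<le> size b"
  unfolding mle_def mless_def by auto

lemma mle_add: "mle a b \<Longrightarrow> mle (c + a) (c + b)"
  unfolding mle_def using mless_add by blast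

definition is_lm :: "'a::zero mpoly \<Rightarrow> nat multiset \<Rightarrow> bool"
  where "is_lm f m \<longleftrightarrow> m \<in> supp f \<and> (\<forall>m'\<in>supp f. mle m' m)"

lemma finite_has_mle_max:
  assumes "finite A" "A \<noteq> {}"
  shows "\<exists>m\<in>A. \<forall>m'\<in>A. mle m' m"
  using assms
proof (induction rule: finite_ne_induct)
  case (singleton x)
  show ?case by simp
next
  case (insert a A)
  then obtain m where m: "m \<in> A" "\<forall>m'\<in>A. mle m' m" by blast
  show ?case
  proof (cases "mle a m")
    case True
    with m show ?thesis by simp blast
  next
    case False
    then have "mle m a" using mless_linear[of a m] by (auto simp: mle_def)
    then have "\<forall>m'\<in>A. mle m' a" using m(2) mle_trans[of _ m a] by simp
    then show ?thesis by simp
  qed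
qed

lemma ex_is_lm: "f \<noteq> 0 \<Longrightarrow> \<exists>m. is_lm f m"
  using finite_has_mle_max[of "supp f"] by (auto simp: is_lm_def)

lemma coef_mon_mult: "coef (mon a c * f) (a + m) = c * coef f m"
  for f :: "'a::comm_ring_1 mpoly"
proof (induction f rule: mpoly_induct)
  case (add m' d f)
  then show ?case by (simp add: distrib_left lookup_add mult_single lookup_single when_def)
qed simp

lemma supp_mon_mult: "supp (mon a c * f) \<subseteq> (+) a ` supp f"
  for f :: "'a::comm_ring_1 mpoly"
  using keys_mult[of "mon a c" f] by (auto split: if_splits)

lemma is_lm_mon_mult:
  fixes f :: "'a::comm_ring_1 mpoly"
  assumes "is_lm f m" shows "is_lm (mon a 1 * f) (a + m)"
  unfolding is_lm_def
proof (intro conjI ballI)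
  show "a + m \<in> supp (mon a 1 * f)"
    using assms by (auto simp: is_lm_def in_keys_iff coef_mon_mult)
  fix m' assume "m' \<in> supp (mon a 1 * f)"
  then obtain n where "n \<in> supp f" "m' = a + n"
    using supp_mon_mult[of a 1 f] by blast
  then show "mle m' (a + m)"
    using assms mle_add by (simp add: is_lm_def)
qed

definition mons :: "nat set \<Rightarrow> nat \<Rightarrow> nat multiset set"
  where "mons V t = {m. set_mset m \<subseteq> V \<and> size m \<le> t}"

lemma finite_mons [simp]: "finite V \<Longrightarrow> finite (mons V t)"
proof (induction t)
  case 0
  have "mons V 0 \<subseteq> {{#}}" by (auto simp: mons_def)
  then show ?case by (rule finite_subset) auto
next
  case (Suc t)
  have "mons V (Suc t) \<subseteq> insert {#} ((\<lambda>(i, m). add_mset i m) ` (V \<times> mons V t))"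
  proof
    fix m assume "m \<in> mons V (Suc t)"
    then show "m \<in> insert {#} ((\<lambda>(i, m). add_mset i m) ` (V \<times> mons V t))"
      by (cases m) (auto simp: mons_def intro!: image_eqI)
  qed
  then show ?case using Suc by (auto intro: finite_subset)
qed

text \<open>Pascal's rule: a monomial either avoids the new variable or is a multiple of it.\<close>

lemma card_mons:
  assumes "finite V" shows "card (mons V t) = (t + card V) choose card V"
  using assms
proof (induction V arbitrary: t)
  case empty
  have "mons {} t = {{#}}" by (auto simp: mons_def)
  then show ?case by simp
next
  case (insert x V)
  show ?case
  proof (induction t)
    case 0
    have "mons (insert x V) 0 = {{#}}" by (auto simp: mons_def)
    then show ?case by simp
  next
    case (Suc t)
    have eq: "mons (insert x V) (Suc t) = mons V (Suc t) \<union> add_mset x ` mons (insert x V) t"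
    proof (intro equalityI subsetI)
      fix m assume m: "m \<in> mons (insert x V) (Suc t)"
      show "m \<in> mons V (Suc t) \<union> add_mset x ` mons (insert x V) t"
      proof (cases "x \<in># m")
        case True
        then obtain m' where "m = add_mset x m'" by (metis mset_add)
        with m show ?thesis by (auto simp: mons_def)
      next
        case False
        with m show ?thesis by (auto simp: mons_def)
      qed
    qed (auto simp: mons_def)
    have "card (mons (insert x V) (Suc t)) = card (mons V (Suc t)) + card (add_mset x ` mons (insert x V) t)"
      unfolding eq
    proof (rule card_Un_disjoint)
      show "finite (mons V (Suc t))" "finite (add_mset x ` mons (insert x V) t)"
        using insert.hyps by simp_all
      show "mons V (Suc t) \<inter> add_mset x ` mons (insert x V) t = {}"
        using insert.hyps by (auto simp: mons_def)
    qed
    also have "card (add_mset x ` mons (insert x V) t) = card (mons (insert x V) t)"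
      by (intro card_image) (auto simp: inj_on_def)
    finally show ?case using Suc insert by simp
  qed
qed

section \<open>Linear systems\<close>

text \<open>Unknowns are indexed by \<open>A\<close> and equations by \<open>B\<close>; the proof
  eliminates one equation at a time. The comparisons of dimensions below are reduced to this
  statement, so that no vector spaces have to be set up.\<close>

lemma underdetermined_system:
  fixes M :: "'i \<Rightarrow> 'k \<Rightarrow> 'a::field"
  assumes "finite A" "finite B" "card B < card A"
  shows "\<exists>c. (\<exists>a\<in>A. c a \<noteq> 0) \<and> (\<forall>b\<in>B. (\<Sum>a\<in>A. c a * M a b) = 0)"
  using assms(2,1,3)
proof (induction B arbitrary: A M)
  case empty
  then show ?case by (intro exI[of _ "\<lambda>_. 1"]) (auto simp: card_gt_0_iff)
next
  case (insert b B)
  show ?case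
  proof (cases "\<forall>a\<in>A. M a b = 0")
    case True
    have "card B < card A" using insert.prems insert.hyps by simp
    from insert.IH[OF insert.prems(1) this, of M]
    obtain c where c: "\<exists>a\<in>A. c a \<noteq> 0" "\<forall>b\<in>B. (\<Sum>a\<in>A. c a * M a b) = 0"
      by blast
    moreover have "(\<Sum>a\<in>A. c a * M a b) = 0" using True by (simp add: sum.neutral)
    ultimately show ?thesis by blast
  next
    case False
    then obtain p where p: "p \<in> A" "M p b \<noteq> 0" by blast
    \<comment> \<open>Eliminating the pivot unknown turns the remaining equations into a system with
      matrix \<open>N\<close>.\<close>
    define N where "N a b' = M a b' - M a b / M p b * M p b'" for a b'
    have "card B < card (A - {p})" using insert.prems insert.hyps p by simp
    then have "\<exists>c. (\<exists>a\<in>A - {p}. c a \<noteq> 0) \<and> (\<forall>b'\<in>B. (\<Sum>a\<in>A - {p}. c a * N a b') = 0)"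
      using insert.IH[of "A - {p}" N] insert.prems(1) by simp
    then obtain c where c: "\<exists>a\<in>A - {p}. c a \<noteq> 0" "\<forall>b'\<in>B. (\<Sum>a\<in>A - {p}. c a * N a b') = 0"
      by blast
    \<comment> \<open>The value that equation \<open>b\<close> forces on the pivot unknown.\<close>
    define q where "q = - (\<Sum>a\<in>A - {p}. c a * M a b) / M p b"
    define c' where "c' a = (if a = p then q else c a)" for a
    have rest: "(\<Sum>a\<in>A - {p}. c' a * M a b') = (\<Sum>a\<in>A - {p}. c a * M a b')" for b'
      by (rule sum.cong) (auto simp: c'_def)
    have split: "(\<Sum>a\<in>A. c' a * M a b') = q * M p b' + (\<Sum>a\<in>A - {p}. c a * M a b')" for b'
      using sum.remove[OF insert.prems(1) p(1), of "\<lambda>a. c' a * M a b'"] by (simp add: rest c'_def)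
    have N: "(\<Sum>a\<in>A - {p}. c a * N a b') = (\<Sum>a\<in>A - {p}. c a * M a b') + q * M p b'" for b'
    proof -
      have "c a * N a b' = c a * M a b' - c a * M a b * (M p b' / M p b)" for a
        by (simp add: N_def algebra_simps)
      then show ?thesis
        by (simp only: sum_subtractf sum_distrib_right [symmetric]) (simp add: q_def)
    qed
    have "(\<Sum>a\<in>A. c' a * M a b') = 0" if "b' \<in> insert b B" for b'
    proof (cases "b' = b")
      case True
      then show ?thesis using p by (simp add: split q_def)
    next
      case False
      then show ?thesis using that c N[of b'] by (simp add: split add.commute)
    qed
    moreover have "\<exists>a\<in>A. c' a \<noteq> 0" using c by (auto simp: c'_def)
    ultimately show ?thesis by blast
  qed
qed

section \<open>Ideals and their Hilbert functions\<close>

definition pideal :: "'a::comm_ring_1 mpoly set \<Rightarrow> bool"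
  where "pideal I \<longleftrightarrow> 0 \<in> I \<and> (\<forall>f\<in>I. \<forall>g\<in>I. f + g \<in> I) \<and> (\<forall>f\<in>I. \<forall>g. g * f \<in> I)"

definition LM :: "'a::zero mpoly set \<Rightarrow> nat multiset set"
  where "LM I = {m. \<exists>f\<in>I. is_lm f m}"

definition stdm :: "'a::zero mpoly set \<Rightarrow> nat \<Rightarrow> nat multiset set"
  where "stdm I t = {m. m \<notin> LM I \<and> size m \<le> t}"

text \<open>For the ideals below this is the affine Hilbert function: as the order is graded, the
  standard monomials represent a basis of the polynomials of degree at most \<open>t\<close> modulo
  those in \<open>I\<close>.\<close>

definition HF :: "'a::zero mpoly set \<Rightarrow> nat \<Rightarrow> nat"
  where "HF I t = card (stdm I t)"

definition dle :: "nat \<Rightarrow> 'a::zero mpoly \<Rightarrow> bool"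
  where "dle t f \<longleftrightarrow> (\<forall>m\<in>supp f. size m \<le> t)"

lemma supp_sum: "supp (sum f A) \<subseteq> (\<Union>a\<in>A. supp (f a))"
proof (induction A rule: infinite_finite_induct)
  case (insert a A)
  then show ?case using Poly_Mapping.keys_add[of "f a" "sum f A"] by auto
qed auto

lemma supp_Cst_mult: "supp (Cst c * f) \<subseteq> supp f" for f :: "'a::comm_ring_1 mpoly"
  using supp_mon_mult[of "{#}" c f] by auto

lemma coef_Cst_mult [simp]: "coef (Cst c * f) m = c * coef f m" for f :: "'a::comm_ring_1 mpoly"
  using coef_mon_mult[of "{#}" c f m] by simp

lemma Cst_mult_mon: "Cst c * mon m d = mon m (c * d)" for c d :: "'a::comm_ring_1"
  by (simp add: mult_single)

lemma dle_0 [simp]: "dle t 0"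
  and dle_mon: "size m \<le> t \<Longrightarrow> dle t (mon m c)"
  by (auto simp: dle_def)

lemma dle_mono: "dle s f \<Longrightarrow> s \<le> t \<Longrightarrow> dle t f"
  by (force simp: dle_def)

lemma dle_add: "dle t f \<Longrightarrow> dle t g \<Longrightarrow> dle t (f + g)"
  using Poly_Mapping.keys_add[of f g] by (auto simp: dle_def)

lemma dle_uminus: "dle t f \<Longrightarrow> dle t (- f)" for f :: "'a::ab_group_add mpoly"
  by (auto simp: dle_def in_keys_iff)

lemma dle_diff: "dle t f \<Longrightarrow> dle t g \<Longrightarrow> dle t (f - g)" for f :: "'a::ab_group_add mpoly"
  using dle_add[of t f "- g"] dle_uminus[of t g] by simp

lemma dle_sum: "(\<And>a. a \<in> A \<Longrightarrow> dle t (f a)) \<Longrightarrow> dle t (sum f A)"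
  by (induction A rule: infinite_finite_induct) (auto intro: dle_add)

lemma dle_mult: "dle s f \<Longrightarrow> dle t g \<Longrightarrow> dle (s + t) (f * g)" for f :: "'a::comm_ring_1 mpoly"
  using keys_mult[of f g] by (fastforce simp: dle_def intro: add_mono)

lemma dle_1 [simp]: "dle t (1 :: 'a::comm_ring_1 mpoly)"
  by (auto simp: dle_def)

lemma dle_prod:
  fixes f :: "'b \<Rightarrow> 'a::comm_ring_1 mpoly"
  assumes "\<And>a. a \<in> A \<Longrightarrow> dle (d a) (f a)"
  shows "dle (sum d A) (prod f A)"
  using assms by (induction A rule: infinite_finite_induct) (auto intro: dle_mult)

lemma ex_dle: "\<exists>t. dle t f"
proof -
  have "dle (Max (size ` supp f)) f" by (auto simp: dle_def)
  then show ?thesis ..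
qed

text \<open>Polynomials may contain any variable \<open>i :: nat\<close>. An ideal in the variables \<open>V\<close> is represented by the ideal that
  it generates together with all other variables, which has the same Hilbert function.\<close>

locale var_ideal =
  fixes V :: "nat set" and I :: "'a::field mpoly set"
  assumes finV: "finite V"
    and ideal: "pideal I"
    and outside: "i \<notin> V \<Longrightarrow> Var i \<in> I"
begin

lemma zero_mem [simp]: "0 \<in> I"
  and add_mem: "f \<in> I \<Longrightarrow> g \<in> I \<Longrightarrow> f + g \<in> I"
  and mult_mem: "f \<in> I \<Longrightarrow> g * f \<in> I"
  using ideal by (auto simp: pideal_def)

lemma mult_mem': "f \<in> I \<Longrightarrow> f * g \<in> I"
  using mult_mem[of f g] by (simp add: mult.commute)

lemma uminus_mem: "f \<in> I \<Longrightarrow> - f \<in> I"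
  using mult_mem[of f "-1"] by simp

lemma diff_mem: "f \<in> I \<Longrightarrow> g \<in> I \<Longrightarrow> f - g \<in> I"
  using add_mem[of f "- g"] uminus_mem by simp

lemma sum_mem: "(\<And>a. a \<in> A \<Longrightarrow> f a \<in> I) \<Longrightarrow> sum f A \<in> I"
  by (induction A rule: infinite_finite_induct) (auto intro: add_mem)

lemma LM_up: "m \<in> LM I \<Longrightarrow> a + m \<in> LM I"
  using is_lm_mon_mult mult_mem unfolding LM_def by blast

lemma LM_up': "m \<in> LM I \<Longrightarrow> m \<subseteq># m' \<Longrightarrow> m' \<in> LM I"
  using LM_up[of m "m' - m"] by simp

lemma std_vars: "m \<notin> LM I \<Longrightarrow> set_mset m \<subseteq> V"
proof
  fix i assume m: "m \<notin> LM I" "i \<in># m"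
  have "{#i#} \<in> LM I" if "i \<notin> V"
    using outside[OF that] by (auto simp: LM_def is_lm_def intro!: bexI[of _ "Var i"])
  then show "i \<in> V" using LM_up'[of "{#i#}" m] m by auto
qed

lemma stdm_subset: "stdm I t \<subseteq> mons V t"
  using std_vars by (auto simp: stdm_def mons_def)

lemma finite_stdm [simp]: "finite (stdm I t)"
  using stdm_subset finite_mons[OF finV] finite_subset by blast

lemma HF_le_mons: "HF I t \<le> card (mons V t)"
  unfolding HF_def using stdm_subset finite_mons[OF finV] by (intro card_mono) auto

lemma HF_mono: "s \<le> t \<Longrightarrow> HF I s \<le> HF I t"
  unfolding HF_def by (intro card_mono finite_stdm) (auto simp: stdm_def)

text \<open>Division by all of \<open>I\<close> at once: modulo \<open>I\<close> a leading monomial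
  is a combination of smaller monomials, and the order is well-founded.\<close>

lemma normal_form_mon: "\<exists>g. (\<forall>m'\<in>supp g. m' \<notin> LM I \<and> mle m' m) \<and> mon m 1 - g \<in> I"
proof (induction m rule: wf_induct_rule[OF wf_mless])
  case (1 m)
  show ?case
  proof (cases "m \<in> LM I")
    case False
    then show ?thesis by (intro exI[of _ "mon m 1"]) simp
  next
    case True
    then obtain f where f: "f \<in> I" "is_lm f m" by (auto simp: LM_def)
    define c where "c = coef f m"
    have c: "c \<noteq> 0" using f by (simp add: c_def is_lm_def in_keys_iff)
    define r where "r = mon m 1 - Cst (inverse c) * f"
    have r: "mless m' m" if "m' \<in> supp r" for m'
    proof -
      have cr: "coef r m' = (if m = m' then 1 else 0) - inverse c * coef f m'"
        by (simp add: r_def lookup_minus lookup_single when_def)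
      have nz: "coef r m' \<noteq> 0" using that by (simp add: in_keys_iff)
      have "m' \<noteq> m" using nz c by (auto simp: cr c_def)
      moreover from this have "m' \<in> supp f" using nz by (auto simp: cr in_keys_iff)
      ultimately show ?thesis using f(2) by (auto simp: is_lm_def mle_def)
    qed
    have "\<forall>m'\<in>supp r. \<exists>g. (\<forall>m''\<in>supp g. m'' \<notin> LM I \<and> mle m'' m') \<and> mon m' 1 - g \<in> I"
      using 1 r by auto
    then obtain G where G: "\<forall>m'\<in>supp r. (\<forall>m''\<in>supp (G m'). m'' \<notin> LM I \<and> mle m'' m') \<and> mon m' 1 - G m' \<in> I"
      by metis
    define g where "g = (\<Sum>m'\<in>supp r. Cst (coef r m') * G m')"
    have "m' \<notin> LM I \<and> mle m' m" if m': "m' \<in> supp g" for m'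
    proof -
      obtain n where n: "n \<in> supp r" "m' \<in> supp (Cst (coef r n) * G n)"
        using m' supp_sum[of "\<lambda>m'. Cst (coef r m') * G m'" "supp r"]
        unfolding g_def by blast
      from n(2) have n2: "m' \<in> supp (G n)" using supp_Cst_mult by fast
      with n(1) have "mle m' n" "mle n m" "m' \<notin> LM I" using G r by (auto simp: mle_def)
      then show ?thesis using mle_trans by blast
    qed
    moreover have "mon m 1 - g \<in> I"
    proof -
      have "r = (\<Sum>m'\<in>supp r. Cst (coef r m') * mon m' 1)"
        using poly_eq_sum_mon[of r] by (simp add: Cst_mult_mon)
      then have "r - g = (\<Sum>m'\<in>supp r. Cst (coef r m') * (mon m' 1 - G m'))"
        by (simp add: g_def right_diff_distrib sum_subtractf)
      also have "\<dots> \<in> I" using G by (intro sum_mem mult_mem) auto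
      finally have "(r - g) + Cst (inverse c) * f \<in> I" using f by (intro add_mem mult_mem)
      then show ?thesis by (simp add: r_def algebra_simps)
    qed
    ultimately show ?thesis by blast
  qed
qed

lemma normal_form:
  "\<exists>g. (\<forall>m\<in>supp g. m \<notin> LM I \<and> (\<exists>m'\<in>supp f. mle m m')) \<and> f - g \<in> I"
proof -
  obtain G where G: "\<And>m. (\<forall>m'\<in>supp (G m). m' \<notin> LM I \<and> mle m' m) \<and> mon m 1 - G m \<in> I"
    using normal_form_mon by metis
  define g where "g = (\<Sum>m\<in>supp f. Cst (coef f m) * G m)"
  have "m \<notin> LM I \<and> (\<exists>m'\<in>supp f. mle m m')" if "m \<in> supp g" for m
    using that supp_sum[of "\<lambda>m. Cst (coef f m) * G m" "supp f"] supp_Cst_mult G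
    unfolding g_def by blast
  moreover have "f - g \<in> I"
  proof -
    have "f = (\<Sum>m\<in>supp f. Cst (coef f m) * mon m 1)"
      using poly_eq_sum_mon[of f] by (simp add: Cst_mult_mon)
    then have "f - g = (\<Sum>m\<in>supp f. Cst (coef f m) * (mon m 1 - G m))"
      by (simp add: g_def right_diff_distrib sum_subtractf)
    also have "\<dots> \<in> I" using G by (intro sum_mem mult_mem) auto
    finally show ?thesis .
  qed
  ultimately show ?thesis by blast
qed

lemma normal_form_dle:
  assumes "dle t f" shows "\<exists>c. f - (\<Sum>m\<in>stdm I t. mon m (c m)) \<in> I"
proof -
  obtain g where g: "\<forall>m\<in>supp g. m \<notin> LM I \<and> (\<exists>m'\<in>supp f. mle m m')" "f - g \<in> I"
    using normal_form by blast
  have "supp g \<subseteq> stdm I t"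
    using g(1) assms mle_size by (fastforce simp: stdm_def dle_def)
  then have "g = (\<Sum>m\<in>stdm I t. mon m (coef g m))"
    by (subst poly_eq_sum_mon, intro sum.mono_neutral_left) (auto simp: in_keys_iff)
  then show ?thesis using g(2) by metis
qed

lemma std_indep: "f \<in> I \<Longrightarrow> supp f \<inter> LM I = {} \<Longrightarrow> f = 0"
  using ex_is_lm[of f] by (auto simp: LM_def is_lm_def)

lemma std_sum_indep:
  assumes "(\<Sum>m\<in>stdm I t. mon m (c m)) \<in> I" "m \<in> stdm I t" shows "c m = 0"
proof -
  let ?f = "\<Sum>m\<in>stdm I t. mon m (c m)"
  have "supp ?f \<subseteq> stdm I t"
    using supp_sum[of "\<lambda>m. mon m (c m)" "stdm I t"] by (auto split: if_splits)
  then have "?f = 0" using assms(1) std_indep by (auto simp: stdm_def)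
  then have "coef ?f m = 0" by simp
  then show ?thesis using assms(2) by (simp add: lookup_sum lookup_single when_def)
qed

text \<open>The normal forms of the \<open>f a\<close> are vectors of length \<open>HF I t\<close>.
  If there are more of them than that, some nontrivial combination has normal form zero and lies in
  \<open>I\<close>.\<close>

lemma indep_card_le:
  assumes "finite A" "\<And>a. a \<in> A \<Longrightarrow> dle t (f a)"
    and indep: "\<And>c a. (\<Sum>a\<in>A. Cst (c a) * f a) \<in> I \<Longrightarrow> a \<in> A \<Longrightarrow> c a = 0"
  shows "card A \<le> HF I t"
proof (rule ccontr)
  assume "\<not> ?thesis"
  then have less: "card (stdm I t) < card A" by (simp add: HF_def)
  have "\<forall>a\<in>A. \<exists>c. f a - (\<Sum>m\<in>stdm I t. mon m (c m)) \<in> I"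
    using assms(2) normal_form_dle by blast
  then obtain M where M: "\<And>a. a \<in> A \<Longrightarrow> f a - (\<Sum>m\<in>stdm I t. mon m (M a m)) \<in> I"
    by metis
  obtain c where c: "\<exists>a\<in>A. c a \<noteq> 0" "\<forall>m\<in>stdm I t. (\<Sum>a\<in>A. c a * M a m) = 0"
    using underdetermined_system[OF assms(1) finite_stdm less, of M] by blast
  have "(\<Sum>a\<in>A. Cst (c a) * (\<Sum>m\<in>stdm I t. mon m (M a m))) = (\<Sum>m\<in>stdm I t. mon m (\<Sum>a\<in>A. c a * M a m))"
    by (rule poly_mapping_eqI) (simp add: lookup_sum lookup_single when_def)
  also have "\<dots> = 0" using c(2) by simp
  finally have "(\<Sum>a\<in>A. Cst (c a) * f a) = (\<Sum>a\<in>A. Cst (c a) * (f a - (\<Sum>m\<in>stdm I t. mon m (M a m))))"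
    by (simp add: right_diff_distrib sum_subtractf)
  also have "\<dots> \<in> I" using M by (intro sum_mem mult_mem) auto
  finally show False using indep c(1) by blast
qed

text \<open>Dual to \<open>indep_card_le\<close>: if fewer polynomials spanned the standard
  monomials modulo \<open>I\<close>, then a nontrivial combination of standard monomials would lie
  in \<open>I\<close>.\<close>

lemma HF_le_card:
  assumes "finite B" and span: "\<And>m. m \<in> stdm I t \<Longrightarrow> \<exists>c. mon m 1 - (\<Sum>b\<in>B. Cst (c b) * g b) \<in> I"
  shows "HF I t \<le> card B"
proof (rule ccontr)
  assume "\<not> ?thesis"
  then have less: "card B < card (stdm I t)" by (simp add: HF_def)
  obtain M where M: "\<And>m. m \<in> stdm I t \<Longrightarrow> mon m 1 - (\<Sum>b\<in>B. Cst (M m b) * g b) \<in> I"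
    using span by metis
  obtain c where c: "\<exists>m\<in>stdm I t. c m \<noteq> 0" "\<forall>b\<in>B. (\<Sum>m\<in>stdm I t. c m * M m b) = 0"
    using underdetermined_system[OF finite_stdm assms(1) less, of M] by blast
  have "(\<Sum>m\<in>stdm I t. Cst (c m) * (\<Sum>b\<in>B. Cst (M m b) * g b)) = (\<Sum>b\<in>B. Cst (\<Sum>m\<in>stdm I t. c m * M m b) * g b)"
    by (rule poly_mapping_eqI)
      (simp add: lookup_sum sum_distrib_left sum_distrib_right mult.assoc sum.swap[of _ B])
  also have "\<dots> = 0" using c(2) by simp
  finally have "(\<Sum>m\<in>stdm I t. mon m (c m)) = (\<Sum>m\<in>stdm I t. Cst (c m) * (mon m 1 - (\<Sum>b\<in>B. Cst (M m b) * g b)))"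
    by (simp add: right_diff_distrib sum_subtractf Cst_mult_mon)
  also have "\<dots> \<in> I" using M by (intro sum_mem mult_mem) auto
  finally show False using std_sum_indep c(1) by blast
qed

end

lemma LM_mono: "I \<subseteq> J \<Longrightarrow> LM I \<subseteq> LM J"
  by (auto simp: LM_def)

lemma HF_antimono:
  assumes "var_ideal V I" "I \<subseteq> J" shows "HF J t \<le> HF I t"
  unfolding HF_def using LM_mono[OF assms(2)] var_ideal.finite_stdm[OF assms(1)]
  by (intro card_mono) (force simp: stdm_def)+

subsection \<open>The growth dichotomy\<close>

lemma card_bounded_multisets:
  assumes "finite V"
  shows "finite {m. set_mset m \<subseteq> V \<and> (\<forall>i\<in>V. count m i \<le> b i)}" (is "finite ?Q")
    and "card {m. set_mset m \<subseteq> V \<and> (\<forall>i\<in>V. count m i \<le> b i)} \<le> (\<Prod>i\<in>V. b i + 1)"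
proof -
  let ?\<phi> = "\<lambda>m. restrict (count m) V"
  have inj: "inj_on ?\<phi> ?Q"
  proof (rule inj_onI)
    fix m m' assume m: "m \<in> ?Q" "m' \<in> ?Q" "?\<phi> m = ?\<phi> m'"
    show "m = m'"
    proof (rule multiset_eqI)
      fix i show "count m i = count m' i"
      proof (cases "i \<in> V")
        case True
        then show ?thesis using fun_cong[OF m(3), of i] by simp
      next
        case False
        then have "i \<notin># m" "i \<notin># m'" using m by auto
        then show ?thesis by (simp add: not_in_iff)
      qed
    qed
  qed
  have sub: "?\<phi> ` ?Q \<subseteq> (\<Pi>\<^sub>E i\<in>V. {..b i})" by auto
  have fin: "finite (\<Pi>\<^sub>E i\<in>V. {..b i})" using assms by (intro finite_PiE) auto
  show "finite ?Q" using finite_subset[OF sub fin] inj finite_imageD by blast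
  have "card ?Q \<le> card (\<Pi>\<^sub>E i\<in>V. {..b i})" using inj sub fin by (rule card_inj_on_le)
  also have "\<dots> = (\<Prod>i\<in>V. b i + 1)" using assms by (simp add: card_PiE)
  finally show "card ?Q \<le> (\<Prod>i\<in>V. b i + 1)" .
qed

text \<open>If there are fewer standard monomials of degree at most \<open>t\<close> than monomials in \<open>j\<close> variables,
  then every \<open>j\<close> variables carry a leading monomial of degree at most \<open>t\<close>, so in a standard
  monomial fewer than \<open>j\<close> exponents reach \<open>t\<close>.\<close>

lemma (in var_ideal) HF_growth:
  assumes "HF I t < (t + j) choose j"
  shows "HF I s * (s + 1) \<le> 2 ^ card V * (t + 1) ^ card V * (s + 1) ^ j"
proof -
  \<comment> \<open>The set \<open>T\<close> collects the variables whose exponents may be large. By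
    \<open>few\<close> it has fewer than \<open>j\<close> elements, and there are at most
    \<open>2 ^ card V\<close> such sets, which is the first factor of the constant.\<close>
  define Q where "Q T = {m. set_mset m \<subseteq> V \<and> (\<forall>i\<in>V. count m i \<le> (if i \<in> T then s else t))}" for T
  have few: "card {i \<in> V. t \<le> count m i} < j" if m: "m \<notin> LM I" for m
  proof (rule ccontr)
    assume "\<not> ?thesis"
    then obtain S where S: "S \<subseteq> {i \<in> V. t \<le> count m i}" "card S = j"
      using obtain_subset_with_card_n by (metis not_less)
    have finS: "finite S" using S finV by (auto intro: finite_subset)
    have "\<not> mons S t \<subseteq> stdm I t"
      using assms S card_mons[OF finS, of t] card_mono[OF finite_stdm, of "mons S t" t]
      by (auto simp: HF_def)
    then obtain a where a: "set_mset a \<subseteq> S" "size a \<le> t" "a \<in> LM I"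
      by (auto simp: mons_def stdm_def)
    have "count a i \<le> count m i" for i
    proof (cases "i \<in># a")
      case True
      then have "t \<le> count m i" using a S by auto
      moreover have "count a i \<le> size a" by (rule count_le_size)
      ultimately show ?thesis using a by linarith
    qed (simp add: not_in_iff)
    then have "a \<subseteq># m" by (simp add: subseteq_mset_def)
    then show False using a m LM_up' by blast
  qed
  define \<T> where "\<T> = {T \<in> Pow V. card T < j}"
  have \<T>: "finite \<T>" "card \<T> \<le> 2 ^ card V"
    using finV card_mono[of "Pow V" \<T>] by (auto simp: \<T>_def card_Pow)
  have sub: "stdm I s \<subseteq> (\<Union>T\<in>\<T>. Q T)"
  proof
    fix m assume m: "m \<in> stdm I s"
    let ?T = "{i \<in> V. t \<le> count m i}"
    have "?T \<in> \<T>" using few m by (auto simp: \<T>_def stdm_def)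
    moreover have "count m i \<le> s" for i
      using m count_le_size[of m i] by (simp add: stdm_def)
    then have "m \<in> Q ?T" using std_vars[of m] m by (auto simp: Q_def stdm_def)
    ultimately show "m \<in> (\<Union>T\<in>\<T>. Q T)" by blast
  qed
  have cardQ: "card (Q T) * (s + 1) \<le> (t + 1) ^ card V * (s + 1) ^ j" if "T \<in> \<T>" for T
  proof -
    have T: "T \<subseteq> V" "card T < j" "finite T" using that finV by (auto simp: \<T>_def intro: finite_subset)
    have "card (Q T) \<le> (\<Prod>i\<in>V. (if i \<in> T then s else t) + 1)"
      unfolding Q_def by (rule card_bounded_multisets(2)[OF finV])
    also have "\<dots> \<le> (\<Prod>i\<in>V. (t + 1) * (if i \<in> T then s + 1 else 1))"
      by (intro prod_mono) auto
    also have "\<dots> = (t + 1) ^ card V * (s + 1) ^ card T"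
    proof -
      have "(\<Prod>i\<in>V. if i \<in> T then s + 1 else 1) = (s + 1) ^ card T"
        using T finV by (simp add: prod.If_cases Int_absorb1)
      then show ?thesis by (simp only: prod.distrib prod_constant)
    qed
    finally have "card (Q T) \<le> (t + 1) ^ card V * (s + 1) ^ card T" .
    \<comment> \<open>One factor \<open>s + 1\<close> goes to the left; this uses
      \<open>card T + 1 \<le> j\<close> and avoids the exponent \<open>j - 1\<close>.\<close>
    from mult_le_mono1[OF this, of "s + 1"]
    have "card (Q T) * (s + 1) \<le> (t + 1) ^ card V * (s + 1) ^ (card T + 1)"
      by (simp only: mult.assoc power_add power_one_right)
    also have "\<dots> \<le> (t + 1) ^ card V * (s + 1) ^ j"
      using T by (intro mult_le_mono2 power_increasing) auto
    finally show ?thesis .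
  qed
  have "HF I s \<le> (\<Sum>T\<in>\<T>. card (Q T))"
  proof -
    have "finite (Q T)" for T unfolding Q_def by (rule card_bounded_multisets[OF finV])
    then have "card (stdm I s) \<le> card (\<Union>T\<in>\<T>. Q T)" using sub \<T> by (intro card_mono) auto
    also have "\<dots> \<le> (\<Sum>T\<in>\<T>. card (Q T))" using \<T> by (intro card_UN_le)
    finally show ?thesis by (simp add: HF_def)
  qed
  then have "HF I s * (s + 1) \<le> (\<Sum>T\<in>\<T>. card (Q T)) * (s + 1)" by (intro mult_le_mono1)
  also have "\<dots> = (\<Sum>T\<in>\<T>. card (Q T) * (s + 1))" by (rule sum_distrib_right)
  also have "\<dots> \<le> (\<Sum>T\<in>\<T>. (t + 1) ^ card V * (s + 1) ^ j)" by (intro sum_mono cardQ)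
  also have "\<dots> = card \<T> * ((t + 1) ^ card V * (s + 1) ^ j)" by simp
  also have "\<dots> \<le> 2 ^ card V * ((t + 1) ^ card V * (s + 1) ^ j)" using \<T> by (intro mult_le_mono1)
  finally show ?thesis by (simp only: mult.assoc)
qed

text \<open>The factor \<open>j ^ j\<close> comes from the estimate
  \<open>(N / j) ^ j \<le> N choose j\<close> at \<open>N = t + j\<close>.\<close>

lemma power_le_binomial: "(t + 1) ^ j \<le> j ^ j * ((t + j) choose j)"
proof (cases "j = 0")
  case False
  have "(real (t + j) / real j) ^ j \<le> real ((t + j) choose j)"
    by (rule binomial_ge_n_over_k_pow_k) simp
  then have "real (t + j) ^ j \<le> real j ^ j * real ((t + j) choose j)"
    using False by (simp add: power_divide divide_le_eq mult.commute)
  then have "(t + j) ^ j \<le> j ^ j * ((t + j) choose j)"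
    by (metis of_nat_le_iff of_nat_mult of_nat_power)
  moreover have "(t + 1) ^ j \<le> (t + j) ^ j" using False by (intro power_mono) auto
  ultimately show ?thesis by linarith
qed simp

text \<open>If the bound failed at one \<open>t\<close>, then by \<open>HF_growth\<close> the values
  \<open>HF I s\<close> would grow at most like \<open>s ^ (j - 1)\<close>. A lower bound of order
  \<open>s ^ j\<close> along the multiples of \<open>e\<close> excludes this.\<close>

lemma (in var_ideal) HF_ge_of_sparse:
  assumes e: "e > 0" and ge: "\<And>t. (t + j) choose j \<le> HF I (e * t)"
  shows "(t + j) choose j \<le> HF I t"
proof (rule ccontr)
  assume "\<not> ?thesis"
  then have less: "HF I t < (t + j) choose j" by simp
  define K where "K = 2 ^ card V * (t + 1) ^ card V"
  define B where "B = j ^ j * K * (e + 1) ^ j"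
  have bd: "e * s + 1 \<le> B" for s
  proof -
    have "(s + 1) ^ j * (e * s + 1) \<le> j ^ j * ((s + j) choose j) * (e * s + 1)"
      by (intro mult_le_mono1 power_le_binomial)
    also have "\<dots> \<le> j ^ j * (HF I (e * s) * (e * s + 1))"
      using ge[of s] by (metis mult.assoc mult_le_mono1 mult_le_mono2)
    also have "\<dots> \<le> j ^ j * (K * (e * s + 1) ^ j)"
      unfolding K_def by (intro mult_le_mono2 HF_growth[OF less])
    also have "\<dots> \<le> j ^ j * (K * ((e + 1) * (s + 1)) ^ j)"
      by (intro mult_le_mono2 power_mono) auto
    also have "\<dots> = (s + 1) ^ j * B" by (simp only: B_def power_mult_distrib mult_ac)
    finally show ?thesis by (rule iffD1[OF nat_mult_le_cancel1, rotated]) simp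
  qed
  obtain e' where "e = Suc e'" using e gr0_implies_Suc by blast
  then show False using bd[of B] by simp
qed

section \<open>Closed sets, irreducibility and chains\<close>

text \<open>Points are total functions that vanish outside \<open>V\<close>; this matches the
  convention that all variables outside \<open>V\<close> belong to the ideals.\<close>

definition pts :: "nat set \<Rightarrow> (nat \<Rightarrow> 'a::zero) set"
  where "pts V = {x. \<forall>i. i \<notin> V \<longrightarrow> x i = 0}"

definition vanish :: "(nat \<Rightarrow> 'a::comm_ring_1) set \<Rightarrow> 'a mpoly set"
  where "vanish Z = {f. \<forall>x\<in>Z. ev x f = 0}"

definition zeros :: "nat set \<Rightarrow> 'a::comm_ring_1 mpoly set \<Rightarrow> (nat \<Rightarrow> 'a) set"
  where "zeros V S = {x \<in> pts V. \<forall>f\<in>S. ev x f = 0}"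

definition zclosed :: "nat set \<Rightarrow> (nat \<Rightarrow> 'a::comm_ring_1) set \<Rightarrow> bool"
  where "zclosed V Z \<longleftrightarrow> (\<exists>S. Z = zeros V S)"

definition irred :: "nat set \<Rightarrow> (nat \<Rightarrow> 'a::comm_ring_1) set \<Rightarrow> bool"
  where "irred V Y \<longleftrightarrow> zclosed V Y \<and> Y \<noteq> {} \<and>
    (\<forall>A B. zclosed V A \<and> zclosed V B \<and> Y = A \<union> B \<longrightarrow> Y = A \<or> Y = B)"

definition irr_chain :: "nat set \<Rightarrow> nat \<Rightarrow> (nat \<Rightarrow> (nat \<Rightarrow> 'a::comm_ring_1) set) \<Rightarrow> bool"
  where "irr_chain V k Y \<longleftrightarrow> (\<forall>i\<le>k. irred V (Y i)) \<and> (\<forall>i<k. Y i \<subset> Y (Suc i))"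

text \<open>The statement that the Krull dimension of \<open>Z\<close> is at least \<open>k\<close>,
  in a form free of suprema.\<close>

definition has_chain :: "nat set \<Rightarrow> nat \<Rightarrow> (nat \<Rightarrow> 'a::comm_ring_1) set \<Rightarrow> bool"
  where "has_chain V k Z \<longleftrightarrow> (\<exists>Y. irr_chain V k Y \<and> Y k \<subseteq> Z)"

lemma var_ideal_vanish:
  fixes Z :: "(nat \<Rightarrow> 'a::field) set"
  assumes "finite V" "Z \<subseteq> pts V" shows "var_ideal V (vanish Z)"
  using assms by unfold_locales (auto simp: vanish_def pideal_def pts_def)

lemma vanish_antimono: "Y \<subseteq> Z \<Longrightarrow> vanish Z \<subseteq> vanish Y"
  by (auto simp: vanish_def)

lemma zeros_vanish: "zclosed V Z \<Longrightarrow> zeros V (vanish Z) = Z"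
  by (auto simp: zclosed_def zeros_def vanish_def)

lemma zclosed_zeros [simp]: "zclosed V (zeros V S)"
  by (auto simp: zclosed_def)

lemma zclosed_pts: "zclosed V Z \<Longrightarrow> Z \<subseteq> pts V"
  by (auto simp: zclosed_def zeros_def)

lemma zclosed_Int_zero:
  assumes "zclosed V Z" shows "zclosed V {x \<in> Z. ev x f = 0}"
proof -
  obtain S where "Z = zeros V S" using assms by (auto simp: zclosed_def)
  then have "{x \<in> Z. ev x f = 0} = zeros V (insert f S)" by (auto simp: zeros_def)
  then show ?thesis by simp
qed

lemma zclosed_singleton:
  assumes "x \<in> pts V" shows "zclosed V {x}"
proof -
  define S where "S = range (\<lambda>i. Var i - Cst (x i))"
  have "y = x" if y: "y \<in> zeros V S" for y
  proof
    fix i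
    have "Var i - Cst (x i) \<in> S" unfolding S_def by (rule rangeI)
    then have "ev y (Var i - Cst (x i)) = 0" using y by (simp only: zeros_def mem_Collect_eq)
    then show "y i = x i" by simp
  qed
  moreover have "x \<in> zeros V S" using assms by (simp add: zeros_def S_def)
  ultimately have "{x} = zeros V S" by blast
  then show ?thesis by simp
qed

lemma irred_singleton:
  assumes "x \<in> pts V" shows "irred V {x}"
  unfolding irred_def
proof (intro conjI allI impI)
  fix A B assume "zclosed V A \<and> zclosed V B \<and> {x} = A \<union> B"
  then have "x \<in> A \<or> x \<in> B" "A \<subseteq> {x}" "B \<subseteq> {x}" by blast+
  then show "{x} = A \<or> {x} = B" by blast
qed (simp_all add: assms zclosed_singleton)

lemma subset_zclosedI:
  assumes "zclosed V A" "Z \<subseteq> pts V" "vanish A \<subseteq> vanish Z" shows "Z \<subseteq> A"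
proof
  fix x assume "x \<in> Z"
  then have "x \<in> zeros V (vanish A)" using assms(2,3) by (auto simp: zeros_def vanish_def)
  then show "x \<in> A" using zeros_vanish[OF assms(1)] by simp
qed

lemma irred_pts: "irred V Y \<Longrightarrow> Y \<subseteq> pts V"
  using zclosed_pts by (auto simp: irred_def)

lemma zclosed_diff_polynomial:
  assumes "zclosed V A" "Z \<subseteq> pts V" "\<not> Z \<subseteq> A"
  shows "\<exists>f. f \<in> vanish A \<and> f \<notin> vanish Z"
  using subset_zclosedI[OF assms(1,2)] assms(3) by blast

text \<open>A product that vanishes on \<open>Y\<close> covers \<open>Y\<close> by the zero sets of
  its two factors.\<close>

lemma irred_vanish_prime:
  fixes Y :: "(nat \<Rightarrow> 'a::field) set"
  assumes "irred V Y" "f * g \<in> vanish Y" shows "f \<in> vanish Y \<or> g \<in> vanish Y"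
proof -
  have Y: "zclosed V Y" "\<forall>A B. zclosed V A \<and> zclosed V B \<and> Y = A \<union> B \<longrightarrow> Y = A \<or> Y = B"
    using assms(1) unfolding irred_def by blast+
  define A where "A = {x \<in> Y. ev x f = 0}"
  define B where "B = {x \<in> Y. ev x g = 0}"
  have "x \<in> A \<or> x \<in> B" if "x \<in> Y" for x
    using assms(2) that by (simp add: vanish_def A_def B_def)
  moreover have "A \<subseteq> Y" "B \<subseteq> Y" by (simp_all add: A_def B_def)
  ultimately have "Y = A \<union> B" by blast
  moreover have "zclosed V A" "zclosed V B" unfolding A_def B_def by (intro zclosed_Int_zero Y(1))+
  ultimately have "Y = A \<or> Y = B" using Y(2)[rule_format, of A B] by simp
  then have "(\<forall>x\<in>Y. ev x f = 0) \<or> (\<forall>x\<in>Y. ev x g = 0)" unfolding A_def B_def by blast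
  then show ?thesis by (simp add: vanish_def)
qed

lemma irred_vanish_prime_prod:
  fixes Y :: "(nat \<Rightarrow> 'a::field) set"
  assumes "irred V Y" "finite A" "prod g A \<in> vanish Y"
  shows "\<exists>a\<in>A. g a \<in> vanish Y"
  using assms(2,3)
proof (induction A rule: finite_induct)
  case empty
  then show ?case using assms(1) by (auto simp: irred_def vanish_def)
next
  case (insert a A)
  then have "g a * prod g A \<in> vanish Y" by simp
  then have "g a \<in> vanish Y \<or> prod g A \<in> vanish Y" by (rule irred_vanish_prime[OF assms(1)])
  then show ?case using insert.IH by blast
qed

lemma prod_vanishI:
  fixes Y :: "(nat \<Rightarrow> 'a::field) set"
  assumes "finite A" "\<And>x. x \<in> Y \<Longrightarrow> \<exists>a\<in>A. ev x (g a) = 0"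
  shows "prod g A \<in> vanish Y"
proof -
  have "ev x (prod g A) = 0" if "x \<in> Y" for x
    using assms(2)[OF that] assms(1) by (auto intro: prod_zero)
  then show ?thesis by (simp add: vanish_def)
qed

text \<open>Otherwise each member of the cover admits a polynomial that vanishes on it but not on
  \<open>Y\<close>. The product of these vanishes on \<open>Y\<close>, against primality.\<close>

lemma irred_subset_Union:
  fixes Y :: "(nat \<Rightarrow> 'a::field) set"
  assumes "irred V Y" "finite \<A>" "\<And>A. A \<in> \<A> \<Longrightarrow> zclosed V A" "Y \<subseteq> \<Union>\<A>"
  shows "\<exists>A\<in>\<A>. Y \<subseteq> A"
proof (rule ccontr)
  assume "\<not> ?thesis"
  then have "\<forall>A\<in>\<A>. \<exists>g. g \<in> vanish A \<and> g \<notin> vanish Y"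
    using zclosed_diff_polynomial[OF assms(3) irred_pts[OF assms(1)]] by blast
  then obtain G where G: "\<And>A. A \<in> \<A> \<Longrightarrow> G A \<in> vanish A \<and> G A \<notin> vanish Y" by metis
  have "prod G \<A> \<in> vanish Y"
  proof (rule prod_vanishI[OF assms(2)])
    fix x assume "x \<in> Y"
    then obtain A where A: "A \<in> \<A>" "x \<in> A" using assms(4) by blast
    then have "ev x (G A) = 0" using G[OF A(1)] by (simp add: vanish_def)
    then show "\<exists>A\<in>\<A>. ev x (G A) = 0" using A(1) by blast
  qed
  then show False using irred_vanish_prime_prod[OF assms(1,2)] G by blast
qed

section \<open>Hilbert functions along chains of irreducible sets\<close>

lemma one_not_LM:
  assumes "pideal I" "(1 :: 'a::field mpoly) \<notin> I" shows "{#} \<notin> LM I"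
proof
  assume "{#} \<in> LM I"
  then obtain f where f: "f \<in> I" "is_lm f {#}" unfolding LM_def by blast
  define c where "c = coef f {#}"
  have c: "c \<noteq> 0" using f(2) by (simp add: c_def is_lm_def in_keys_iff)
  have other: "coef f m = 0" if m: "m \<noteq> {#}" for m
  proof (rule ccontr)
    assume "coef f m \<noteq> 0"
    then have "mle m {#}" using f(2) by (simp add: is_lm_def in_keys_iff)
    then show False using mle_size[of m "{#}"] m by simp
  qed
  have "Cst (inverse c) * f = 1"
  proof (rule poly_mapping_eqI)
    fix m show "coef (Cst (inverse c) * f) m = coef 1 m"
      using c other[of m] by (cases "m = {#}") (simp_all add: lookup_one c_def [symmetric] when_def)
  qed
  moreover have "Cst (inverse c) * f \<in> I" using assms(1) f(1) unfolding pideal_def by blast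
  ultimately show False using assms(2) by simp
qed

text \<open>Multiplication by \<open>f\<close> is injective modulo the prime ideal
  \<open>vanish Z\<close> and has values in \<open>vanish Y\<close>. Hence the standard monomials of
  \<open>Y\<close> and the products of \<open>f\<close> with those of \<open>Z\<close> in degree
  \<open>t - e\<close> are together independent modulo \<open>vanish Z\<close>.\<close>

lemma HF_chain_step:
  fixes Y Z :: "(nat \<Rightarrow> 'a::field) set"
  assumes V: "finite V" and Z: "irred V Z" and Y: "Y \<subseteq> Z"
    and f: "f \<in> vanish Y" "f \<notin> vanish Z" "dle e f" and "e \<le> t"
  shows "HF (vanish Y) t + HF (vanish Z) (t - e) \<le> HF (vanish Z) t"
proof -
  have "Z \<subseteq> pts V" using Z zclosed_pts by (auto simp: irred_def)
  then interpret Z: var_ideal V "vanish Z" + Y: var_ideal V "vanish Y"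
    using V Y by (auto intro!: var_ideal_vanish)
  let ?A = "stdm (vanish Y) t <+> stdm (vanish Z) (t - e)"
  define F where "F = case_sum (\<lambda>m. mon m 1) (\<lambda>m. f * mon m (1 :: 'a))"
  have split: "(\<Sum>a\<in>?A. Cst (c a) * F a) =
      (\<Sum>m\<in>stdm (vanish Y) t. mon m (c (Inl m))) + f * (\<Sum>m\<in>stdm (vanish Z) (t - e). mon m (c (Inr m)))" for c
  proof -
    have "(\<Sum>a\<in>?A. Cst (c a) * F a) = (\<Sum>m\<in>stdm (vanish Y) t. Cst (c (Inl m)) * F (Inl m))
        + (\<Sum>m\<in>stdm (vanish Z) (t - e). Cst (c (Inr m)) * F (Inr m))"
      by (subst sum.Plus) (simp_all add: o_def)
    moreover have "Cst (c (Inl m)) * F (Inl m) = mon m (c (Inl m))" for m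
      by (simp add: F_def Cst_mult_mon)
    moreover have "Cst (c (Inr m)) * F (Inr m) = f * mon m (c (Inr m))" for m
      by (simp add: F_def mult.left_commute[of "Cst _" f] Cst_mult_mon)
    ultimately show ?thesis by (simp only: sum_distrib_left)
  qed
  have "card ?A \<le> HF (vanish Z) t"
  proof (rule Z.indep_card_le)
    fix a assume a: "a \<in> ?A"
    show "dle t (F a)"
    proof (cases a)
      case (Inl m)
      then have "m \<in> stdm (vanish Y) t" using a by auto
      then show ?thesis by (simp add: F_def Inl stdm_def dle_mon)
    next
      case (Inr m)
      then have "m \<in> stdm (vanish Z) (t - e)" using a by auto
      then have "dle (t - e) (mon m (1 :: 'a))" by (simp add: stdm_def dle_mon)
      then show ?thesis using dle_mult[OF f(3)] \<open>e \<le> t\<close> by (fastforce simp: F_def Inr)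
    qed
  next
    fix c a assume sum: "(\<Sum>a\<in>?A. Cst (c a) * F a) \<in> vanish Z" and a: "a \<in> ?A"
    let ?S = "\<Sum>m\<in>stdm (vanish Y) t. mon m (c (Inl m))"
    let ?T = "\<Sum>m\<in>stdm (vanish Z) (t - e). mon m (c (Inr m))"
    have mem: "?S + f * ?T \<in> vanish Z" using sum by (simp only: split)
    then have "?S + f * ?T \<in> vanish Y" using vanish_antimono[OF Y] by (rule rev_subsetD)
    then have "(?S + f * ?T) - f * ?T \<in> vanish Y"
      using Y.diff_mem Y.mult_mem'[OF f(1)] by blast
    then have "?S \<in> vanish Y" by simp
    then have S0: "c (Inl m) = 0" if "m \<in> stdm (vanish Y) t" for m
      using Y.std_sum_indep[of "\<lambda>m. c (Inl m)"] that by blast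
    then have "?S = 0" by simp
    then have "f * ?T \<in> vanish Z" using mem by simp
    then have "?T \<in> vanish Z" using irred_vanish_prime[OF Z] f(2) by blast
    then have T0: "c (Inr m) = 0" if "m \<in> stdm (vanish Z) (t - e)" for m
      using Z.std_sum_indep[of "\<lambda>m. c (Inr m)"] that by blast
    show "c a = 0" using a S0 T0 by (elim PlusE) simp_all
  qed simp_all
  then show ?thesis by (simp add: card_Plus HF_def)
qed

text \<open>By \<open>HF_chain_step\<close> the differences of the Hilbert function of one link,
  taken with a fixed step, dominate the Hilbert function of the link below. Summation raises the
  order of growth by one, with Pascal's rule as discrete integration.\<close>

lemma irr_chain_HF:
  fixes Y :: "nat \<Rightarrow> (nat \<Rightarrow> 'a::field) set"
  assumes V: "finite V" and "irr_chain V k Y"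
  shows "\<exists>e>0. \<forall>t. (t + k) choose k \<le> HF (vanish (Y k)) (e * t)"
  using assms(2)
proof (induction k)
  case 0
  have Y: "irred V (Y 0)" using 0 by (simp add: irr_chain_def)
  then interpret var_ideal V "vanish (Y 0)"
    using V irred_pts by (auto intro!: var_ideal_vanish)
  have "1 \<notin> vanish (Y 0)" using Y by (auto simp: vanish_def irred_def)
  then have "{#} \<in> stdm (vanish (Y 0)) t" for t
    using one_not_LM ideal by (auto simp: stdm_def)
  then have "card {{#} :: nat multiset} \<le> HF (vanish (Y 0)) t" for t
    unfolding HF_def by (intro card_mono finite_stdm) simp
  then show ?case by (intro exI[of _ 1]) simp
next
  case (Suc k)
  have irr: "irred V (Y k)" "irred V (Y (Suc k))" and sub: "Y k \<subset> Y (Suc k)"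
    using Suc.prems by (auto simp: irr_chain_def)
  interpret A: var_ideal V "vanish (Y k)" using irr V irred_pts by (auto intro!: var_ideal_vanish)
  interpret B: var_ideal V "vanish (Y (Suc k))" using irr V irred_pts by (auto intro!: var_ideal_vanish)
  have "irr_chain V k Y" using Suc.prems by (auto simp: irr_chain_def)
  then obtain e where e: "e > 0" "\<And>t. (t + k) choose k \<le> HF (vanish (Y k)) (e * t)"
    using Suc.IH by blast
  obtain f where f: "f \<in> vanish (Y k)" "f \<notin> vanish (Y (Suc k))"
  proof -
    have "zclosed V (Y k)" using irr(1) by (simp add: irred_def)
    from zclosed_diff_polynomial[OF this irred_pts[OF irr(2)]] sub show ?thesis using that by blast
  qed
  obtain d where d: "dle d f" using ex_dle by blast
  \<comment> \<open>As \<open>e \<le> g\<close>, the bound for \<open>Y k\<close> persists with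
    dilation \<open>g\<close>; as \<open>d \<le> g\<close>, the step in \<open>HF_chain_step\<close>
    can be \<open>g\<close> as well.\<close>
  define g where "g = e + d"
  have g: "g > 0" "e \<le> g" "dle g f" using e dle_mono[OF d] by (auto simp: g_def)
  have lower: "(t + k) choose k \<le> HF (vanish (Y k)) (g * t)" for t
    using e(2)[of t] A.HF_mono[OF mult_le_mono1[OF g(2)], of t] by (rule le_trans)
  have "(t + Suc k) choose Suc k \<le> HF (vanish (Y (Suc k))) (g * t)" for t
  proof (induction t)
    case 0
    have "1 \<le> HF (vanish (Y k)) 0" using lower[of 0] by simp
    also have "\<dots> \<le> HF (vanish (Y (Suc k))) 0"
      using sub by (intro HF_antimono[OF B.var_ideal_axioms] vanish_antimono) blast
    finally show ?case by simp
  next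
    case (Suc t)
    have "(Suc t + Suc k) choose Suc k = ((Suc t + k) choose k) + ((t + Suc k) choose Suc k)" by simp
    also have "\<dots> \<le> HF (vanish (Y k)) (g * Suc t) + HF (vanish (Y (Suc k))) (g * t)"
      using lower[of "Suc t"] Suc by linarith
    also have "g * t = g * Suc t - g" by simp
    also have "HF (vanish (Y k)) (g * Suc t) + HF (vanish (Y (Suc k))) (g * Suc t - g)
        \<le> HF (vanish (Y (Suc k))) (g * Suc t)"
      using sub by (intro HF_chain_step[OF V irr(2) _ f g(3)]) auto
    finally show ?case .
  qed
  with g(1) show ?case by blast
qed

text \<open>The dilation \<open>e\<close> depends on the chain; \<open>HF_ge_of_sparse\<close>
  removes it.\<close>

lemma irr_chain_HF_ge:
  fixes Y :: "nat \<Rightarrow> (nat \<Rightarrow> 'a::field) set"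
  assumes "finite V" "irr_chain V k Y" "var_ideal V J" "J \<subseteq> vanish (Y k)"
  shows "(t + k) choose k \<le> HF J t"
proof -
  obtain e where "e > 0" "\<And>t. (t + k) choose k \<le> HF (vanish (Y k)) (e * t)"
    using irr_chain_HF[OF assms(1,2)] by blast
  moreover have "HF (vanish (Y k)) s \<le> HF J s" for s using HF_antimono assms(3,4) by blast
  ultimately show ?thesis
    using var_ideal.HF_ge_of_sparse[OF assms(3), of e k t] le_trans by blast
qed

section \<open>Noetherianity\<close>

lemma nat_seq_mono_subseq:
  fixes s :: "nat \<Rightarrow> nat"
  shows "\<exists>r :: nat \<Rightarrow> nat. strict_mono r \<and> (\<forall>i j. i \<le> j \<longrightarrow> s (r i) \<le> s (r j))"
proof -
  obtain f where f: "strict_mono f" "monoseq (\<lambda>n. s (f n))" using seq_monosub by blast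
  consider "\<forall>m. \<forall>n\<ge>m. s (f m) \<le> s (f n)" | "\<forall>m. \<forall>n\<ge>m. s (f n) \<le> s (f m)"
    using f(2) by (auto simp: monoseq_def)
  then show ?thesis
  proof cases
    case 1
    with f(1) show ?thesis by blast
  next
    case 2
    \<comment> \<open>A nonincreasing sequence of natural numbers is constant from a place on where
      its minimum is attained.\<close>
    define N where "N = arg_min (\<lambda>n. s (f n)) (\<lambda>_. True)"
    have N: "s (f N) \<le> s (f n)" for n
      unfolding N_def by (rule arg_min_nat_le) simp
    have "s (f (N + i)) = s (f N)" for i using N[of "N + i"] 2 by (simp add: le_antisym)
    then show ?thesis using f(1)
      by (intro exI[of _ "\<lambda>i. f (N + i)"]) (auto simp: strict_mono_def)
  qed
qed

lemma dickson_seq: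
  fixes s :: "nat \<Rightarrow> 'k \<Rightarrow> nat"
  assumes "finite K"
  shows "\<exists>r :: nat \<Rightarrow> nat. strict_mono r \<and> (\<forall>k\<in>K. \<forall>i j. i \<le> j \<longrightarrow> s (r i) k \<le> s (r j) k)"
  using assms
proof induction
  case empty
  show ?case by (intro exI[of _ id]) (simp add: strict_mono_def)
next
  case (insert k K)
  then obtain r :: "nat \<Rightarrow> nat" where r: "strict_mono r" "\<forall>k\<in>K. \<forall>i j. i \<le> j \<longrightarrow> s (r i) k \<le> s (r j) k" by blast
  obtain q :: "nat \<Rightarrow> nat" where q: "strict_mono q" "\<forall>i j. i \<le> j \<longrightarrow> s (r (q i)) k \<le> s (r (q j)) k"
    using nat_seq_mono_subseq[of "\<lambda>i. s (r i) k"] by blast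
  have "q i \<le> q j" if "i \<le> j" for i j using q(1) that by (simp add: strict_mono_less_eq)
  then have "\<forall>k'\<in>insert k K. \<forall>i j. i \<le> j \<longrightarrow> s (r (q i)) k' \<le> s (r (q j)) k'" using r(2) q(2) by blast
  moreover have "strict_mono (\<lambda>i. r (q i))" using r(1) q(1) by (simp add: strict_mono_def)
  ultimately show ?case by (intro exI[of _ "\<lambda>i. r (q i)"]) blast
qed

text \<open>Dickson's lemma with one additional coordinate \<open>v\<close>, which later carries the
  absolute value of an integral leading coefficient.\<close>

lemma dickson:
  fixes m :: "nat \<Rightarrow> nat multiset" and v :: "nat \<Rightarrow> nat"
  assumes "finite V" "\<And>i. set_mset (m i) \<subseteq> V"
  shows "\<exists>i j. i < j \<and> m i \<subseteq># m j \<and> v i \<le> v j"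
proof -
  define s where "s i k = (case k of None \<Rightarrow> v i | Some x \<Rightarrow> count (m i) x)" for i k
  have "\<exists>r :: nat \<Rightarrow> nat. strict_mono r \<and> (\<forall>k\<in>insert None (Some ` V). \<forall>i j. i \<le> j \<longrightarrow> s (r i) k \<le> s (r j) k)"
    by (rule dickson_seq) (use assms(1) in simp)
  then obtain r :: "nat \<Rightarrow> nat" where r: "strict_mono r"
    "\<forall>k\<in>insert None (Some ` V). \<forall>i j. i \<le> j \<longrightarrow> s (r i) k \<le> s (r j) k"
    by blast
  have "v (r 0) \<le> v (r 1)" using r(2)[rule_format, of None 0 1] by (simp add: s_def)
  moreover have "count (m (r 0)) x \<le> count (m (r 1)) x" for x
  proof (cases "x \<in> V")
    case True
    then show ?thesis using r(2)[rule_format, of "Some x" 0 1] by (simp add: s_def)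
  next
    case False
    then have "x \<notin># m (r 0)" using assms(2) by blast
    then show ?thesis by (simp add: not_in_iff)
  qed
  then have "m (r 0) \<subseteq># m (r 1)" by (simp add: subseteq_mset_def)
  moreover have "r 0 < r 1" using r(1) by (simp add: strict_mono_def)
  ultimately show ?thesis by blast
qed

text \<open>The normal form modulo \<open>I\<close> of an element of \<open>J\<close> lies in
  \<open>J\<close> and has no monomial in \<open>LM J\<close>, so it is zero.\<close>

lemma LM_eq_imp_eq:
  assumes "var_ideal V I" "var_ideal V J" "I \<subseteq> J" "LM J \<subseteq> LM I" shows "I = J"
proof -
  interpret I: var_ideal V I by fact
  interpret J: var_ideal V J by fact
  have "f \<in> I" if f: "f \<in> J" for f
  proof -
    obtain g where g: "\<forall>m\<in>supp g. m \<notin> LM I" "f - g \<in> I" using I.normal_form by blast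
    have "f - (f - g) \<in> J" using f g(2) assms(3) J.diff_mem by blast
    then have "g \<in> J" by simp
    then have "g = 0" using J.std_indep[of g] g(1) assms(4) by auto
    then show ?thesis using g(2) by simp
  qed
  with assms(3) show ?thesis by blast
qed

text \<open>Along a strictly decreasing sequence of closed sets, each vanishing ideal acquires a
  leading monomial absent from the previous one. By Dickson's lemma an earlier one of these divides
  a later one, which therefore was not new.\<close>

lemma wf_zclosed:
  assumes "finite V"
  shows "wf {(A, B :: (nat \<Rightarrow> 'a::field) set). zclosed V A \<and> zclosed V B \<and> A \<subset> B}"
proof (rule ccontr)
  assume "\<not> ?thesis"
  then have "\<exists>Z :: nat \<Rightarrow> (nat \<Rightarrow> 'a) set. \<forall>i. (Z (Suc i), Z i) \<in> {(A, B). zclosed V A \<and> zclosed V B \<and> A \<subset> B}"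
    unfolding wf_iff_no_infinite_down_chain by (rule notnotD)
  then obtain Z :: "nat \<Rightarrow> (nat \<Rightarrow> 'a) set"
    where Z0: "\<forall>i. (Z (Suc i), Z i) \<in> {(A, B). zclosed V A \<and> zclosed V B \<and> A \<subset> B}"
    by (rule exE)
  have Z: "zclosed V (Z i)" "Z (Suc i) \<subset> Z i" for i using spec[OF Z0, of i] by simp_all
  have vi: "var_ideal V (vanish (Z i))" for i by (intro var_ideal_vanish assms zclosed_pts Z(1))
  have mono: "vanish (Z i) \<subseteq> vanish (Z j)" if ij: "i \<le> j" for i j
  proof (rule lift_Suc_mono_le[where f = "\<lambda>i. vanish (Z i)", OF _ ij])
    fix n show "vanish (Z n) \<subseteq> vanish (Z (Suc n))"
      using Z(2)[of n] by (intro vanish_antimono) blast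
  qed
  have "\<exists>m. m \<in> LM (vanish (Z (Suc i))) \<and> m \<notin> LM (vanish (Z i))" for i
  proof (rule ccontr)
    assume "\<not> ?thesis"
    then have "LM (vanish (Z (Suc i))) \<subseteq> LM (vanish (Z i))" by (simp add: subset_iff)
    then have eq: "vanish (Z i) = vanish (Z (Suc i))" by (intro LM_eq_imp_eq[OF vi vi] mono) simp_all
    have "Z i = zeros V (vanish (Z i))" by (rule zeros_vanish[OF Z(1), symmetric])
    also have "\<dots> = Z (Suc i)" unfolding eq by (rule zeros_vanish[OF Z(1)])
    finally show False using Z(2)[of i] by blast
  qed
  then have "\<forall>i. \<exists>m. m \<in> LM (vanish (Z (Suc i))) \<and> m \<notin> LM (vanish (Z i))" by (rule allI)
  from choice[OF this] obtain m
    where m0: "\<forall>i. m i \<in> LM (vanish (Z (Suc i))) \<and> m i \<notin> LM (vanish (Z i))" by (rule exE)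
  have m: "m i \<in> LM (vanish (Z (Suc i)))" "m i \<notin> LM (vanish (Z i))" for i using spec[OF m0, of i] by simp_all
  have mV: "set_mset (m i) \<subseteq> V" for i by (rule var_ideal.std_vars[OF vi m(2)])
  obtain i j where ij: "i < j" "m i \<subseteq># m j" using dickson[of V m "\<lambda>_. 0", OF assms mV] by (elim exE conjE)
  have "LM (vanish (Z (Suc i))) \<subseteq> LM (vanish (Z j))" using ij(1) by (intro LM_mono mono) simp
  then have "m i \<in> LM (vanish (Z j))" using m(1) by (rule subsetD)
  then have "m j \<in> LM (vanish (Z j))" by (rule var_ideal.LM_up'[OF vi _ ij(2)])
  then show False using m(2)[of j] by simp
qed

section \<open>Irreducible components, and hyperplanes that avoid given points\<close>

lemma finite_irred_decomposition:
  fixes Z :: "(nat \<Rightarrow> 'a::field) set"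
  assumes "finite V" "zclosed V Z"
  shows "\<exists>\<A>. finite \<A> \<and> (\<forall>Y\<in>\<A>. irred V Y) \<and> Z = \<Union>\<A>"
  using assms(2)
proof (induction Z rule: wf_induct_rule[OF wf_zclosed[OF assms(1)]])
  case (1 Z)
  consider "Z = {}" | "irred V Z" | A B where "zclosed V A" "zclosed V B" "Z = A \<union> B" "A \<subset> Z" "B \<subset> Z"
    using 1(2) unfolding irred_def by blast
  then show ?case
  proof cases
    case 1
    then show ?thesis by (intro exI[of _ "{}"]) auto
  next
    case 2
    then show ?thesis by (intro exI[of _ "{Z}"]) auto
  next
    case (3 A B)
    then obtain \<A> \<B> where "finite \<A>" "\<forall>Y\<in>\<A>. irred V Y" "A = \<Union>\<A>" "finite \<B>" "\<forall>Y\<in>\<B>. irred V Y" "B = \<Union>\<B>"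
      using 1(1)[of A] 1(1)[of B] 1(2) by blast
    then show ?thesis using 3(3) by (intro exI[of _ "\<A> \<union> \<B>"]) auto
  qed
qed

text \<open>For a new point \<open>y\<close> with \<open>y k \<noteq> 0\<close>, adding
  \<open>s\<close> to the coefficient at \<open>k\<close> changes the value at \<open>x\<close> by
  \<open>s * x k\<close>. Only finitely many \<open>s\<close> are bad for one of the points.\<close>

lemma linear_form_avoiding:
  fixes N :: "(nat \<Rightarrow> 'a::field) set"
  assumes inf: "infinite (UNIV :: 'a set)" and V: "finite V" and "finite N"
    and "\<And>x. x \<in> N \<Longrightarrow> \<exists>i\<in>V. x i \<noteq> 0"
  shows "\<exists>c. \<forall>x\<in>N. (\<Sum>i\<in>V. c i * x i) \<noteq> 0"
  using assms(3,4)
proof (induction N rule: finite_induct)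
  case (insert y N)
  then obtain c where c: "\<forall>x\<in>N. (\<Sum>i\<in>V. c i * x i) \<noteq> 0" by blast
  obtain k where k: "k \<in> V" "y k \<noteq> 0" using insert.prems by blast
  have "finite ((\<lambda>x. - (\<Sum>i\<in>V. c i * x i) / x k) ` insert y N)" using insert.hyps by simp
  then obtain s where s: "s \<notin> (\<lambda>x. - (\<Sum>i\<in>V. c i * x i) / x k) ` insert y N"
    using inf ex_new_if_finite by blast
  define c' where "c' i = c i + (if i = k then s else 0)" for i
  have c': "(\<Sum>i\<in>V. c' i * x i) = (\<Sum>i\<in>V. c i * x i) + s * x k" for x
  proof -
    have "c' i * x i = c i * x i + (if i = k then s * x k else 0)" for i by (simp add: c'_def distrib_right)
    then show ?thesis using V k(1) by (simp add: sum.distrib)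
  qed
  have "(\<Sum>i\<in>V. c' i * x i) \<noteq> 0" if x: "x \<in> insert y N" for x
  proof (cases "x k = 0")
    case True
    then show ?thesis using x c k(2) by (auto simp: c')
  next
    case False
    have s': "s \<noteq> - (\<Sum>i\<in>V. c i * x i) / x k" using s x by blast
    show ?thesis
    proof
      assume "(\<Sum>i\<in>V. c' i * x i) = 0"
      then have "s * x k = - (\<Sum>i\<in>V. c i * x i)" by (simp add: c' eq_neg_iff_add_eq_0 add.commute)
      then have "s = - (\<Sum>i\<in>V. c i * x i) / x k" using False by (subst nonzero_eq_divide_eq) simp_all
      then show False using s' by simp
    qed
  qed
  then show ?case by blast
qed auto

section \<open>Homogeneous ideals and the Nullstellensatz\<close>

lemma Cst_1 [simp]: "mon {#} 1 = (1 :: 'a::comm_ring_1 mpoly)"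
  by (rule poly_mapping_eqI) (simp add: lookup_one lookup_single when_def)

definition hcomp :: "nat \<Rightarrow> 'a::comm_ring_1 mpoly \<Rightarrow> 'a mpoly"
  where "hcomp k f = (\<Sum>m\<in>{m \<in> supp f. size m = k}. mon m (coef f m))"

definition homog :: "nat \<Rightarrow> 'a::zero mpoly \<Rightarrow> bool"
  where "homog e f \<longleftrightarrow> (\<forall>m\<in>supp f. size m = e)"

lemma coef_hcomp: "coef (hcomp k f) m = (if size m = k then coef f m else 0)"
proof -
  have "coef (hcomp k f) m = (\<Sum>n\<in>{m \<in> supp f. size m = k}. if n = m then coef f n else 0)"
    by (simp add: hcomp_def lookup_sum lookup_single when_def)
  then show ?thesis by (simp add: in_keys_iff)
qed

lemma homog_iff: "homog e f \<longleftrightarrow> (\<forall>m. size m \<noteq> e \<longrightarrow> coef f m = 0)"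
  by (auto simp: homog_def in_keys_iff)

lemma hcomp_add: "hcomp k (f + g) = hcomp k f + hcomp k g"
  by (rule poly_mapping_eqI) (simp add: coef_hcomp lookup_add)

lemma homog_hcomp [simp]: "homog k (hcomp k f)"
  by (simp add: homog_iff coef_hcomp)

lemma hcomp_homog: "homog e f \<Longrightarrow> hcomp k f = (if k = e then f else 0)"
  by (rule poly_mapping_eqI) (auto simp: coef_hcomp homog_iff)

lemma homog_0 [simp]: "homog e 0"
  and homog_mon: "size m = e \<Longrightarrow> homog e (mon m c)"
  by (simp_all add: homog_def)

lemma homog_add: "homog e f \<Longrightarrow> homog e g \<Longrightarrow> homog e (f + g)"
  by (simp add: homog_iff lookup_add)

lemma homog_diff: "homog e f \<Longrightarrow> homog e g \<Longrightarrow> homog e (f - g)" for f :: "'a::comm_ring_1 mpoly"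
  by (simp add: homog_iff lookup_minus)

lemma homog_sum: "(\<And>a. a \<in> A \<Longrightarrow> homog e (f a)) \<Longrightarrow> homog e (sum f A)"
  by (induction A rule: infinite_finite_induct) (auto intro: homog_add)

lemma homog_mult: "homog d f \<Longrightarrow> homog e g \<Longrightarrow> homog (d + e) (f * g)" for f :: "'a::comm_ring_1 mpoly"
  using keys_mult[of f g] by (fastforce simp: homog_def)

lemma homog_1 [simp]: "homog 0 (1 :: 'a::comm_ring_1 mpoly)"
  by (simp add: homog_def)

lemma homog_power: "homog e f \<Longrightarrow> homog (k * e) (f ^ k)" for f :: "'a::comm_ring_1 mpoly"
  by (induction k) (auto intro: homog_mult)

lemma homog_Cst_mult: "homog e f \<Longrightarrow> homog e (Cst c * f)" for f :: "'a::comm_ring_1 mpoly"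
  using homog_mult[of 0 "Cst c" e f] homog_mon[of "{#}" 0 c] by simp

lemma homog_imp_dle: "homog e f \<Longrightarrow> dle e f"
  by (simp add: homog_def dle_def)

lemma hcomp_homog_mult:
  assumes "homog e g" shows "hcomp (e + k) (g * b) = g * hcomp k b"
    and "k' < e \<Longrightarrow> hcomp k' (g * b) = 0"
proof -
  have "hcomp (e + k) (g * b) = g * hcomp k b \<and> (k' < e \<longrightarrow> hcomp k' (g * b) = 0)"
  proof (induction b rule: mpoly_induct)
    case zero
    have "hcomp i 0 = (0 :: 'a mpoly)" for i by (simp add: hcomp_def)
    then show ?case by simp
  next
    case (add m c f)
    have "homog (e + size m) (g * mon m c)" by (intro homog_mult assms homog_mon) simp
    then have "hcomp i (g * mon m c) = (if i = e + size m then g * mon m c else 0)" for i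
      by (rule hcomp_homog)
    moreover have "hcomp i (mon m c) = (if i = size m then mon m c else 0)" for i
      by (intro hcomp_homog homog_mon) simp
    ultimately show ?case using add by (simp add: distrib_left hcomp_add)
  qed
  then show "hcomp (e + k) (g * b) = g * hcomp k b" "k' < e \<Longrightarrow> hcomp k' (g * b) = 0" by blast+
qed

definition trunc :: "nat \<Rightarrow> 'a::comm_ring_1 mpoly \<Rightarrow> 'a mpoly"
  where "trunc t f = (\<Sum>k\<le>t. hcomp k f)"

lemma coef_trunc: "coef (trunc t f) m = (if size m \<le> t then coef f m else 0)"
  by (simp add: trunc_def lookup_sum coef_hcomp)

lemma trunc_eq: "dle t f \<Longrightarrow> trunc t f = f"
  by (rule poly_mapping_eqI) (auto simp: coef_trunc dle_def in_keys_iff)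

lemma trunc_add: "trunc t (f + g) = trunc t f + trunc t g"
  by (rule poly_mapping_eqI) (simp add: coef_trunc lookup_add)

lemma dle_trunc: "dle t (trunc t f)"
  by (auto simp: dle_def in_keys_iff coef_trunc split: if_splits)

lemma trunc_linear_mult:
  assumes "homog 1 g" shows "trunc (Suc t) (g * b) = g * trunc t b"
proof -
  have "trunc (Suc t) (g * b) = hcomp 0 (g * b) + (\<Sum>k\<le>t. hcomp (Suc k) (g * b))"
    unfolding trunc_def by (rule sum.atMost_Suc_shift)
  moreover have "hcomp (Suc k) (g * b) = g * hcomp k b" for k
    using hcomp_homog_mult(1)[OF assms, of k b] by simp
  moreover have "hcomp 0 (g * b) = 0" by (rule hcomp_homog_mult(2)[OF assms]) simp
  ultimately show ?thesis by (simp add: trunc_def sum_distrib_left)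
qed

lemma ex_submultiset_size: "k \<le> size (m :: 'b multiset) \<Longrightarrow> \<exists>a b. m = a + b \<and> size a = k"
proof (induction m arbitrary: k)
  case empty
  then show ?case by simp
next
  case (add x m)
  show ?case
  proof (cases k)
    case 0
    then show ?thesis by (intro exI[of _ "{#}"] exI[of _ "add_mset x m"]) simp
  next
    case (Suc k')
    then obtain a b where "m = a + b" "size a = k'" using add.IH[of k'] add.prems by auto
    then show ?thesis using Suc by (intro exI[of _ "add_mset x a"] exI[of _ b]) simp
  qed
qed

locale hom_ideal = var_ideal +
  assumes graded: "f \<in> I \<Longrightarrow> hcomp k f \<in> I"
begin

lemma trunc_mem: "f \<in> I \<Longrightarrow> trunc t f \<in> I"
  unfolding trunc_def by (intro sum_mem graded)

end

context var_ideal
begin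

lemma mon_outside_mem:
  assumes "\<not> set_mset m \<subseteq> V" shows "mon m c \<in> I"
proof -
  obtain i where i: "i \<in># m" "i \<notin> V" using assms by blast
  then have "mon m c = mon (m - {#i#}) c * Var i" by (simp add: mult_single)
  then show ?thesis using mult_mem[OF outside[OF i(2)]] by simp
qed

lemma outside_mem:
  assumes "\<And>m. set_mset m \<subseteq> V \<Longrightarrow> coef f m = 0" shows "f \<in> I"
proof -
  have "(\<Sum>m\<in>supp f. mon m (coef f m)) \<in> I"
  proof (rule sum_mem)
    fix m assume "m \<in> supp f"
    then have "\<not> set_mset m \<subseteq> V" using assms[of m] by (auto simp: in_keys_iff)
    then show "mon m (coef f m) \<in> I" by (rule mon_outside_mem)
  qed
  then show ?thesis using poly_eq_sum_mon[of f] by simp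
qed

end

definition adjoin :: "'a::comm_ring_1 mpoly set \<Rightarrow> 'a mpoly \<Rightarrow> 'a mpoly set"
  where "adjoin I g = {a + g * b | a b. a \<in> I}"

lemma adjoinI: "a \<in> I \<Longrightarrow> a + g * b \<in> adjoin I g"
  by (auto simp: adjoin_def)

lemma (in var_ideal) adjoin_superset: "I \<subseteq> adjoin I g"
  using adjoinI[of _ I g 0] by auto

lemma (in var_ideal) gen_mem_adjoin: "g \<in> adjoin I g"
  using adjoinI[of 0 I g 1] by simp

lemma (in var_ideal) var_ideal_adjoin: "var_ideal V (adjoin I g)"
proof
  show "finite V" by (rule finV)
  show "Var i \<in> adjoin I g" if "i \<notin> V" for i using outside[OF that] adjoin_superset by blast
  show "pideal (adjoin I g)"
    unfolding pideal_def
  proof (intro conjI ballI allI)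
    show "0 \<in> adjoin I g" using adjoinI[of 0 I g 0] by simp
    fix f assume "f \<in> adjoin I g"
    then obtain a b where f: "f = a + g * b" "a \<in> I" by (auto simp: adjoin_def)
    show "h * f \<in> adjoin I g" for h
      using adjoinI[OF mult_mem[OF f(2), of h], of g "h * b"] by (simp add: f(1) algebra_simps)
    fix f' assume "f' \<in> adjoin I g"
    then obtain a' b' where f': "f' = a' + g * b'" "a' \<in> I" by (auto simp: adjoin_def)
    show "f + f' \<in> adjoin I g"
      using adjoinI[OF add_mem[OF f(2) f'(2)], of g "b + b'"] by (simp add: f(1) f'(1) algebra_simps)
  qed
qed

lemma (in hom_ideal) hom_ideal_adjoin:
  assumes "homog e g" shows "hom_ideal V (adjoin I g)"
proof -
  interpret A: var_ideal V "adjoin I g" by (rule var_ideal_adjoin)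
  show ?thesis
  proof
    fix f k assume "f \<in> adjoin I g"
    then obtain a b where f: "f = a + g * b" "a \<in> I" by (auto simp: adjoin_def)
    show "hcomp k f \<in> adjoin I g"
    proof (cases "e \<le> k")
      case True
      then have "hcomp k (g * b) = g * hcomp (k - e) b"
        using hcomp_homog_mult(1)[OF assms, of "k - e" b] by simp
      then show ?thesis using adjoinI[OF graded[OF f(2)], of k g "hcomp (k - e) b"] by (simp add: f(1) hcomp_add)
    next
      case False
      then have "hcomp k (g * b) = 0" by (intro hcomp_homog_mult(2)[OF assms]) simp
      then show ?thesis using adjoinI[OF graded[OF f(2)], of k g 0] by (simp add: f(1) hcomp_add)
    qed
  qed
qed

text \<open>For an ideal \<open>I\<close> this says that it contains the \<open>N\<close>-th power
  of the irrelevant ideal.\<close>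

definition full_degree :: "'a::zero_neq_one mpoly set \<Rightarrow> nat \<Rightarrow> bool"
  where "full_degree I N \<longleftrightarrow> (\<forall>m. size m = N \<longrightarrow> mon m 1 \<in> I)"

lemma (in var_ideal) homog_mem_of_full_degree:
  assumes "full_degree I N" "homog k f" "N \<le> k" shows "f \<in> I"
proof -
  have "(\<Sum>m\<in>supp f. mon m (coef f m)) \<in> I"
  proof (rule sum_mem)
    fix m assume "m \<in> supp f"
    then have "N \<le> size m" using assms(2,3) by (simp add: homog_def)
    then obtain a b where m: "m = a + b" "size a = N" using ex_submultiset_size by blast
    have "mon a 1 \<in> I" using assms(1) m(2) by (simp add: full_degree_def)
    from mult_mem[OF this, of "mon b (coef f m)"] show "mon m (coef f m) \<in> I"
      by (simp add: mult_single m(1) add.commute)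
  qed
  then show ?thesis using poly_eq_sum_mon[of f] by simp
qed

text \<open>A homogeneous ideal is contained in one that is maximal among those containing no power of the
  irrelevant ideal; such an ideal is prime.\<close>

lemma maximal_relevant_ideal:
  assumes I: "hom_ideal V I" and rel: "\<And>N. \<not> full_degree I N"
  shows "\<exists>P. I \<subseteq> P \<and> hom_ideal V P \<and> (\<forall>N. \<not> full_degree P N) \<and>
    (\<forall>J. P \<subseteq> J \<and> hom_ideal V J \<and> (\<forall>N. \<not> full_degree J N) \<longrightarrow> J = P)"
proof -
  define S where "S = {J. I \<subseteq> J \<and> hom_ideal V J \<and> (\<forall>N. \<not> full_degree J N)}"
  have finV: "finite V" using I by (simp add: hom_ideal_def var_ideal_def)
  have "\<exists>M\<in>S. \<forall>J\<in>S. M \<subseteq> J \<longrightarrow> J = M"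
  proof (rule subset_Zorn_nonempty)
    show "S \<noteq> {}" using assms by (auto simp: S_def)
    fix C assume C: "C \<noteq> {}" "subset.chain S C"
    then have CS: "J \<in> S" if "J \<in> C" for J using that by (auto simp: subset.chain_def)
    have hom: "hom_ideal V J" if "J \<in> C" for J using CS[OF that] by (simp add: S_def)
    have vi: "var_ideal V J" if "J \<in> C" for J using hom[OF that] by (simp add: hom_ideal_def)
    obtain J0 where J0: "J0 \<in> C" using C(1) by blast
    have "var_ideal V (\<Union>C)"
    proof
      show "finite V" by (rule finV)
      show "Var i \<in> \<Union>C" if "i \<notin> V" for i using var_ideal.outside[OF vi[OF J0] that] J0 by blast
      show "pideal (\<Union>C)"
        unfolding pideal_def
      proof (intro conjI ballI allI)
        show "0 \<in> \<Union>C" using var_ideal.zero_mem[OF vi[OF J0]] J0 by blast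
        fix f assume "f \<in> \<Union>C"
        then obtain J where J: "J \<in> C" "f \<in> J" by blast
        show "g * f \<in> \<Union>C" for g using var_ideal.mult_mem[OF vi[OF J(1)] J(2)] J(1) by blast
        fix g assume "g \<in> \<Union>C"
        then obtain K where K: "K \<in> C" "g \<in> K" by blast
        have "J \<subseteq> K \<or> K \<subseteq> J" using C(2) J(1) K(1) by (auto simp: subset.chain_def)
        then show "f + g \<in> \<Union>C"
        proof
          assume "J \<subseteq> K"
          then have "f + g \<in> K" using var_ideal.add_mem[OF vi[OF K(1)]] J K by blast
          then show ?thesis using K by blast
        next
          assume "K \<subseteq> J"
          then have "f + g \<in> J" using var_ideal.add_mem[OF vi[OF J(1)]] J K by blast
          then show ?thesis using J by blast
        qed
      qed
    qed
    then have UC: "hom_ideal V (\<Union>C)"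
      using hom_ideal.graded[OF hom] by (auto simp: hom_ideal_def hom_ideal_axioms_def)
    have "\<not> full_degree (\<Union>C) N" for N
    proof
      assume full: "full_degree (\<Union>C) N"
      \<comment> \<open>Only finitely many monomials in \<open>V\<close> have degree
        \<open>N\<close>, so one member of the chain contains them all; the other monomials of this
        degree lie in every member.\<close>
      define A where "A = (\<lambda>m. mon m (1 :: 'a)) ` {m \<in> mons V N. size m = N}"
      have "finite A" unfolding A_def using finite_mons[OF finV, of N] by simp
      moreover have "A \<subseteq> \<Union>C" using full unfolding A_def full_degree_def by blast
      ultimately obtain J where J: "J \<in> C" "A \<subseteq> J"
        using finite_subset_Union_chain[OF _ _ C(1) C(2)] by blast
      have "full_degree J N"
        unfolding full_degree_def
      proof (intro allI impI)
        fix m :: "nat multiset" assume m: "size m = N"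
        show "mon m 1 \<in> J"
        proof (cases "set_mset m \<subseteq> V")
          case True
          then have "mon m 1 \<in> A" using m unfolding A_def mons_def by simp
          then show ?thesis using J by blast
        next
          case False
          then show ?thesis by (rule var_ideal.mon_outside_mem[OF vi[OF J(1)]])
        qed
      qed
      then show False using CS[OF J(1)] by (simp add: S_def)
    qed
    moreover have "I \<subseteq> \<Union>C" using CS[OF J0] J0 unfolding S_def by blast
    ultimately show "\<Union>C \<in> S" using UC unfolding S_def by blast
  qed
  then obtain P where P: "P \<in> S" "\<forall>J\<in>S. P \<subseteq> J \<longrightarrow> J = P" by blast
  have "J = P" if "P \<subseteq> J \<and> hom_ideal V J \<and> (\<forall>N. \<not> full_degree J N)" for J
  proof -
    have "J \<in> S" using that P(1) unfolding S_def by blast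
    then show ?thesis using P(2) that by blast
  qed
  then show ?thesis using P(1) unfolding S_def by blast
qed

text \<open>The sum is the homogenisation of \<open>q\<close>, evaluated at \<open>x\<close> and
  \<open>z\<close>. Over an algebraically closed field it splits into linear forms; a prime ideal
  contains one of these, and it is not \<open>z\<close>.\<close>

lemma binary_form_factor:
  fixes P :: "'a::alg_closed_field mpoly set"
  assumes "hom_ideal V P" "1 \<notin> P"
    and prime': "\<forall>d e f g. homog d f \<longrightarrow> homog e g \<longrightarrow> f * g \<in> P \<longrightarrow> f \<in> P \<or> g \<in> P"
    and x: "homog 1 x" and z: "homog 1 z" "z \<notin> P"
  shows "q \<noteq> 0 \<Longrightarrow> Polynomial.degree q \<le> k \<Longrightarrow>
    (\<Sum>s\<le>k. Cst (Polynomial.coeff q s) * (x ^ s * z ^ (k - s))) \<in> P \<Longrightarrow> \<exists>r. x - Cst r * z \<in> P"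
proof (induction k arbitrary: q)
  case 0
  interpret hom_ideal V P by fact
  have nz: "Polynomial.coeff q 0 \<noteq> 0" using 0(1,2) by (metis le_zero_eq leading_coeff_0_iff)
  have "Cst (Polynomial.coeff q 0) \<in> P" using 0(3) by simp
  from mult_mem[OF this, of "Cst (inverse (Polynomial.coeff q 0))"] have "1 \<in> P"
    using nz by (simp add: mult_single)
  then show ?case using assms(2) by simp
next
  case (Suc k)
  interpret hom_ideal V P by fact
  have prime: "f \<in> P \<or> g \<in> P" if "homog d f" "homog e g" "f * g \<in> P" for d e f g
    using prime' that by blast
  define H where "H k q = (\<Sum>s\<le>k. Cst (Polynomial.coeff q s) * (x ^ s * z ^ (k - s)))" for k and q :: "'a poly"
  have Hz: "H (Suc k) p = z * H k p" if "Polynomial.coeff p (Suc k) = 0" for p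
  proof -
    have "H (Suc k) p = (\<Sum>s\<le>k. Cst (Polynomial.coeff p s) * (x ^ s * z ^ (Suc k - s)))"
      using that by (simp add: H_def)
    also have "\<dots> = (\<Sum>s\<le>k. z * (Cst (Polynomial.coeff p s) * (x ^ s * z ^ (k - s))))"
      by (rule sum.cong) (auto simp: Suc_diff_le mult_ac)
    finally show ?thesis by (simp only: H_def sum_distrib_left)
  qed
  have Hx: "H (Suc k) (pCons 0 p) = x * H k p" for p
  proof -
    have "H (Suc k) (pCons 0 p) = (\<Sum>s\<le>k. Cst (Polynomial.coeff p s) * (x ^ Suc s * z ^ (k - s)))"
      unfolding H_def by (subst sum.atMost_Suc_shift) simp
    also have "\<dots> = (\<Sum>s\<le>k. x * (Cst (Polynomial.coeff p s) * (x ^ s * z ^ (k - s))))"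
      by (rule sum.cong) (auto simp: mult_ac)
    finally show ?thesis by (simp only: H_def sum_distrib_left)
  qed
  have homH: "homog k (H k p)" for p
    unfolding H_def
  proof (intro homog_sum homog_Cst_mult)
    fix s assume "s \<in> {..k}"
    then show "homog k (x ^ s * z ^ (k - s))"
      using homog_mult[OF homog_power[OF x, of s] homog_power[OF z(1), of "k - s"]] by simp
  qed
  have HS: "H (Suc k) q \<in> P" using Suc.prems(3) by (simp add: H_def)
  show ?case
  proof (cases "Polynomial.coeff q (Suc k) = 0")
    case True
    then have "z * H k q \<in> P" using HS Hz by simp
    then have "H k q \<in> P" using prime[OF z(1) homH] z(2) by blast
    moreover have "Polynomial.degree q \<le> k"
      using True Suc.prems(1,2) by (metis le_Suc_eq leading_coeff_0_iff)
    ultimately show ?thesis using Suc.IH[of q] Suc.prems(1) by (simp add: H_def)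
  next
    case False
    then have deg: "Polynomial.degree q = Suc k" using Suc.prems(2) le_degree by (metis le_antisym)
    then obtain r where "poly q r = 0" using alg_closed_imp_poly_has_root[of q] by auto
    then have "[:- r, 1:] dvd q" by (simp only: poly_eq_0_iff_dvd)
    then obtain p where p: "q = [:- r, 1:] * p" by (rule dvdE)
    have p0: "p \<noteq> 0" using p Suc.prems(1) by auto
    have "Polynomial.degree ([:- r, 1:] * p) = Polynomial.degree [:- r, 1:] + Polynomial.degree p"
      using p0 by (intro Polynomial.degree_mult_eq) simp_all
    then have degp: "Polynomial.degree p = k" using deg p by simp
    have "q = pCons 0 p - Polynomial.smult r p" by (simp add: p)
    then have cq: "Cst (Polynomial.coeff q s) = Cst (Polynomial.coeff (pCons 0 p) s) - Cst r * Cst (Polynomial.coeff p s)" for s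
      by (simp add: single_diff mult_single)
    have "H (Suc k) q = H (Suc k) (pCons 0 p) - Cst r * H (Suc k) p"
      unfolding H_def cq by (simp only: left_diff_distrib sum_subtractf sum_distrib_left mult.assoc)
    also have "\<dots> = (x - Cst r * z) * H k p"
      using degp by (simp add: Hx Hz coeff_eq_0 left_diff_distrib mult.assoc)
    finally have "(x - Cst r * z) * H k p \<in> P" using HS by simp
    moreover have "homog 1 (x - Cst r * z)" using x z by (intro homog_diff homog_Cst_mult)
    ultimately have "x - Cst r * z \<in> P \<or> H k p \<in> P" using prime[OF _ homH] by blast
    then show ?thesis using Suc.IH[OF p0] degp by (auto simp: H_def)
  qed
qed

text \<open>An ideal \<open>P\<close> above \<open>I\<close> that is maximal among the relevant ones
  is prime and turns out to describe a line through the origin: some variable \<open>z\<close> is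
  not in \<open>P\<close>, and modulo \<open>P\<close> every variable is a scalar multiple of
  \<open>z\<close>. The scalars are the coordinates of the zero.\<close>

theorem homogeneous_nullstellensatz:
  fixes I :: "'a::alg_closed_field mpoly set"
  assumes I: "hom_ideal V I" and rel: "\<And>N. \<not> full_degree I N"
  shows "\<exists>x\<in>zeros V I. \<exists>i\<in>V. x i \<noteq> 0"
proof -
  obtain P where IP: "I \<subseteq> P" and P: "hom_ideal V P" and relP': "\<forall>N. \<not> full_degree P N"
    and max': "\<forall>J. P \<subseteq> J \<and> hom_ideal V J \<and> (\<forall>N. \<not> full_degree J N) \<longrightarrow> J = P"
    using maximal_relevant_ideal[OF I rel] by (elim exE conjE)
  have relP: "\<not> full_degree P N" for N using relP' by simp
  interpret hom_ideal V P by fact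
  have one: "1 \<notin> P" using relP[of 0] by (simp add: full_degree_def)
  have adj: "\<exists>N. full_degree (adjoin P g) N" if g: "homog e g" "g \<notin> P" for e g
  proof (rule ccontr)
    assume "\<not> ?thesis"
    then have "adjoin P g = P" using max' adjoin_superset hom_ideal_adjoin[OF g(1)] by simp
    then show False using gen_mem_adjoin g(2) by blast
  qed
  have prime: "f \<in> P \<or> g \<in> P" if fg: "homog d f" "homog e g" "f * g \<in> P" for d e f g
  proof (rule ccontr)
    assume not: "\<not> (f \<in> P \<or> g \<in> P)"
    obtain N1 where N1: "full_degree (adjoin P f) N1" using adj[OF fg(1)] not by blast
    obtain N2 where N2: "full_degree (adjoin P g) N2" using adj[OF fg(2)] not by blast
    have "mon m 1 \<in> P" if m: "size m = N1 + N2" for m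
    proof -
      obtain m1 m2 where m12: "m = m1 + m2" "size m1 = N1" using ex_submultiset_size[of N1 m] m by auto
      then have "size m2 = N2" using m by simp
      then obtain a b where ab: "mon m2 1 = a + g * b" "a \<in> P"
        using N2 unfolding full_degree_def adjoin_def by blast
      obtain a' b' where ab': "mon m1 1 = a' + f * b'" "a' \<in> P"
        using N1 m12(2) unfolding full_degree_def adjoin_def by blast
      have "mon m (1 :: 'a) = mon m1 1 * mon m2 1" by (simp add: m12(1) mult_single)
      also have "\<dots> = (a' * (a + g * b) + (f * b') * a) + (f * g) * (b * b')"
        by (simp add: ab(1) ab'(1) algebra_simps)
      also have "\<dots> \<in> P"
        by (intro add_mem mult_mem'[OF ab'(2)] mult_mem[OF ab(2)] mult_mem'[OF fg(3)])
      finally show ?thesis .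
    qed
    then show False using relP[of "N1 + N2"] by (simp add: full_degree_def)
  qed
  obtain i0 where i0: "i0 \<in> V" "Var i0 \<notin> P"
  proof -
    obtain m where m: "size m = 1" "mon m 1 \<notin> P" using relP[of 1] unfolding full_degree_def by blast
    then obtain i where "m = {#i#}" using size_1_singleton_mset by blast
    then show ?thesis using m(2) outside that by blast
  qed
  define z where "z = (Var i0 :: 'a mpoly)"
  have z: "homog 1 z" "z \<notin> P" using i0(2) by (simp_all add: z_def homog_mon)
  have zpow: "z ^ k \<notin> P" for k
  proof (induction k)
    case 0
    show ?case using one by simp
  next
    case (Suc k)
    then show ?case using prime[OF z(1) homog_power[OF z(1), of k]] z(2) by auto
  qed
  obtain N where N: "full_degree (adjoin P z) N" using adj[OF z] by blast
  \<comment> \<open>Modulo \<open>P\<close>, forms of degree \<open>N + k\<close> are divisible by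
    \<open>z ^ k\<close>, because \<open>P\<close> and \<open>z\<close> together generate all
    monomials of degree \<open>N\<close>.\<close>
  have divz: "\<exists>b. homog N b \<and> f - z ^ k * b \<in> P" if "homog (N + k) f" for f k
    using that
  proof (induction k arbitrary: f)
    case 0
    then show ?case by (intro exI[of _ f]) simp
  next
    case (Suc k)
    have "f \<in> adjoin P z"
      using var_ideal.homog_mem_of_full_degree[OF var_ideal_adjoin N Suc.prems] by simp
    then obtain a b where ab: "f = a + z * b" "a \<in> P" by (auto simp: adjoin_def)
    have "hcomp (1 + (N + k)) f = hcomp (1 + (N + k)) a + z * hcomp (N + k) b"
      unfolding ab(1) hcomp_add hcomp_homog_mult(1)[OF z(1)] ..
    moreover have "hcomp (1 + (N + k)) f = f" using hcomp_homog[OF Suc.prems] by simp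
    ultimately have f: "f - z * hcomp (N + k) b = hcomp (1 + (N + k)) a" by (metis add_diff_cancel_right')
    obtain b' where b': "homog N b'" "hcomp (N + k) b - z ^ k * b' \<in> P"
      using Suc.IH[OF homog_hcomp] by blast
    have "f - z ^ Suc k * b' = (f - z * hcomp (N + k) b) + z * (hcomp (N + k) b - z ^ k * b')"
      by (simp add: right_diff_distrib mult.assoc)
    also have "\<dots> \<in> P" unfolding f by (intro add_mem mult_mem b'(2) graded ab(2))
    finally show ?case using b'(1) by blast
  qed
  have lin: "\<exists>r. Var i - Cst r * z \<in> P" for i
  proof -
    define B where "B = {m \<in> mons V N. size m = N}"
    have finB: "finite B" using finite_mons[OF finV] by (simp add: B_def)
    define n where "n = card B"
    \<comment> \<open>Modulo \<open>P\<close>, the \<open>k + 1\<close> forms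
      \<open>Var i ^ s * z ^ (k - s)\<close> become \<open>z ^ n\<close> times forms of degree
      \<open>N\<close>. The latter have only \<open>n\<close> relevant coefficients, fewer than
      \<open>k + 1\<close>, so a nontrivial combination lies in \<open>P\<close>.\<close>
    define k where "k = N + n"
    have hx: "homog 1 (Var i :: 'a mpoly)" by (simp add: homog_mon)
    have "\<exists>b. homog N b \<and> Var i ^ s * z ^ (k - s) - z ^ n * b \<in> P" if "s \<le> k" for s
    proof (rule divz)
      show "homog (N + n) (Var i ^ s * z ^ (k - s))"
        using homog_mult[OF homog_power[OF hx, of s] homog_power[OF z(1), of "k - s"]] that by (simp add: k_def)
    qed
    then have "\<forall>s. \<exists>b. s \<le> k \<longrightarrow> homog N b \<and> Var i ^ s * z ^ (k - s) - z ^ n * b \<in> P" by simp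
    from choice[OF this] obtain b
      where b0: "\<forall>s. s \<le> k \<longrightarrow> homog N (b s) \<and> Var i ^ s * z ^ (k - s) - z ^ n * b s \<in> P" by (rule exE)
    then have b: "\<And>s. s \<le> k \<Longrightarrow> homog N (b s)"
      "\<And>s. s \<le> k \<Longrightarrow> Var i ^ s * z ^ (k - s) - z ^ n * b s \<in> P" by simp_all
    have "card B < card {..k}" by (simp add: k_def n_def)
    from underdetermined_system[OF _ finB this, of "\<lambda>s. coef (b s)"]
    obtain c where c: "\<exists>s\<le>k. c s \<noteq> 0" "\<And>m. m \<in> B \<Longrightarrow> (\<Sum>s\<le>k. c s * coef (b s) m) = 0" by auto
    have "(\<Sum>s\<le>k. Cst (c s) * b s) \<in> P"
    proof (rule outside_mem)
      fix m :: "nat multiset" assume m: "set_mset m \<subseteq> V"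
      show "coef (\<Sum>s\<le>k. Cst (c s) * b s) m = 0"
      proof (cases "size m = N")
        case True
        then have "m \<in> B" using m by (simp add: B_def mons_def)
        then show ?thesis using c(2) by (simp add: lookup_sum)
      next
        case False
        then have "coef (b s) m = 0" if "s \<le> k" for s using b(1)[OF that] by (simp add: homog_iff)
        then show ?thesis by (simp add: lookup_sum)
      qed
    qed
    then have 1: "z ^ n * (\<Sum>s\<le>k. Cst (c s) * b s) \<in> P" by (rule mult_mem)
    have 2: "(\<Sum>s\<le>k. Cst (c s) * (Var i ^ s * z ^ (k - s) - z ^ n * b s)) \<in> P"
      using b(2) by (intro sum_mem mult_mem) simp
    have "z ^ n * (\<Sum>s\<le>k. Cst (c s) * b s) + (\<Sum>s\<le>k. Cst (c s) * (Var i ^ s * z ^ (k - s) - z ^ n * b s)) \<in> P"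
      by (rule add_mem[OF 1 2])
    also have "z ^ n * (\<Sum>s\<le>k. Cst (c s) * b s) + (\<Sum>s\<le>k. Cst (c s) * (Var i ^ s * z ^ (k - s) - z ^ n * b s))
        = (\<Sum>s\<le>k. Cst (c s) * (Var i ^ s * z ^ (k - s)))"
      by (simp only: sum_distrib_left sum.distrib [symmetric]) (simp add: algebra_simps)
    finally have form: "(\<Sum>s\<le>k. Cst (c s) * (Var i ^ s * z ^ (k - s))) \<in> P" .
    define q where "q = (\<Sum>s\<le>k. Polynomial.monom (c s) s)"
    have coeff_q: "Polynomial.coeff q s = (if s \<le> k then c s else 0)" for s
      by (simp add: q_def Polynomial.coeff_sum)
    have "q \<noteq> 0" using c(1) coeff_q by (metis Polynomial.coeff_0)
    moreover have "Polynomial.degree q \<le> k" by (rule degree_le) (simp add: coeff_q)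
    moreover have "(\<Sum>s\<le>k. Cst (Polynomial.coeff q s) * (Var i ^ s * z ^ (k - s))) \<in> P"
      using form by (simp add: coeff_q)
    moreover have "\<forall>d e f g. homog d f \<longrightarrow> homog e g \<longrightarrow> f * g \<in> P \<longrightarrow> f \<in> P \<or> g \<in> P"
      using prime by (intro allI impI)
    ultimately show ?thesis using binary_form_factor[OF P one _ hx z, of q k] by simp
  qed
  then have "\<forall>i. \<exists>r. Var i - Cst r * z \<in> P" by (rule allI)
  from choice[OF this] obtain r where r0: "\<forall>i. Var i - Cst (r i) * z \<in> P" by (rule exE)
  have r: "Var i - Cst (r i) * z \<in> P" for i by (rule spec[OF r0])
  define y where "y i = (if i \<in> V then r i else 0)" for i
  have y: "Var i - Cst (y i) * z \<in> P" for i
    using r[of i] outside[of i] by (simp add: y_def)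
  have yV: "y \<in> pts V" by (simp add: pts_def y_def)
  have mony: "mon m 1 - Cst (\<Prod>i\<in>#m. y i) * z ^ size m \<in> P" for m
  proof (induction m)
    case empty
    show ?case by simp
  next
    case (add i m)
    have "mon (add_mset i m) 1 - Cst (\<Prod>i\<in>#add_mset i m. y i) * z ^ size (add_mset i m)
      = (Var i - Cst (y i) * z) * mon m 1 + Cst (y i) * z * (mon m 1 - Cst (\<Prod>i\<in>#m. y i) * z ^ size m)"
    proof -
      have "mon (add_mset i m) (1 :: 'a) = Var i * mon m 1" by (simp add: mult_single)
      moreover have "Cst (\<Prod>i\<in>#add_mset i m. y i) = Cst (y i) * Cst (\<Prod>i\<in>#m. y i)" by (simp add: mult_single)
      ultimately show ?thesis by (simp add: algebra_simps)
    qed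
    also have "\<dots> \<in> P" by (intro add_mem mult_mem add mult_mem'[OF y])
    finally show ?case .
  qed
  \<comment> \<open>Modulo \<open>P\<close> a form \<open>f\<close> of degree \<open>e\<close>
    equals \<open>ev y f * z ^ e\<close>, and no power of \<open>z\<close> lies in
    \<open>P\<close>.\<close>
  have hom0: "ev y f = 0" if f: "homog e f" "f \<in> P" for e f
  proof (rule ccontr)
    assume nz: "ev y f \<noteq> 0"
    have "f - Cst (ev y f) * z ^ e = (\<Sum>m\<in>supp f. Cst (coef f m) * (mon m 1 - Cst (\<Prod>i\<in>#m. y i) * z ^ size m))"
    proof -
      have "(\<Sum>m\<in>supp f. Cst (coef f m) * mon m 1) = f"
        using poly_eq_sum_mon[of f] by (simp add: Cst_mult_mon)
      moreover have "(\<Sum>m\<in>supp f. Cst (coef f m) * (Cst (\<Prod>i\<in>#m. y i) * z ^ size m)) = Cst (ev y f) * z ^ e"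
      proof -
        have "(\<Sum>m\<in>supp f. Cst (coef f m) * (Cst (\<Prod>i\<in>#m. y i) * z ^ size m))
          = (\<Sum>m\<in>supp f. Cst (coef f m * (\<Prod>i\<in>#m. y i)) * z ^ e)"
          using f(1) by (intro sum.cong) (simp_all add: homog_def mult_single flip: mult.assoc)
        also have "\<dots> = Cst (ev y f) * z ^ e"
        proof -
          have "Cst (\<Sum>m\<in>A. g m) = (\<Sum>m\<in>A. Cst (g m))" for A and g :: "nat multiset \<Rightarrow> 'a"
            by (induction A rule: infinite_finite_induct) (simp_all add: single_add)
          then show ?thesis by (simp add: hom_eval_def sum_distrib_right)
        qed
        finally show ?thesis .
      qed
      ultimately show ?thesis by (simp only: right_diff_distrib sum_subtractf)
    qed
    also have "\<dots> \<in> P" by (intro sum_mem mult_mem mony)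
    finally have "f - (f - Cst (ev y f) * z ^ e) \<in> P" by (rule diff_mem[OF f(2)])
    then have "Cst (ev y f) * z ^ e \<in> P" by simp
    then have "Cst (inverse (ev y f)) * (Cst (ev y f) * z ^ e) \<in> P" by (rule mult_mem)
    then have "z ^ e \<in> P" using nz by (simp add: mult_single flip: mult.assoc)
    then show False using zpow by blast
  qed
  have "ev y f = 0" if f: "f \<in> I" for f
  proof -
    obtain t where "dle t f" using ex_dle by blast
    then have eq: "f = (\<Sum>k\<le>t. hcomp k f)" using trunc_eq[of t f] by (simp add: trunc_def)
    have "ev y (hcomp k f) = 0" for k by (rule hom0[OF homog_hcomp graded[OF subsetD[OF IP f]]])
    then have "ev y (\<Sum>k\<le>t. hcomp k f) = 0" by simp
    then show ?thesis using eq by simp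
  qed
  then have "y \<in> zeros V I" using yV by (simp add: zeros_def)
  moreover have "y i0 \<noteq> 0"
  proof
    assume "y i0 = 0"
    then show False using y[of i0] i0(2) by simp
  qed
  ultimately show ?thesis using i0(1) by blast
qed

section \<open>Hilbert functions and Krull dimension\<close>

text \<open>Otherwise the product of all \<open>X - a\<close>, increased by 1, would have no
  root.\<close>

lemma alg_closed_infinite: "infinite (UNIV :: 'a::alg_closed_field set)"
proof
  assume fin: "finite (UNIV :: 'a set)"
  define p where "p = (\<Prod>a\<in>(UNIV :: 'a set). [:- a, 1:]) + 1"
  have "Polynomial.degree (\<Prod>a\<in>(UNIV :: 'a set). [:- a, 1:]) = card (UNIV :: 'a set)"
    by (subst degree_prod_sum_eq) auto
  moreover have "card (UNIV :: 'a set) > 0" using fin by (simp add: card_gt_0_iff)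
  ultimately have "Polynomial.degree p > 0" unfolding p_def by (subst degree_add_eq_left) auto
  then obtain x where "poly p x = 0" using alg_closed_imp_poly_has_root by blast
  moreover have "poly (\<Prod>a\<in>(UNIV :: 'a set). [:- a, 1:]) x = 0"
    using fin by (simp add: poly_prod prod_zero_iff)
  ultimately show False by (simp add: p_def)
qed

lemma ev_scale_homog: "homog e f \<Longrightarrow> ev (\<lambda>i. c * x i) f = c ^ e * ev x f"
proof -
  assume f: "homog e f"
  have "(\<Prod>i\<in>#m. c * x i) = c ^ size m * (\<Prod>i\<in>#m. x i)" for m
    by (induction m) (simp_all add: mult_ac)
  then show ?thesis
    using f by (simp add: hom_eval_def homog_def sum_distrib_left mult_ac)
qed

lemma ev_zero_point: "ev (\<lambda>i. 0) f = coef f {#}"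
proof (induction f rule: mpoly_induct)
  case (add m c f)
  have "(\<Prod>i\<in>#m. (0 :: 'a)) = (if m = {#} then 1 else 0)" by (cases m) auto
  then show ?case using add by (simp add: lookup_add lookup_single when_def)
qed simp

context hom_ideal
begin

lemma zeros_scale:
  assumes "x \<in> zeros V I" shows "(\<lambda>i. c * x i) \<in> zeros V I"
proof -
  have "ev (\<lambda>i. c * x i) f = 0" if f: "f \<in> I" for f
  proof -
    obtain t where "dle t f" using ex_dle by blast
    then have eq: "f = (\<Sum>k\<le>t. hcomp k f)" using trunc_eq[of t f] by (simp add: trunc_def)
    have "ev x (hcomp k f) = 0" for k using graded[OF f] assms by (simp add: zeros_def)
    then have "ev (\<lambda>i. c * x i) (hcomp k f) = 0" for k using ev_scale_homog[OF homog_hcomp, of c x k f] by simp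
    then have "ev (\<lambda>i. c * x i) (\<Sum>k\<le>t. hcomp k f) = 0" by simp
    then show ?thesis using eq by simp
  qed
  then show ?thesis using assms by (simp add: zeros_def pts_def)
qed

lemma HF_eq_0_of_no_zeros:
  assumes "zeros V I = {}" shows "HF I t = 0"
proof -
  have "(\<lambda>i. 0) \<in> pts V" by (simp add: pts_def)
  then obtain f where f: "f \<in> I" "ev (\<lambda>i. 0) f \<noteq> 0" using assms by (auto simp: zeros_def)
  define c where "c = coef f {#}"
  have c: "c \<noteq> 0" using f(2) by (simp add: ev_zero_point c_def)
  have "hcomp 0 f = Cst c" by (rule poly_mapping_eqI) (auto simp: coef_hcomp lookup_single when_def c_def)
  then have "Cst c \<in> I" using graded[OF f(1), of 0] by simp
  moreover have "is_lm (Cst c) {#}" using c by (simp add: is_lm_def)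
  ultimately have "{#} \<in> LM I" unfolding LM_def by blast
  then have "stdm I t = {}" using LM_up'[of "{#}"] by (auto simp: stdm_def)
  then show ?thesis by (simp add: HF_def)
qed

text \<open>The inequality opposite to \<open>HF_chain_step\<close>: the standard monomials of
  \<open>adjoin I g\<close>, together with \<open>g\<close> times those of \<open>I\<close> in
  degree one less, span modulo \<open>I\<close>. Since \<open>I\<close> is graded, a representation
  \<open>a + g * b\<close> can be truncated to the degrees in question.\<close>

lemma HF_adjoin_linear:
  assumes g: "homog 1 g"
  shows "HF I (Suc t) \<le> HF I t + HF (adjoin I g) (Suc t)"
proof -
  interpret A: var_ideal V "adjoin I g" by (rule var_ideal_adjoin)
  let ?B = "stdm (adjoin I g) (Suc t) <+> stdm I t"
  define G where "G = case_sum (\<lambda>m. mon m 1) (\<lambda>m. g * mon m (1 :: 'a))"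
  have "HF I (Suc t) \<le> card ?B"
  proof (rule HF_le_card)
    fix m0 assume "m0 \<in> stdm I (Suc t)"
    then have d0: "dle (Suc t) (mon m0 1)" by (simp add: stdm_def dle_mon)
    then obtain c where c: "mon m0 1 - (\<Sum>m\<in>stdm (adjoin I g) (Suc t). mon m (c m)) \<in> adjoin I g"
      using A.normal_form_dle by blast
    let ?S = "\<Sum>m\<in>stdm (adjoin I g) (Suc t). mon m (c m)"
    obtain a b where ab: "mon m0 1 - ?S = a + g * b" "a \<in> I" using c by (auto simp: adjoin_def)
    have "dle (Suc t) (mon m0 1 - ?S)" by (intro dle_diff d0 dle_sum dle_mon) (simp add: stdm_def)
    then have "mon m0 1 - ?S = trunc (Suc t) (mon m0 1 - ?S)" by (rule trunc_eq[symmetric])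
    also have "\<dots> = trunc (Suc t) a + g * trunc t b"
      unfolding ab(1) trunc_add trunc_linear_mult[OF g] ..
    finally have tr: "mon m0 1 - ?S = trunc (Suc t) a + g * trunc t b" .
    obtain d where d: "trunc t b - (\<Sum>m\<in>stdm I t. mon m (d m)) \<in> I"
      using normal_form_dle[OF dle_trunc] by blast
    let ?T = "\<Sum>m\<in>stdm I t. mon m (d m)"
    have "mon m0 1 - (?S + g * ?T) = (mon m0 1 - ?S) - g * ?T" by (rule diff_diff_eq[symmetric])
    also have "\<dots> = trunc (Suc t) a + g * (trunc t b - ?T)"
      unfolding tr by (simp only: right_diff_distrib add_diff_eq)
    also have "\<dots> \<in> I" by (intro add_mem mult_mem d trunc_mem ab(2))
    finally have mem: "mon m0 1 - (?S + g * ?T) \<in> I" .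
    define e where "e = case_sum c d"
    have "(\<Sum>b\<in>?B. Cst (e b) * G b) = ?S + g * ?T"
    proof -
      have "(\<Sum>b\<in>?B. Cst (e b) * G b) = (\<Sum>m\<in>stdm (adjoin I g) (Suc t). Cst (e (Inl m)) * G (Inl m))
        + (\<Sum>m\<in>stdm I t. Cst (e (Inr m)) * G (Inr m))"
        by (subst sum.Plus) (simp_all add: o_def)
      moreover have "Cst (e (Inl m)) * G (Inl m) = mon m (c m)" for m
        by (simp add: G_def e_def Cst_mult_mon)
      moreover have "Cst (e (Inr m)) * G (Inr m) = g * mon m (d m)" for m
        by (simp add: G_def e_def mult.left_commute[of "Cst _" g] Cst_mult_mon)
      ultimately show ?thesis by (simp only: sum_distrib_left)
    qed
    with mem have "mon m0 1 - (\<Sum>b\<in>?B. Cst (e b) * G b) \<in> I" by (simp only:)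
    then show "\<exists>c. mon m0 1 - (\<Sum>b\<in>?B. Cst (c b) * G b) \<in> I" by (rule exI[of _ e])
  qed simp
  then show ?thesis by (simp add: card_Plus HF_def)
qed

end

section \<open>Chains in the zero set of a homogeneous ideal and the growth of its Hilbert
  function\<close>

lemma has_chain_0_iff: "has_chain V 0 Z \<longleftrightarrow> (\<exists>Y. irred V Y \<and> Y \<subseteq> Z)"
  by (auto simp: has_chain_def irr_chain_def)

lemma irr_chain_extend:
  assumes "irr_chain V k Y" "irred V A" "Y k \<subset> A"
  shows "irr_chain V (Suc k) (Y(Suc k := A))"
  using assms unfolding irr_chain_def by (auto simp: le_Suc_eq less_Suc_eq)

lemma has_chain_SucI:
  assumes "irr_chain V k Y" "irred V A" "Y k \<subset> A" "A \<subseteq> Z"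
  shows "has_chain V (Suc k) Z"
  unfolding has_chain_def
  using irr_chain_extend[OF assms(1-3)] assms(4) by (intro exI[of _ "Y(Suc k := A)"]) simp

lemma irr_chain_singleton: "x \<in> pts V \<Longrightarrow> irr_chain V 0 (\<lambda>_. {x})"
  using irred_singleton by (auto simp: irr_chain_def)

lemma irr_chain_nonzero_point:
  fixes Y :: "nat \<Rightarrow> (nat \<Rightarrow> 'a::comm_ring_1) set"
  assumes "irr_chain V (Suc k) Y"
  shows "\<exists>x\<in>Y (Suc k). \<exists>i\<in>V. x i \<noteq> 0"
proof (rule ccontr)
  assume not: "\<not> ?thesis"
  have sub: "Y k \<subset> Y (Suc k)" and irr: "irred V (Y k)" "irred V (Y (Suc k))"
    using assms unfolding irr_chain_def by auto
  have "x = (\<lambda>i. 0)" if x: "x \<in> Y (Suc k)" for x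
  proof
    fix i show "x i = 0" using not x irred_pts[OF irr(2)] by (cases "i \<in> V") (auto simp: pts_def)
  qed
  then have "Y (Suc k) \<subseteq> {\<lambda>i. 0}" by blast
  moreover have "Y k \<noteq> {}" using irr(1) by (simp add: irred_def)
  ultimately show False using sub by blast
qed

lemma (in var_ideal) HF_le_of_full_degree:
  assumes N: "full_degree I N" shows "HF I s \<le> card (mons V N)"
proof -
  have "m \<in> mons V N" if m: "m \<in> stdm I s" for m
  proof -
    have "size m \<le> N"
    proof (rule ccontr)
      assume "\<not> size m \<le> N"
      then obtain a b where ab: "m = a + b" "size a = N" using ex_submultiset_size[of N m] by auto
      have "is_lm (mon a (1 :: 'a)) a" by (simp add: is_lm_def)
      moreover have "mon a 1 \<in> I" using N ab(2) by (simp add: full_degree_def)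
      ultimately have "a \<in> LM I" unfolding LM_def by blast
      then have "b + a \<in> LM I" by (rule LM_up)
      then show False using m by (simp add: stdm_def ab(1) add.commute)
    qed
    moreover have "set_mset m \<subseteq> V" using m by (intro std_vars) (simp add: stdm_def)
    ultimately show ?thesis by (simp add: mons_def)
  qed
  then have "stdm I s \<subseteq> mons V N" by (rule subsetI)
  then show ?thesis unfolding HF_def by (intro card_mono finite_mons finV)
qed

text \<open>The multiples of \<open>x\<close> form an infinite set inside finitely many irreducible
  components. Two of them share a component, which therefore strictly contains a single
  point.\<close>

lemma (in hom_ideal) has_chain_1_of_nonzero_zero:
  assumes inf: "infinite (UNIV :: 'a set)" and x: "x \<in> zeros V I" "x i \<noteq> 0"
  shows "has_chain V (Suc 0) (zeros V I)"
proof -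
  obtain \<A> where A: "finite \<A>" "\<forall>Y\<in>\<A>. irred V Y" "zeros V I = \<Union>\<A>"
    using finite_irred_decomposition[OF finV zclosed_zeros[of V I]] by (elim exE conjE)
  have "(\<lambda>i. c * x i) \<in> \<Union>\<A>" for c unfolding A(3)[symmetric] by (rule zeros_scale[OF x(1)])
  then have "\<forall>c. \<exists>Y. Y \<in> \<A> \<and> (\<lambda>i. c * x i) \<in> Y" by (simp only: Union_iff Bex_def) simp
  from choice[OF this] obtain g where g0: "\<forall>c. g c \<in> \<A> \<and> (\<lambda>i. c * x i) \<in> g c" by (rule exE)
  have g: "g c \<in> \<A>" "(\<lambda>i. c * x i) \<in> g c" for c using spec[OF g0, of c] by simp_all
  have "\<not> inj g"
  proof
    assume inj: "inj g"
    have "range g \<subseteq> \<A>" using g(1) by (simp add: image_subset_iff)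
    then have "finite (range g)" using A(1) by (rule finite_subset)
    from finite_imageD[OF this inj] inf show False by simp
  qed
  then have "\<exists>a b. g a = g b \<and> a \<noteq> b" by (simp only: inj_def not_all not_imp)
  then obtain a b where ab: "g a = g b" "a \<noteq> b" by (elim exE conjE)
  have ne: "(\<lambda>k. b * x k) \<noteq> (\<lambda>k. a * x k)"
  proof
    assume "(\<lambda>k. b * x k) = (\<lambda>k. a * x k)"
    from fun_cong[OF this, of i] show False using ab(2) x(2) by simp
  qed
  have mem: "(\<lambda>k. b * x k) \<in> g a" using g(2)[of b] ab(1) by simp
  have "{\<lambda>i. a * x i} \<noteq> g a"
  proof
    assume "{\<lambda>i. a * x i} = g a"
    with mem have "(\<lambda>k. b * x k) \<in> {\<lambda>i. a * x i}" by (simp only:)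
    with ne show False by simp
  qed
  moreover have "{\<lambda>i. a * x i} \<subseteq> g a" using g(2)[of a] by simp
  ultimately have "{\<lambda>i. a * x i} \<subset> g a" by (rule psubsetI[rotated])
  moreover have "(\<lambda>i. a * x i) \<in> pts V" using zeros_scale[OF x(1)] by (simp add: zeros_def)
  moreover have "irred V (g a)" using A(2) g(1) by blast
  moreover have "g a \<subseteq> zeros V I" unfolding A(3) by (rule Union_upper[OF g(1)])
  ultimately show ?thesis
    by (intro has_chain_SucI[OF irr_chain_singleton])
qed

text \<open>Here the Nullstellensatz enters: without a nonzero zero, \<open>I\<close> contains a
  power of the irrelevant ideal, and only finitely many monomials are standard.\<close>

lemma bounded_HF_of_no_chain_1:
  fixes I :: "'a::alg_closed_field mpoly set"
  assumes I: "hom_ideal V I" and no: "\<not> has_chain V 1 (zeros V I)"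
  shows "\<exists>K. \<forall>s. HF I s \<le> K"
proof -
  interpret hom_ideal V I by fact
  have "\<exists>N. full_degree I N"
  proof (rule ccontr)
    assume "\<nexists>N. full_degree I N"
    then have "\<not> full_degree I N" for N by simp
    from homogeneous_nullstellensatz[OF I this]
    obtain x i where x: "x \<in> zeros V I" "x i \<noteq> 0" by (elim bexE)
    from has_chain_1_of_nonzero_zero[OF alg_closed_infinite x] no show False by simp
  qed
  then obtain N where "full_degree I N" by (rule exE)
  then show ?thesis using HF_le_of_full_degree by blast
qed

text \<open>A hyperplane that contains no component with a nonzero point cuts the length of chains
  by one. By \<open>HF_adjoin_linear\<close> the increments of the Hilbert function are bounded by
  the Hilbert function of the section.\<close>

lemma HF_growth_of_no_chain:
  fixes I :: "'a::alg_closed_field mpoly set"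
  assumes "hom_ideal V I" "\<not> has_chain V (Suc j) (zeros V I)"
  shows "\<exists>K. \<forall>s. HF I s \<le> K * (s + 1) ^ j"
  using assms
proof (induction j arbitrary: I)
  case 0
  then show ?case using bounded_HF_of_no_chain_1[of V I] by simp
next
  case (Suc j)
  interpret hom_ideal V I by fact
  obtain \<A> where A: "finite \<A>" "\<forall>Y\<in>\<A>. irred V Y" "zeros V I = \<Union>\<A>"
    using finite_irred_decomposition[OF finV zclosed_zeros[of V I]] by (elim exE conjE)
  \<comment> \<open>No homogeneous linear form avoids a component consisting of the origin alone,
    but such a component cannot contain the top of a chain of positive length.\<close>
  define \<B> where "\<B> = {Y \<in> \<A>. \<exists>x\<in>Y. \<exists>i\<in>V. x i \<noteq> 0}"
  have "\<forall>Y\<in>\<B>. \<exists>x. x \<in> Y \<and> (\<exists>i\<in>V. x i \<noteq> 0)" by (auto simp: \<B>_def)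
  from bchoice[OF this] obtain p where p: "\<forall>Y\<in>\<B>. p Y \<in> Y \<and> (\<exists>i\<in>V. p Y i \<noteq> 0)" by (rule exE)
  have fin: "finite (p ` \<B>)" using A(1) by (simp add: \<B>_def)
  have "\<exists>i\<in>V. x i \<noteq> 0" if "x \<in> p ` \<B>" for x using p that by auto
  from linear_form_avoiding[OF alg_closed_infinite finV fin this]
  obtain c where c: "\<forall>x\<in>p ` \<B>. (\<Sum>i\<in>V. c i * x i) \<noteq> 0" by (rule exE)
  define l where "l = (\<Sum>i\<in>V. Cst (c i) * Var i)"
  have l: "homog 1 l" unfolding l_def by (intro homog_sum homog_Cst_mult homog_mon) simp
  have evl: "ev x l = (\<Sum>i\<in>V. c i * x i)" for x by (simp add: l_def)
  interpret L: hom_ideal V "adjoin I l" by (rule hom_ideal_adjoin[OF l])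
  have "\<not> has_chain V (Suc j) (zeros V (adjoin I l))"
  proof
    assume "has_chain V (Suc j) (zeros V (adjoin I l))"
    then obtain Y where Y: "irr_chain V (Suc j) Y" "Y (Suc j) \<subseteq> zeros V (adjoin I l)"
      unfolding has_chain_def by blast
    have irr: "irred V (Y (Suc j))" using Y(1) by (simp add: irr_chain_def)
    have "zeros V (adjoin I l) \<subseteq> zeros V I" using adjoin_superset[of l] by (auto simp: zeros_def)
    then have sub: "Y (Suc j) \<subseteq> \<Union>\<A>" using Y(2) A(3) by simp
    have "zclosed V B" if "B \<in> \<A>" for B using A(2) that by (simp add: irred_def)
    from irred_subset_Union[OF irr A(1) this sub]
    obtain Z where Z: "Z \<in> \<A>" "Y (Suc j) \<subseteq> Z" by (rule bexE)
    obtain x where "x \<in> Y (Suc j)" "\<exists>i\<in>V. x i \<noteq> 0" using irr_chain_nonzero_point[OF Y(1)] by (rule bexE)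
    then have "Z \<in> \<B>" using Z by (auto simp: \<B>_def)
    then have "ev (p Z) l \<noteq> 0" using c by (simp add: evl)
    then have "p Z \<notin> zeros V (adjoin I l)" using gen_mem_adjoin[of l] by (auto simp: zeros_def)
    then have "p Z \<notin> Y (Suc j)" using Y(2) by blast
    moreover have "p Z \<in> Z" using p \<open>Z \<in> \<B>\<close> by simp
    ultimately have ss: "Y (Suc j) \<subset> Z" using Z(2) by blast
    have "irred V Z" using A(2) Z(1) by simp
    moreover have "Z \<subseteq> zeros V I" unfolding A(3) by (rule Union_upper[OF Z(1)])
    ultimately have "has_chain V (Suc (Suc j)) (zeros V I)" using ss by (intro has_chain_SucI[OF Y(1)])
    with Suc.prems(2) show False by simp
  qed
  then obtain K where K: "\<And>s. HF (adjoin I l) s \<le> K * (s + 1) ^ j"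
    using Suc.IH[OF L.hom_ideal_axioms] by blast
  \<comment> \<open>The summand \<open>HF I 0\<close> makes the bound true at \<open>s = 0\<close>;
    the rest is summation of the increments.\<close>
  have "HF I s \<le> (K + HF I 0) * (s + 1) ^ Suc j" for s
  proof (induction s)
    case 0
    show ?case by simp
  next
    case (Suc s)
    have "HF I (Suc s) \<le> HF I s + HF (adjoin I l) (Suc s)" by (rule HF_adjoin_linear[OF l])
    also have "\<dots> \<le> (K + HF I 0) * (s + 1) ^ Suc j + K * (Suc s + 1) ^ j"
      using Suc K[of "Suc s"] by linarith
    also have "\<dots> \<le> (K + HF I 0) * ((s + 1) * (Suc s + 1) ^ j) + (K + HF I 0) * (Suc s + 1) ^ j"
    proof (rule add_mono)
      have "(s + 1) ^ Suc j \<le> (s + 1) * (Suc s + 1) ^ j"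
        unfolding power_Suc by (intro mult_le_mono2 power_mono) simp_all
      then show "(K + HF I 0) * (s + 1) ^ Suc j \<le> (K + HF I 0) * ((s + 1) * (Suc s + 1) ^ j)"
        by (rule mult_le_mono2)
      show "K * (Suc s + 1) ^ j \<le> (K + HF I 0) * (Suc s + 1) ^ j" by (rule mult_le_mono1) simp
    qed
    also have "\<dots> = (K + HF I 0) * (Suc s + 1) ^ Suc j" by (simp add: algebra_simps)
    finally show ?case .
  qed
  then show ?case by blast
qed

text \<open>Converse to \<open>irr_chain_HF_ge\<close> for homogeneous ideals: without a chain of
  length \<open>j > 0\<close> the growth is of order \<open>j - 1\<close>, so the binomial
  coefficient of order \<open>j\<close> wins eventually. For \<open>j = 0\<close> there are no
  zeros, and the ideal contains a nonzero constant.\<close>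

theorem HF_small_of_no_chain:
  fixes I :: "'a::alg_closed_field mpoly set"
  assumes I: "hom_ideal V I" and no: "\<not> has_chain V j (zeros V I)"
  shows "\<exists>t. HF I t < (t + j) choose j"
proof (cases j)
  case 0
  have "zeros V I = {}"
  proof (rule ccontr)
    assume "zeros V I \<noteq> {}"
    then obtain x where x: "x \<in> zeros V I" by blast
    then have "irred V {x}" by (intro irred_singleton) (simp add: zeros_def)
    then show False using no x unfolding 0 has_chain_0_iff by blast
  qed
  then show ?thesis using hom_ideal.HF_eq_0_of_no_zeros[OF I] 0 by auto
next
  case (Suc k)
  obtain K where K: "\<And>s. HF I s \<le> K * (s + 1) ^ k" using HF_growth_of_no_chain[OF I] no Suc by blast
  show ?thesis
  proof (rule ccontr)
    assume "\<not> ?thesis"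
    then have ge: "(t + j) choose j \<le> HF I t" for t by (simp add: not_less)
    \<comment> \<open>At this \<open>t\<close> the inequality
      \<open>(t + 1) ^ Suc k \<le> j ^ j * K * (t + 1) ^ k\<close> fails.\<close>
    define t where "t = j ^ j * K"
    have "(t + 1) ^ k * (t + 1) \<le> j ^ j * ((t + j) choose j)"
      using power_le_binomial[of t j] by (simp add: Suc mult.commute)
    also have "\<dots> \<le> j ^ j * (K * (t + 1) ^ k)" using ge[of t] K[of t] by (intro mult_le_mono2) linarith
    also have "\<dots> = (t + 1) ^ k * t" by (simp add: t_def)
    finally have "t + 1 \<le> t" by (rule iffD1[OF nat_mult_le_cancel1, rotated]) simp
    then show False by simp
  qed
qed

lemma coeff_hom_id' [simp]: "coeff_hom id"
  by (simp add: coeff_hom_def)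

section \<open>Nullity of a matrix is a closed condition\<close>

text \<open>Rows are indexed by \<open>A\<close>, columns by \<open>B\<close>; the kernel contains
  \<open>b\<close> independent vectors. Independence is expressed through coefficients, in the style
  of \<open>underdetermined_system\<close>.\<close>

definition nullity_ge :: "'r set \<Rightarrow> 'c set \<Rightarrow> ('r \<Rightarrow> 'c \<Rightarrow> 'a::field) \<Rightarrow> nat \<Rightarrow> bool"
  where "nullity_ge A B M b \<longleftrightarrow> (\<exists>v :: nat \<Rightarrow> 'c \<Rightarrow> 'a.
    (\<forall>k<b. \<forall>i\<in>A. (\<Sum>j\<in>B. M i j * v k j) = 0) \<and>
    (\<forall>c. (\<forall>j\<in>B. (\<Sum>k<b. c k * v k j) = 0) \<longrightarrow> (\<forall>k<b. c k = 0)))"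

lemma nullity_ge_le_card:
  fixes M :: "'r \<Rightarrow> 'c \<Rightarrow> 'a::field"
  assumes "finite B" "nullity_ge A B M b" shows "b \<le> card B"
proof (rule ccontr)
  assume "\<not> ?thesis"
  then have less: "card B < card {..<b}" by simp
  obtain v :: "nat \<Rightarrow> 'c \<Rightarrow> 'a"
    where v: "\<forall>c. (\<forall>j\<in>B. (\<Sum>k<b. c k * v k j) = 0) \<longrightarrow> (\<forall>k<b. c k = 0)"
    using assms(2) unfolding nullity_ge_def by (elim exE conjE)
  obtain c where c: "\<exists>k\<in>{..<b}. c k \<noteq> 0" "\<forall>j\<in>B. (\<Sum>k<b. c k * v k j) = 0"
    using underdetermined_system[OF finite_lessThan assms(1) less, of v] by (elim exE conjE)
  then show False using spec[OF v, of c] by auto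
qed

lemma nullity_ge_zero:
  fixes M :: "'r \<Rightarrow> 'c \<Rightarrow> 'a::field"
  assumes "finite B" "b \<le> card B" "\<And>i j. i \<in> A \<Longrightarrow> j \<in> B \<Longrightarrow> M i j = 0"
  shows "nullity_ge A B M b"
proof -
  obtain C where C: "C \<subseteq> B" "card C = b" using obtain_subset_with_card_n[OF assms(2)] by auto
  have finC: "finite C" using C(1) assms(1) by (rule finite_subset)
  obtain e where e: "bij_betw e {..<b} C"
    using ex_bij_betw_nat_finite[OF finC] C(2) by (auto simp: atLeast0LessThan)
  define v :: "nat \<Rightarrow> 'c \<Rightarrow> 'a" where "v k j = (if j = e k then 1 else 0)" for k j
  have "(\<Sum>j\<in>B. M i j * v k j) = 0" if "i \<in> A" for i k
    using assms(3)[OF that] by (intro sum.neutral) simp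
  moreover have "c k = 0" if c: "\<forall>j\<in>B. (\<Sum>k<b. c k * v k j) = 0" and k: "k < b" for c k
  proof -
    have "e k \<in> B" using e k C(1) by (auto simp: bij_betw_def)
    then have "(\<Sum>l<b. c l * v l (e k)) = 0" using c by simp
    also have "(\<Sum>l<b. c l * v l (e k)) = (\<Sum>l<b. if l = k then c l else 0)"
    proof (rule sum.cong)
      fix l assume "l \<in> {..<b}"
      then have "e k = e l \<longleftrightarrow> l = k" using e k by (auto simp: bij_betw_def inj_on_def)
      then show "c l * v l (e k) = (if l = k then c l else 0)" by (simp add: v_def)
    qed simp
    also have "\<dots> = c k" using k by simp
    finally show ?thesis .
  qed
  ultimately show ?thesis unfolding nullity_ge_def by (intro exI[of _ v]) simp
qed

text \<open>Eliminating the variable of a pivot identifies the kernel of \<open>M\<close> with that of the scaled Schur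
  complement; the scaling keeps the entries polynomial.\<close>

lemma nullity_ge_pivot:
  fixes M :: "'r \<Rightarrow> 'c \<Rightarrow> 'a::field"
  assumes B: "finite B" and p: "p \<in> A" "q \<in> B" "M p q \<noteq> 0"
  shows "nullity_ge A B M b \<longleftrightarrow>
    nullity_ge (A - {p}) (B - {q}) (\<lambda>i j. M p q * M i j - M i q * M p j) b" (is "_ \<longleftrightarrow> nullity_ge ?A ?B ?M b")
proof -
  have split: "(\<Sum>j\<in>B. g j) = g q + (\<Sum>j\<in>?B. g j)" for g :: "'c \<Rightarrow> 'a"
    by (rule sum.remove[OF B p(2)])
  have schur: "(\<Sum>j\<in>?B. ?M i j * w j) = M p q * (\<Sum>j\<in>?B. M i j * w j) - M i q * (\<Sum>j\<in>?B. M p j * w j)" for i w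
    by (simp add: left_diff_distrib sum_subtractf sum_distrib_left mult.assoc)
  show ?thesis
  proof
    assume "nullity_ge A B M b"
    then obtain v where v: "\<forall>k<b. \<forall>i\<in>A. (\<Sum>j\<in>B. M i j * v k j) = 0"
      and ind: "\<forall>c. (\<forall>j\<in>B. (\<Sum>k<b. c k * v k j) = 0) \<longrightarrow> (\<forall>k<b. c k = 0)"
      unfolding nullity_ge_def by (elim exE conjE)
    have rest: "(\<Sum>j\<in>?B. M i j * v k j) = - (M i q * v k q)" if "k < b" "i \<in> A" for i k
      using v that split[of "\<lambda>j. M i j * v k j"] by (simp add: eq_neg_iff_add_eq_0 add.commute)
    have "(\<Sum>j\<in>?B. ?M i j * v k j) = 0" if "k < b" "i \<in> ?A" for i k
    proof -
      have "i \<in> A" using that by simp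
      then show ?thesis unfolding schur rest[OF that(1) p(1)] rest[OF that(1) \<open>i \<in> A\<close>] by simp
    qed
    moreover have "\<forall>k<b. c k = 0" if c: "\<forall>j\<in>?B. (\<Sum>k<b. c k * v k j) = 0" for c
    proof -
      have "M p q * (\<Sum>k<b. c k * v k q) = (\<Sum>k<b. c k * (M p q * v k q))"
        by (simp add: sum_distrib_left mult.left_commute)
      also have "\<dots> = (\<Sum>k<b. c k * - (\<Sum>j\<in>?B. M p j * v k j))"
        using rest[OF _ p(1)] by (intro sum.cong) simp_all
      also have "\<dots> = - (\<Sum>k<b. \<Sum>j\<in>?B. M p j * (c k * v k j))"
        by (simp add: sum_negf sum_distrib_left mult.left_commute)
      also have "(\<Sum>k<b. \<Sum>j\<in>?B. M p j * (c k * v k j)) = (\<Sum>j\<in>?B. M p j * (\<Sum>k<b. c k * v k j))"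
        by (subst sum.swap) (simp add: sum_distrib_left)
      also have "\<dots> = 0" using c by (intro sum.neutral) simp
      finally have "(\<Sum>k<b. c k * v k q) = 0" using p(3) by simp
      then have "\<forall>j\<in>B. (\<Sum>k<b. c k * v k j) = 0" using c by auto
      then show ?thesis using spec[OF ind, of c] by simp
    qed
    ultimately show "nullity_ge ?A ?B ?M b" unfolding nullity_ge_def by (intro exI[of _ v]) simp
  next
    assume "nullity_ge ?A ?B ?M b"
    then obtain v where v: "\<forall>k<b. \<forall>i\<in>?A. (\<Sum>j\<in>?B. ?M i j * v k j) = 0"
      and ind: "\<forall>c. (\<forall>j\<in>?B. (\<Sum>k<b. c k * v k j) = 0) \<longrightarrow> (\<forall>k<b. c k = 0)"
      unfolding nullity_ge_def by (elim exE conjE)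
    define w where "w k j = (if j = q then - (\<Sum>j\<in>?B. M p j * v k j) / M p q else v k j)" for k j
    have w: "(\<Sum>j\<in>?B. g j * w k j) = (\<Sum>j\<in>?B. g j * v k j)" for g k
      by (rule sum.cong) (simp_all add: w_def)
    have wq: "w k q = - (\<Sum>j\<in>?B. M p j * v k j) / M p q" for k by (simp add: w_def)
    have "(\<Sum>j\<in>B. M i j * w k j) = 0" if k: "k < b" and i: "i \<in> A" for i k
    proof (cases "i = p")
      case True
      then show ?thesis using p(3) by (simp add: split w wq)
    next
      case False
      then have "(\<Sum>j\<in>?B. ?M i j * v k j) = 0" using v k i by simp
      then have "M p q * (\<Sum>j\<in>?B. M i j * v k j) = M i q * (\<Sum>j\<in>?B. M p j * v k j)"
        unfolding schur by simp
      then have "(\<Sum>j\<in>?B. M i j * v k j) = M i q * (\<Sum>j\<in>?B. M p j * v k j) / M p q"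
        using p(3) by (simp add: nonzero_eq_divide_eq mult.commute)
      then show ?thesis unfolding split w wq by simp
    qed
    moreover have "\<forall>k<b. c k = 0" if c: "\<forall>j\<in>B. (\<Sum>k<b. c k * w k j) = 0" for c
    proof -
      have "(\<Sum>k<b. c k * v k j) = 0" if j: "j \<in> ?B" for j
      proof -
        have "(\<Sum>k<b. c k * w k j) = 0" using c j by simp
        moreover have "w k j = v k j" for k using j by (simp add: w_def)
        ultimately show ?thesis by simp
      qed
      then show ?thesis using spec[OF ind, of c] by simp
    qed
    ultimately show "nullity_ge A B M b" unfolding nullity_ge_def by (intro exI[of _ w]) simp
  qed
qed

text \<open>These play the part of minors: each polynomial is a product of pivots along one course
  of fraction-free elimination, and all choices of pivots are taken. The factor 1 at the end records
  that too few columns are left for a kernel of dimension \<open>b\<close>.\<close>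

primrec elim_polys :: "nat \<Rightarrow> 'r set \<Rightarrow> 'c set \<Rightarrow> ('r \<Rightarrow> 'c \<Rightarrow> int mpoly) \<Rightarrow> nat \<Rightarrow> int mpoly set"
  where
    "elim_polys 0 A B M b = (if b \<le> card B then {} else {1})"
  | "elim_polys (Suc k) A B M b = (if b \<le> card B then
      (\<Union>(i, j)\<in>A \<times> B. (\<lambda>P. M i j * P) `
        elim_polys k (A - {i}) (B - {j}) (\<lambda>i' j'. M i j * M i' j' - M i' j * M i j') b)
      else {1})"

text \<open>A branch whose pivot vanishes at \<open>h\<close> imposes nothing; a branch whose pivot
  does not vanish is equivalent to the condition by \<open>nullity_ge_pivot\<close>. If every entry
  vanishes, the kernel is everything.\<close>

lemma nullity_ge_iff_elim_polys:
  fixes h :: "nat \<Rightarrow> 'a::field"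
  assumes "finite A" "finite B" "card A = k"
  shows "nullity_ge A B (\<lambda>i j. iev h (M i j)) b \<longleftrightarrow> (\<forall>P\<in>elim_polys k A B M b. iev h P = 0)"
  using assms
proof (induction k arbitrary: A B M)
  case 0
  then have A: "A = {}" by simp
  show ?case
  proof (cases "b \<le> card B")
    case True
    then show ?thesis using nullity_ge_zero[OF 0(2) True, of A] A by simp
  next
    case False
    then show ?thesis using nullity_ge_le_card[OF 0(2), of A _ b] by auto
  qed
next
  case (Suc k)
  define N where "N i j = (\<lambda>i' j'. M i j * M i' j' - M i' j * M i j')" for i j
  have IH: "nullity_ge (A - {i}) (B - {j}) (\<lambda>i' j'. iev h (N i j i' j')) b \<longleftrightarrow>
      (\<forall>P\<in>elim_polys k (A - {i}) (B - {j}) (N i j) b. iev h P = 0)" if "i \<in> A" for i j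
    using Suc.prems that by (intro Suc.IH) simp_all
  have pivot: "nullity_ge A B (\<lambda>i j. iev h (M i j)) b \<longleftrightarrow>
      (\<forall>P\<in>elim_polys k (A - {i}) (B - {j}) (N i j) b. iev h P = 0)"
    if ij: "i \<in> A" "j \<in> B" "iev h (M i j) \<noteq> 0" for i j
    using nullity_ge_pivot[where M = "\<lambda>i j. iev h (M i j)" and b = b, OF Suc.prems(2) ij(1,2)] ij(3)
      IH[OF ij(1), of j] by (simp add: N_def)
  show ?case
  proof (cases "b \<le> card B")
    case False
    then show ?thesis using nullity_ge_le_card[OF Suc.prems(2), of A _ b] by auto
  next
    case True
    have elim: "(\<forall>P\<in>elim_polys (Suc k) A B M b. iev h P = 0) \<longleftrightarrow>
        (\<forall>i\<in>A. \<forall>j\<in>B. \<forall>P\<in>elim_polys k (A - {i}) (B - {j}) (N i j) b. iev h (M i j) = 0 \<or> iev h P = 0)"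
      using True by (auto simp: N_def)
    show ?thesis
    proof (cases "\<forall>i\<in>A. \<forall>j\<in>B. iev h (M i j) = 0")
      case zero: True
      then have "nullity_ge A B (\<lambda>i j. iev h (M i j)) b"
        by (intro nullity_ge_zero[OF Suc.prems(2) True]) simp
      then show ?thesis unfolding elim using zero by simp
    next
      case False
      then obtain i0 j0 where ij: "i0 \<in> A" "j0 \<in> B" "iev h (M i0 j0) \<noteq> 0" by blast
      show ?thesis unfolding elim
      proof
        assume L: "nullity_ge A B (\<lambda>i j. iev h (M i j)) b"
        show "\<forall>i\<in>A. \<forall>j\<in>B. \<forall>P\<in>elim_polys k (A - {i}) (B - {j}) (N i j) b. iev h (M i j) = 0 \<or> iev h P = 0"
        proof (intro ballI)
          fix i j P assume "i \<in> A" "j \<in> B" "P \<in> elim_polys k (A - {i}) (B - {j}) (N i j) b"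
          then show "iev h (M i j) = 0 \<or> iev h P = 0" using pivot[of i j] L by auto
        qed
      next
        assume R: "\<forall>i\<in>A. \<forall>j\<in>B. \<forall>P\<in>elim_polys k (A - {i}) (B - {j}) (N i j) b. iev h (M i j) = 0 \<or> iev h P = 0"
        have "\<forall>P\<in>elim_polys k (A - {i0}) (B - {j0}) (N i0 j0) b. iev h P = 0"
          using R ij by blast
        then show "nullity_ge A B (\<lambda>i j. iev h (M i j)) b" using pivot[OF ij] by simp
      qed
    qed
  qed
qed

section \<open>Hilbert functions as nullities\<close>

definition vars_in :: "nat set \<Rightarrow> 'a::zero mpoly \<Rightarrow> bool"
  where "vars_in V f \<longleftrightarrow> (\<forall>m\<in>supp f. set_mset m \<subseteq> V)"

lemma vars_in_diff: "vars_in V f \<Longrightarrow> vars_in V g \<Longrightarrow> vars_in V (f - g)" for f :: "'a::comm_ring_1 mpoly"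
proof -
  assume "vars_in V f" "vars_in V g"
  moreover have "supp (f - g) \<subseteq> supp f \<union> supp g" by (auto simp: in_keys_iff lookup_minus)
  ultimately show ?thesis by (auto simp: vars_in_def)
qed

lemma vars_in_mult: "vars_in V f \<Longrightarrow> vars_in V g \<Longrightarrow> vars_in V (f * g)" for f :: "'a::comm_ring_1 mpoly"
proof -
  assume fg: "vars_in V f" "vars_in V g"
  show ?thesis unfolding vars_in_def
  proof
    fix m assume "m \<in> supp (f * g)"
    then obtain a b where ab: "m = a + b" "a \<in> supp f" "b \<in> supp g" using keys_mult[of f g] by blast
    then show "set_mset m \<subseteq> V" using fg unfolding vars_in_def by simp
  qed
qed

lemma vars_in_mon: "set_mset m \<subseteq> V \<Longrightarrow> vars_in V (mon m c)"
  and vars_in_0 [simp]: "vars_in V 0"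
  and vars_in_1 [simp]: "vars_in V (1 :: 'a::comm_ring_1 mpoly)"
  by (simp_all add: vars_in_def)

lemma vars_in_elim_polys:
  assumes "\<And>i j. i \<in> A \<Longrightarrow> j \<in> B \<Longrightarrow> vars_in V (M i j)" "P \<in> elim_polys k A B M b"
  shows "vars_in V P"
  using assms
proof (induction k arbitrary: A B M P)
  case 0
  then show ?case by (auto split: if_splits)
next
  case (Suc k)
  show ?case
  proof (cases "b \<le> card B")
    case True
    then obtain i j Q where ij: "i \<in> A" "j \<in> B" and Q: "P = M i j * Q"
      "Q \<in> elim_polys k (A - {i}) (B - {j}) (\<lambda>i' j'. M i j * M i' j' - M i' j * M i j') b"
      using Suc.prems(2) by auto
    have "vars_in V Q"
    proof (rule Suc.IH[OF _ Q(2)])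
      fix i' j' assume "i' \<in> A - {i}" "j' \<in> B - {j}"
      then show "vars_in V (M i j * M i' j' - M i' j * M i j')"
        using ij by (intro vars_in_diff vars_in_mult Suc.prems(1)) auto
    qed
    then show ?thesis unfolding Q(1) by (intro vars_in_mult Suc.prems(1) ij)
  next
    case False
    then show ?thesis using Suc.prems(2) by simp
  qed
qed

text \<open>The kernel consists of the linear functionals that annihilate the part of
  \<open>I\<close> supported on \<open>mons V t\<close>, which the rows span. It is dual to the
  quotient, whose dimension is \<open>HF I t\<close>.\<close>

lemma (in var_ideal) HF_ge_iff_nullity_ge:
  fixes r :: "'r \<Rightarrow> 'a mpoly"
  assumes A: "finite A"
    and rows: "\<And>i. i \<in> A \<Longrightarrow> r i \<in> I" "\<And>i. i \<in> A \<Longrightarrow> supp (r i) \<subseteq> mons V t"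
    and span: "\<And>f. f \<in> I \<Longrightarrow> supp f \<subseteq> mons V t \<Longrightarrow> \<exists>e. f = (\<Sum>i\<in>A. Cst (e i) * r i)"
  shows "b \<le> HF I t \<longleftrightarrow> nullity_ge A (mons V t) (\<lambda>i. coef (r i)) b"
proof -
  let ?B = "mons V t"
  have finB: "finite ?B" by (rule finite_mons[OF finV])
  have "\<forall>n\<in>?B. \<exists>c. mon n 1 - (\<Sum>m\<in>stdm I t. mon m (c m)) \<in> I"
  proof
    fix n assume "n \<in> ?B"
    then have "dle t (mon n (1 :: 'a))" by (intro dle_mon) (simp add: mons_def)
    then show "\<exists>c. mon n 1 - (\<Sum>m\<in>stdm I t. mon m (c m)) \<in> I" by (rule normal_form_dle)
  qed
  from bchoice[OF this] obtain d where d: "\<forall>n\<in>?B. mon n 1 - (\<Sum>m\<in>stdm I t. mon m (d n m)) \<in> I" by (rule exE)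
  have expand: "f = (\<Sum>n\<in>?B. mon n (coef f n))" if "supp f \<subseteq> ?B" for f :: "'a mpoly"
  proof -
    have "(\<Sum>n\<in>supp f. mon n (coef f n)) = (\<Sum>n\<in>?B. mon n (coef f n))"
      by (rule sum.mono_neutral_left[OF finB that]) (simp add: in_keys_iff)
    then show ?thesis using poly_eq_sum_mon[of f] by simp
  qed
  show ?thesis
  proof
    assume b: "b \<le> HF I t"
    obtain e where e: "bij_betw e {..<HF I t} (stdm I t)"
      using ex_bij_betw_nat_finite[OF finite_stdm[of t]] by (auto simp: atLeast0LessThan HF_def)
    have eS: "e k \<in> stdm I t" if "k < HF I t" for k using e that by (auto simp: bij_betw_def)
    \<comment> \<open>The \<open>k\<close>-th functional takes the coefficient of the
      \<open>k\<close>-th standard monomial in the normal form; together they are the dual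
      basis.\<close>
    define v where "v k n = d n (e k)" for k n
    have "(\<Sum>n\<in>?B. coef (r i) n * v k n) = 0" if k: "k < b" and i: "i \<in> A" for i k
    proof -
      have memX: "(\<Sum>n\<in>?B. Cst (coef (r i) n) * (mon n 1 - (\<Sum>m\<in>stdm I t. mon m (d n m)))) \<in> I"
        using d by (intro sum_mem mult_mem) simp
      have eqX: "(\<Sum>n\<in>?B. Cst (coef (r i) n) * (mon n 1 - (\<Sum>m\<in>stdm I t. mon m (d n m))))
          = r i - (\<Sum>n\<in>?B. Cst (coef (r i) n) * (\<Sum>m\<in>stdm I t. mon m (d n m)))"
        using expand[OF rows(2)[OF i]] by (simp add: right_diff_distrib sum_subtractf Cst_mult_mon)
      have "r i - (r i - (\<Sum>n\<in>?B. Cst (coef (r i) n) * (\<Sum>m\<in>stdm I t. mon m (d n m)))) \<in> I"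
        using diff_mem[OF rows(1)[OF i] memX] unfolding eqX .
      then have "(\<Sum>n\<in>?B. Cst (coef (r i) n) * (\<Sum>m\<in>stdm I t. mon m (d n m))) \<in> I" by simp
      moreover have "(\<Sum>n\<in>?B. Cst (coef (r i) n) * (\<Sum>m\<in>stdm I t. mon m (d n m)))
          = (\<Sum>m\<in>stdm I t. mon m (\<Sum>n\<in>?B. coef (r i) n * d n m))"
        by (rule poly_mapping_eqI) (simp add: lookup_sum lookup_single when_def)
      ultimately have "(\<Sum>m\<in>stdm I t. mon m (\<Sum>n\<in>?B. coef (r i) n * d n m)) \<in> I" by simp
      from std_sum_indep[OF this eS[of k]] k b show ?thesis by (simp add: v_def)
    qed
    moreover have "\<forall>k<b. c k = 0" if c: "\<forall>n\<in>?B. (\<Sum>k<b. c k * v k n) = 0" for c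
    proof (intro allI impI)
      fix k assume k: "k < b"
      define n where "n = e k"
      have n: "n \<in> stdm I t" "n \<in> ?B" using eS[of k] k b stdm_subset[of t] by (auto simp: n_def)
      have dn: "d n m = (if m = n then 1 else 0)" if m: "m \<in> stdm I t" for m
      proof -
        have "(\<Sum>m\<in>stdm I t. mon m ((if m = n then 1 else 0) - d n m)) = mon n 1 - (\<Sum>m\<in>stdm I t. mon m (d n m))"
        proof (rule poly_mapping_eqI)
          fix a
          show "coef (\<Sum>m\<in>stdm I t. mon m ((if m = n then 1 else 0) - d n m)) a
            = coef (mon n 1 - (\<Sum>m\<in>stdm I t. mon m (d n m))) a"
            using n(1) by (auto simp: lookup_sum lookup_minus lookup_single when_def)
        qed
        then have "(\<Sum>m\<in>stdm I t. mon m ((if m = n then 1 else 0) - d n m)) \<in> I" using d n(2) by simp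
        from std_sum_indep[OF this m] show ?thesis by simp
      qed
      have "(\<Sum>l<b. c l * v l n) = (\<Sum>l<b. if l = k then c l else 0)"
      proof (rule sum.cong)
        fix l assume l: "l \<in> {..<b}"
        then have "e l = n \<longleftrightarrow> l = k" using e k b by (auto simp: bij_betw_def inj_on_def n_def)
        then show "c l * v l n = (if l = k then c l else 0)"
          using dn[OF eS[of l]] l b by (simp add: v_def)
      qed simp
      also have "\<dots> = c k" using k by simp
      finally show "c k = 0" using c n(2) by simp
    qed
    ultimately show "nullity_ge A ?B (\<lambda>i. coef (r i)) b" unfolding nullity_ge_def by (intro exI[of _ v]) simp
  next
    assume "nullity_ge A ?B (\<lambda>i. coef (r i)) b"
    then obtain v where v: "\<forall>k<b. \<forall>i\<in>A. (\<Sum>n\<in>?B. coef (r i) n * v k n) = 0"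
      and ind: "\<forall>c. (\<forall>n\<in>?B. (\<Sum>k<b. c k * v k n) = 0) \<longrightarrow> (\<forall>k<b. c k = 0)"
      unfolding nullity_ge_def by (elim exE conjE)
    show "b \<le> HF I t"
    proof (rule ccontr)
      assume "\<not> ?thesis"
      then have less: "card (stdm I t) < card {..<b}" by (simp add: HF_def)
      obtain c where c: "\<exists>k\<in>{..<b}. c k \<noteq> 0" "\<forall>m\<in>stdm I t. (\<Sum>k<b. c k * v k m) = 0"
        using underdetermined_system[OF finite_lessThan finite_stdm less, of v] by (elim exE conjE)
      \<comment> \<open>This combination of the functionals vanishes on the rows and on the standard
        monomials. Every monomial in \<open>mons V t\<close> is a combination of rows plus one of
        standard monomials, so the functional is zero, against independence.\<close>
      define u where "u n = (\<Sum>k<b. c k * v k n)" for n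
      define Lf where "Lf f = (\<Sum>n\<in>?B. coef f n * u n)" for f :: "'a mpoly"
      have Lr: "Lf (r i) = 0" if i: "i \<in> A" for i
      proof -
        have "Lf (r i) = (\<Sum>n\<in>?B. \<Sum>k<b. c k * (coef (r i) n * v k n))"
          by (simp add: Lf_def u_def sum_distrib_left mult.left_commute)
        also have "\<dots> = (\<Sum>k<b. c k * (\<Sum>n\<in>?B. coef (r i) n * v k n))"
          by (subst sum.swap) (simp add: sum_distrib_left)
        also have "\<dots> = 0" using v i by (intro sum.neutral) simp
        finally show ?thesis .
      qed
      have Lsum: "Lf (\<Sum>a\<in>S. Cst (g a) * f a) = (\<Sum>a\<in>S. g a * Lf (f a))" for S g and f :: "'b \<Rightarrow> 'a mpoly"
        by (simp add: Lf_def lookup_sum sum_distrib_right sum_distrib_left mult.assoc sum.swap[of _ ?B])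
      have Lsum': "Lf (\<Sum>a\<in>A. Cst (g a) * r a) = (\<Sum>a\<in>A. g a * Lf (r a))" for g
        by (simp add: Lf_def lookup_sum sum_distrib_right sum_distrib_left mult.assoc sum.swap[of _ ?B])
      have Lstd: "Lf (\<Sum>m\<in>stdm I t. mon m (g m)) = 0" for g
      proof -
        have "coef (\<Sum>m\<in>stdm I t. mon m (g m)) n * u n = 0" for n
          using c(2) by (cases "n \<in> stdm I t") (simp_all add: lookup_sum lookup_single when_def u_def)
        then show ?thesis unfolding Lf_def by (intro sum.neutral) simp
      qed
      have "u n = 0" if n: "n \<in> ?B" for n
      proof -
        let ?f = "mon n 1 - (\<Sum>m\<in>stdm I t. mon m (d n m))"
        have "supp ?f \<subseteq> ?B"
        proof
          fix a assume "a \<in> supp ?f"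
          then have "a = n \<or> a \<in> stdm I t"
            by (auto simp: in_keys_iff lookup_minus lookup_sum lookup_single when_def split: if_splits)
          then show "a \<in> ?B" using n stdm_subset[of t] by blast
        qed
        from span[OF bspec[OF d n] this] obtain g where g: "?f = (\<Sum>i\<in>A. Cst (g i) * r i)" by (rule exE)
        have "Lf ?f = 0" unfolding g Lsum' using Lr by (intro sum.neutral) simp
        moreover have "Lf ?f = Lf (mon n 1) - Lf (\<Sum>m\<in>stdm I t. mon m (d n m))"
          by (simp add: Lf_def lookup_minus left_diff_distrib sum_subtractf)
        moreover have "Lf (mon n 1) = u n"
          using n finB by (simp add: Lf_def lookup_single when_def if_distrib[of "\<lambda>x. x * _"] cong: if_cong)
        ultimately show ?thesis using Lstd[of "d n"] by simp
      qed
      then show False using spec[OF ind, of c] c(1) by (auto simp: u_def)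
    qed
  qed
qed

section \<open>Noetherianity of integral polynomials, through divisibility of values\<close>

definition lmon :: "'a::zero mpoly \<Rightarrow> nat multiset"
  where "lmon f = (SOME m. is_lm f m)"

lemma is_lm_lmon: "f \<noteq> 0 \<Longrightarrow> is_lm f (lmon f)"
  unfolding lmon_def using ex_is_lm by (rule someI_ex)

lemma is_lm_unique: "is_lm f m \<Longrightarrow> is_lm f m' \<Longrightarrow> m = m'"
  using mle_antisym by (simp add: is_lm_def)

lemma lmon_eq: "is_lm f m \<Longrightarrow> lmon f = m"
  unfolding lmon_def using is_lm_unique[of f] by (intro some_equality)

text \<open>Hilbert's basis theorem over the integers. The sets \<open>J T\<close> are defined by
  divisibility of values, for all moduli \<open>p\<close> at once, and are closed under the ideal
  operations, so that no generators have to be tracked. If they grew forever, Dickson's lemma would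
  allow one of the chosen minimal new elements to be reduced by an earlier one.\<close>

theorem uniform_divisibility_bound:
  fixes S :: "nat \<Rightarrow> int mpoly set"
  assumes V: "finite V" and S: "\<And>t P. P \<in> S t \<Longrightarrow> vars_in V P"
  shows "\<exists>T. \<forall>(p :: int) h. (\<forall>t\<le>T. \<forall>P\<in>S t. p dvd iev h P) \<longrightarrow> (\<forall>t. \<forall>P\<in>S t. p dvd iev h P)"
proof (rule ccontr)
  assume not: "\<not> ?thesis"
  define J where "J T = {f. \<forall>(p :: int) h. (\<forall>t\<le>T. \<forall>P\<in>S t. p dvd iev h P) \<longrightarrow> p dvd iev h f}" for T
  have Jadd: "f - g \<in> J T" "q * g \<in> J T" "f + g \<in> J T" if "f \<in> J T" "g \<in> J T" for f g q T
    using that unfolding J_def by auto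
  have Jmono: "J T \<subseteq> J T'" if TT: "T \<le> T'" for T T'
  proof
    fix f assume f: "f \<in> J T"
    have "p dvd iev h f" if a: "\<forall>t\<le>T'. \<forall>P\<in>S t. (p :: int) dvd iev h P" for p h
    proof -
      have "\<forall>t\<le>T. \<forall>P\<in>S t. p dvd iev h P" using a le_trans[OF _ TT] by blast
      then show ?thesis using f unfolding J_def by blast
    qed
    then show "f \<in> J T'" unfolding J_def by blast
  qed
  have SJ: "P \<in> J t" if "P \<in> S t" for P t using that unfolding J_def by auto
  \<comment> \<open>Polynomials that belong to some \<open>J T'\<close> but not yet to
    \<open>J T\<close>. For each \<open>T\<close> one is chosen whose leading monomial, and then
    whose absolute leading coefficient, is minimal.\<close>
  define D where "D T = {f. vars_in V f \<and> f \<notin> J T \<and> (\<exists>T'. f \<in> J T')}" for T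
  have D: "D T \<noteq> {}" for T
  proof -
    obtain p h where ph: "\<forall>t\<le>T. \<forall>P\<in>S t. p dvd iev h P" "\<not> (\<forall>t. \<forall>P\<in>S t. (p :: int) dvd iev h P)"
      using not by blast
    then obtain t P where P: "P \<in> S t" "\<not> p dvd iev h P" by blast
    then have "P \<notin> J T" using ph(1) unfolding J_def by blast
    then have "P \<in> D T" using S[OF P(1)] SJ[OF P(1)] unfolding D_def by blast
    then show ?thesis by blast
  qed
  define R where "R = inv_image ({(a, b). mless a b} <*lex*> less_than)
    (\<lambda>f :: int mpoly. (lmon f, nat \<bar>coef f (lmon f)\<bar>))"
  have wfR: "wf R" unfolding R_def by (intro wf_inv_image wf_lex_prod wf_mless wf_less_than)
  have "\<forall>T. \<exists>f. f \<in> D T \<and> (\<forall>g. (g, f) \<in> R \<longrightarrow> g \<notin> D T)"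
  proof
    fix T
    obtain f0 where "f0 \<in> D T" using D[of T] by blast
    from wfE_min[OF wfR this] show "\<exists>f. f \<in> D T \<and> (\<forall>g. (g, f) \<in> R \<longrightarrow> g \<notin> D T)" by metis
  qed
  from choice[OF this] obtain f where f0: "\<forall>T. f T \<in> D T \<and> (\<forall>g. (g, f T) \<in> R \<longrightarrow> g \<notin> D T)" by (rule exE)
  have fD: "f T \<in> D T" and fmin: "(g, f T) \<in> R \<Longrightarrow> g \<notin> D T" for T g using spec[OF f0, of T] by auto
  have "\<forall>T. \<exists>T'. f T \<in> J T'" using fD unfolding D_def by blast
  from choice[OF this] obtain nxt where nxt: "\<forall>T. f T \<in> J (nxt T)" by (rule exE)
  have nxt_gr: "T < nxt T" for T
  proof (rule ccontr)
    assume "\<not> T < nxt T"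
    then have "J (nxt T) \<subseteq> J T" by (intro Jmono) simp
    then show False using spec[OF nxt, of T] fD[of T] unfolding D_def by blast
  qed
  define \<tau> where "\<tau> k = (nxt ^^ k) 0" for k
  have tau_Suc: "\<tau> (Suc k) = nxt (\<tau> k)" for k by (simp add: \<tau>_def)
  have tau_mono: "\<tau> i \<le> \<tau> k" if ik: "i \<le> k" for i k
  proof (rule lift_Suc_mono_le[where f = \<tau>, OF _ ik])
    show "\<tau> n \<le> \<tau> (Suc n)" for n using nxt_gr[of "\<tau> n"] by (simp add: tau_Suc)
  qed
  define g where "g k = f (\<tau> k)" for k
  have nz: "g k \<noteq> 0" for k
  proof
    assume "g k = 0"
    moreover have "(0 :: int mpoly) \<in> J (\<tau> k)" unfolding J_def by simp
    ultimately show False using fD[of "\<tau> k"] unfolding D_def g_def by simp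
  qed
  have lm: "is_lm (g k) (lmon (g k))" for k by (rule is_lm_lmon[OF nz])
  have gV: "vars_in V (g k)" for k using fD[of "\<tau> k"] unfolding D_def g_def by simp
  have mV: "set_mset (lmon (g k)) \<subseteq> V" for k using gV[of k] lm[of k] unfolding vars_in_def is_lm_def by blast
  define c where "c k = coef (g k) (lmon (g k))" for k
  have c: "c k \<noteq> 0" for k using lm[of k] by (simp add: c_def is_lm_def in_keys_iff)
  obtain i k where ik: "i < k" "lmon (g i) \<subseteq># lmon (g k)" "nat \<bar>c i\<bar> \<le> nat \<bar>c k\<bar>"
    using dickson[of V "\<lambda>k. lmon (g k)" "\<lambda>k. nat \<bar>c k\<bar>", OF V mV] by (elim exE conjE)
  define a where "a = lmon (g k) - lmon (g i)"
  have a: "lmon (g k) = a + lmon (g i)" using ik(2) by (simp add: a_def)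
  define q where "q = c k div c i"
  \<comment> \<open>Division with remainder of the leading coefficient by an earlier one that is no
    larger. The result is smaller than \<open>g k\<close>, but it is still new at stage
    \<open>\<tau> k\<close>, since \<open>g i\<close> already belongs to
    \<open>J (\<tau> k)\<close>.\<close>
  define f' where "f' = g k - mon a q * g i"
  have giJ: "g i \<in> J (\<tau> k)"
  proof -
    have "g i \<in> J (\<tau> (Suc i))" using spec[OF nxt, of "\<tau> i"] by (simp add: g_def tau_Suc)
    moreover have "J (\<tau> (Suc i)) \<subseteq> J (\<tau> k)" using ik(1) by (intro Jmono tau_mono) simp
    ultimately show ?thesis by blast
  qed
  then have qgi: "mon a q * g i \<in> J (\<tau> k)" by (rule Jadd(2)[OF giJ])
  have gkN: "g k \<notin> J (\<tau> k)" using fD[of "\<tau> k"] unfolding D_def g_def by simp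
  have f'N: "f' \<notin> J (\<tau> k)"
  proof
    assume "f' \<in> J (\<tau> k)"
    from Jadd(3)[OF this qgi] have "g k \<in> J (\<tau> k)" by (simp add: f'_def)
    with gkN show False ..
  qed
  have "f' \<in> J (\<tau> (Suc k))"
  proof -
    have "g k \<in> J (\<tau> (Suc k))" using spec[OF nxt, of "\<tau> k"] by (simp add: g_def tau_Suc)
    moreover have "mon a q * g i \<in> J (\<tau> (Suc k))" using qgi Jmono[OF tau_mono[of k "Suc k"]] by auto
    ultimately show ?thesis unfolding f'_def by (rule Jadd(1))
  qed
  moreover have "vars_in V f'"
  proof -
    have "set_mset a \<subseteq> V" using mV[of k] unfolding a by simp
    then show ?thesis unfolding f'_def by (intro vars_in_diff vars_in_mult gV vars_in_mon)
  qed
  ultimately have f'D: "f' \<in> D (\<tau> k)" using f'N unfolding D_def by blast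
  have f'nz: "f' \<noteq> 0"
  proof
    assume "f' = 0"
    then show False using f'N by (simp add: J_def)
  qed
  have le: "mle m (lmon (g k))" if m: "m \<in> supp f'" for m
  proof -
    have "m \<in> supp (g k) \<or> m \<in> supp (mon a q * g i)"
      using m by (auto simp: f'_def in_keys_iff lookup_minus)
    then show ?thesis
    proof
      assume "m \<in> supp (g k)"
      then show ?thesis using lm[of k] by (simp add: is_lm_def)
    next
      assume "m \<in> supp (mon a q * g i)"
      then obtain n where n: "m = a + n" "n \<in> supp (g i)" using supp_mon_mult[of a q "g i"] by blast
      have "mle n (lmon (g i))" using lm[of i] n(2) by (simp add: is_lm_def)
      then show ?thesis unfolding n(1) a by (rule mle_add)
    qed
  qed
  have cf: "coef f' (lmon (g k)) = c k mod c i"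
  proof -
    have "coef (mon a q * g i) (lmon (g k)) = q * c i" unfolding a c_def by (rule coef_mon_mult)
    then show ?thesis by (simp add: f'_def lookup_minus c_def[symmetric] q_def minus_div_mult_eq_mod)
  qed
  have "(f', g k) \<in> R"
  proof (cases "c k mod c i = 0")
    case True
    have "lmon f' \<in> supp f'" using is_lm_lmon[OF f'nz] by (simp add: is_lm_def)
    then have "mle (lmon f') (lmon (g k))" "lmon f' \<noteq> lmon (g k)" using le cf True by (auto simp: in_keys_iff)
    then have "mless (lmon f') (lmon (g k))" by (simp add: mle_def)
    then show ?thesis by (simp add: R_def)
  next
    case False
    then have "is_lm f' (lmon (g k))" using le cf by (simp add: is_lm_def in_keys_iff)
    then have eq: "lmon f' = lmon (g k)" by (rule lmon_eq)
    have "\<bar>c k mod c i\<bar> < \<bar>c i\<bar>" using c[of i] by (rule abs_mod_less)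
    moreover have "\<bar>c i\<bar> \<le> \<bar>c k\<bar>" using ik(3) c[of k] by simp
    ultimately have "\<bar>coef f' (lmon (g k))\<bar> < \<bar>c k\<bar>" unfolding cf by linarith
    then have "nat \<bar>coef f' (lmon f')\<bar> < nat \<bar>coef (g k) (lmon (g k))\<bar>"
      unfolding eq c_def by simp
    then show ?thesis by (simp add: R_def eq)
  qed
  then have "f' \<notin> D (\<tau> k)" using fmin unfolding g_def by blast
  with f'D show False by simp
qed

section \<open>Homogeneously generated ideals\<close>

text \<open>The ideal generated by the variables outside \<open>V\<close>, described by
  coefficients; \<open>gideal\<close> starts from it in order to satisfy
  \<open>var_ideal\<close>.\<close>

definition outer :: "nat set \<Rightarrow> 'a::zero mpoly set"
  where "outer V = {f. \<forall>m. set_mset m \<subseteq> V \<longrightarrow> coef f m = 0}"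

primrec gideal :: "nat set \<Rightarrow> 'a::comm_ring_1 mpoly list \<Rightarrow> 'a mpoly set"
  where "gideal V [] = outer V" | "gideal V (g # gs) = adjoin (gideal V gs) g"

lemma outer_mult:
  fixes f :: "'a::comm_ring_1 mpoly"
  assumes "f \<in> outer V" shows "g * f \<in> outer V"
proof -
  have mon: "coef (mon a c * f) m = 0" if m: "set_mset m \<subseteq> V" for a c m
  proof (cases "m \<in> supp (mon a c * f)")
    case True
    then obtain m' where m': "m = a + m'" "m' \<in> supp f" using supp_mon_mult[of a c f] by blast
    then have "set_mset m' \<subseteq> V" using m by simp
    then show ?thesis using assms m'(2) by (simp add: outer_def in_keys_iff)
  qed (simp add: in_keys_iff)
  have "coef (g * f) m = 0" if m: "set_mset m \<subseteq> V" for m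
    by (induction g rule: mpoly_induct) (simp_all add: distrib_right lookup_add mon[OF m])
  then show ?thesis by (simp add: outer_def)
qed

lemma hom_ideal_outer: "finite V \<Longrightarrow> hom_ideal V (outer V :: 'a::field mpoly set)"
proof
  fix i assume "i \<notin> V"
  then show "Var i \<in> (outer V :: 'a mpoly set)" by (auto simp: outer_def lookup_single when_def)
next
  show "pideal (outer V :: 'a mpoly set)"
    unfolding pideal_def using outer_mult by (auto simp: outer_def lookup_add)
next
  fix f :: "'a mpoly" and k assume "f \<in> outer V"
  then show "hcomp k f \<in> outer V" by (simp add: outer_def coef_hcomp)
qed

lemma hom_ideal_gideal:
  assumes "finite V" "\<And>g. g \<in> set gs \<Longrightarrow> \<exists>e. homog e g"
  shows "hom_ideal V (gideal V gs :: 'a::field mpoly set)"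
  using assms(2)
proof (induction gs)
  case Nil
  then show ?case using hom_ideal_outer[OF assms(1)] by simp
next
  case (Cons g gs)
  then have "hom_ideal V (gideal V gs)" by simp
  moreover obtain e where "homog e g" using Cons.prems by auto
  ultimately show ?case using hom_ideal.hom_ideal_adjoin by (metis gideal.simps(2))
qed

lemma zeros_outer: "zeros V (outer V) = (pts V :: (nat \<Rightarrow> 'a::field) set)"
proof -
  have "ev x f = 0" if x: "x \<in> pts V" and f: "f \<in> outer V" for x :: "nat \<Rightarrow> 'a" and f
  proof -
    have *: "coef f m * (\<Prod>i\<in>#m. x i) = 0" for m
    proof (cases "set_mset m \<subseteq> V")
      case True
      then show ?thesis using f by (simp add: outer_def)
    next
      case False
      then obtain i where "i \<in># m" "i \<notin> V" by blast
      then have "(\<Prod>i\<in>#m. x i) = 0" using x by (auto simp: pts_def prod_mset_zero_iff)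
      then show ?thesis by simp
    qed
    show ?thesis unfolding hom_eval_def by (rule sum.neutral, rule ballI, rule *)
  qed
  then show ?thesis by (auto simp: zeros_def)
qed

lemma (in var_ideal) zeros_adjoin: "zeros V (adjoin I g) = {x \<in> zeros V I. ev x g = 0}"
proof (intro equalityI subsetI)
  fix x assume "x \<in> zeros V (adjoin I g)"
  then show "x \<in> {x \<in> zeros V I. ev x g = 0}"
    using adjoin_superset[of g] gen_mem_adjoin[of g] by (auto simp: zeros_def)
next
  fix x assume "x \<in> {x \<in> zeros V I. ev x g = 0}"
  then show "x \<in> zeros V (adjoin I g)" by (auto simp: zeros_def adjoin_def)
qed

lemma zeros_gideal:
  assumes "finite V" "\<And>g. g \<in> set gs \<Longrightarrow> \<exists>e. homog e g"
  shows "zeros V (gideal V gs) = {x \<in> pts V. \<forall>g\<in>set gs. ev x (g :: 'a::field mpoly) = 0}"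
  using assms(2)
proof (induction gs)
  case Nil
  then show ?case by (simp add: zeros_outer)
next
  case (Cons g gs)
  then have "var_ideal V (gideal V gs)" using hom_ideal_gideal[OF assms(1), of gs] by (simp add: hom_ideal_def)
  from var_ideal.zeros_adjoin[OF this, of g] Cons show ?case by auto
qed

section \<open>The Macaulay matrix of a homogeneously generated ideal\<close>

definition proj :: "nat set \<Rightarrow> nat \<Rightarrow> 'a::comm_ring_1 mpoly \<Rightarrow> 'a mpoly"
  where "proj V t f = (\<Sum>m\<in>{m \<in> supp f. m \<in> mons V t}. mon m (coef f m))"

lemma coef_proj: "coef (proj V t f) m = (if m \<in> mons V t then coef f m else 0)"
proof -
  have "coef (proj V t f) m = (\<Sum>n\<in>{m \<in> supp f. m \<in> mons V t}. if n = m then coef f n else 0)"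
    by (simp add: proj_def lookup_sum lookup_single when_def)
  then show ?thesis by (simp add: in_keys_iff)
qed

lemma proj_add: "proj V t (f + g) = proj V t f + proj V t g"
  by (rule poly_mapping_eqI) (simp add: coef_proj lookup_add)

lemma proj_eq: "supp f \<subseteq> mons V t \<Longrightarrow> proj V t f = f"
  by (rule poly_mapping_eqI) (auto simp: coef_proj in_keys_iff)

lemma proj_eq_0: "supp f \<inter> mons V t = {} \<Longrightarrow> proj V t f = 0"
  by (rule poly_mapping_eqI) (auto simp: coef_proj in_keys_iff)

lemma supp_mult_mon: "supp (f * mon a c) \<subseteq> (\<lambda>m. m + a) ` supp f" for f :: "'a::comm_ring_1 mpoly"
  using supp_mon_mult[of a c f] by (simp add: mult.commute add.commute)

lemma coef_mult_mon:
  "coef (f * mon a 1) m = (if a \<subseteq># m then coef f (m - a) else 0)" for f :: "'a::comm_ring_1 mpoly"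
proof (cases "a \<subseteq># m")
  case True
  then have "coef (mon a 1 * f) (a + (m - a)) = coef f (m - a)" by (simp only: coef_mon_mult mult_1)
  then show ?thesis using True by (simp add: mult.commute)
next
  case False
  then have "m \<notin> supp (f * mon a 1)" using supp_mult_mon[of f a 1] by auto
  then show ?thesis using False by (simp add: in_keys_iff)
qed

definition span_rows :: "'r set \<Rightarrow> ('r \<Rightarrow> 'a::comm_ring_1 mpoly) \<Rightarrow> 'a mpoly set"
  where "span_rows A r = {f. \<exists>c. f = (\<Sum>i\<in>A. Cst (c i) * r i)}"

lemma span_rows_add: "f \<in> span_rows A r \<Longrightarrow> g \<in> span_rows A r \<Longrightarrow> f + g \<in> span_rows A r"
proof -
  assume "f \<in> span_rows A r" "g \<in> span_rows A r"
  then obtain c d where "f = (\<Sum>i\<in>A. Cst (c i) * r i)" "g = (\<Sum>i\<in>A. Cst (d i) * r i)"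
    by (auto simp: span_rows_def)
  then have "f + g = (\<Sum>i\<in>A. Cst (c i + d i) * r i)" by (simp add: single_add distrib_right sum.distrib)
  then show ?thesis unfolding span_rows_def by (intro CollectI exI)
qed

lemma span_rows_0: "0 \<in> span_rows A r"
  unfolding span_rows_def by (auto intro!: exI[of _ "\<lambda>_. 0"])

lemma span_rows_row: "finite A \<Longrightarrow> i \<in> A \<Longrightarrow> Cst c * r i \<in> span_rows A r"
proof -
  assume A: "finite A" "i \<in> A"
  have "(\<Sum>k\<in>A. Cst (if k = i then c else 0) * r k) = (\<Sum>k\<in>A. if k = i then Cst c * r k else 0)"
    by (rule sum.cong) simp_all
  also have "\<dots> = Cst c * r i" using A by simp
  finally have "Cst c * r i = (\<Sum>k\<in>A. Cst (if k = i then c else 0) * r k)" by (rule sym)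
  then show ?thesis unfolding span_rows_def by (intro CollectI exI)
qed

text \<open>The rows of the Macaulay matrix in degree \<open>t\<close>: a generator \<open>x\<close>
  of degree \<open>e x\<close> is multiplied by all monomials that keep the degree at most
  \<open>t\<close>.\<close>

definition row_index :: "nat set \<Rightarrow> nat \<Rightarrow> 'x list \<Rightarrow> ('x \<Rightarrow> nat) \<Rightarrow> ('x \<times> nat multiset) set"
  where "row_index V t xs e = {(x, m) \<in> set xs \<times> mons V t. size m + e x \<le> t}"

lemma finite_row_index: "finite V \<Longrightarrow> finite (row_index V t xs e)"
proof -
  assume "finite V"
  then have "finite (set xs \<times> mons V t)" by simp
  then show ?thesis unfolding row_index_def by (rule rev_finite_subset) auto
qed

text \<open>As the generators are homogeneous in the variables \<open>V\<close>,
  \<open>proj V t\<close> keeps or kills each monomial multiple of a generator as a whole. Hence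
  elements of degree at most \<open>t\<close> are combinations of such multiples of degree at most
  \<open>t\<close>; no cancellation in higher degrees has to be considered.\<close>

lemma HF_gideal_ge_iff:
  fixes g :: "'x \<Rightarrow> 'a::field mpoly"
  assumes V: "finite V" and g: "\<And>x. x \<in> set xs \<Longrightarrow> homog (e x) (g x)" "\<And>x. x \<in> set xs \<Longrightarrow> vars_in V (g x)"
  shows "b \<le> HF (gideal V (map g xs)) t \<longleftrightarrow>
    nullity_ge (row_index V t xs e) (mons V t) (\<lambda>(x, m) n. coef (g x * mon m 1) n) b"
proof -
  let ?A = "row_index V t xs e"
  define r where "r = (\<lambda>(x, m). g x * mon m (1 :: 'a))"
  have hom: "hom_ideal V (gideal V (map g ys))" if "set ys \<subseteq> set xs" for ys
    using that g(1) by (intro hom_ideal_gideal[OF V]) auto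
  have supp_r: "supp (g x * mon m c) \<subseteq> mons V t" if x: "x \<in> set xs" and m: "set_mset m \<subseteq> V" "size m + e x \<le> t" for x m c
  proof
    fix n assume "n \<in> supp (g x * mon m c)"
    then obtain n' where n': "n = n' + m" "n' \<in> supp (g x)" using supp_mult_mon[of "g x" m c] by blast
    have "set_mset n' \<subseteq> V" "size n' = e x" using g[OF x] n'(2) by (auto simp: homog_def vars_in_def)
    then show "n \<in> mons V t" using m n'(1) by (simp add: mons_def)
  qed
  have out: "supp (g x * mon m c) \<inter> mons V t = {}" if x: "x \<in> set xs" and m: "\<not> (set_mset m \<subseteq> V \<and> size m + e x \<le> t)" for x m c
  proof -
    have "n \<notin> mons V t" if n: "n \<in> supp (g x * mon m c)" for n
    proof -
      obtain n' where n': "n = n' + m" "n' \<in> supp (g x)" using n supp_mult_mon[of "g x" m c] by blast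
      have "size n' = e x" using g(1)[OF x] n'(2) by (simp add: homog_def)
      then show ?thesis using m n'(1) by (auto simp: mons_def)
    qed
    then show ?thesis by blast
  qed
  have finA: "finite ?A" by (rule finite_row_index[OF V])
  have proj_mult: "proj V t (g x * b) \<in> span_rows ?A r" if x: "x \<in> set xs" for x b
  proof (induction b rule: mpoly_induct)
    case zero
    have "proj V t (0 :: 'a mpoly) = 0" by (rule proj_eq_0) simp
    then show ?case using span_rows_0 by simp
  next
    case (add m c b)
    have "proj V t (g x * mon m c) \<in> span_rows ?A r"
    proof (cases "set_mset m \<subseteq> V \<and> size m + e x \<le> t")
      case True
      then have "(x, m) \<in> ?A" using x by (simp add: row_index_def mons_def)
      from span_rows_row[OF finA this, of c r] have "Cst c * (g x * mon m 1) \<in> span_rows ?A r" by (simp add: r_def)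
      moreover have "Cst c * (g x * mon m 1) = g x * mon m c" by (simp add: mult.left_commute[of "Cst c"] mult_single)
      moreover have "proj V t (g x * mon m c) = g x * mon m c" using True by (intro proj_eq supp_r[OF x]) simp_all
      ultimately show ?thesis by simp
    next
      case False
      then have "proj V t (g x * mon m c) = 0" by (intro proj_eq_0 out[OF x])
      then show ?thesis using span_rows_0 by simp
    qed
    then show ?case using add by (simp add: distrib_left proj_add span_rows_add)
  qed
  have span: "proj V t f \<in> span_rows ?A r" if "f \<in> gideal V (map g ys)" "set ys \<subseteq> set xs" for f ys
    using that
  proof (induction ys arbitrary: f)
    case Nil
    then have "proj V t f = 0" by (intro poly_mapping_eqI) (simp add: coef_proj outer_def mons_def)
    then show ?case using span_rows_0 by simp
  next
    case (Cons y ys)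
    then obtain a b where f: "f = a + g y * b" "a \<in> gideal V (map g ys)" by (auto simp: adjoin_def)
    then show ?case using Cons by (simp add: proj_add span_rows_add proj_mult)
  qed
  interpret hom_ideal V "gideal V (map g xs)" by (rule hom) simp
  have gen: "g x \<in> gideal V (map g ys)" if "x \<in> set ys" "set ys \<subseteq> set xs" for x ys
    using that
  proof (induction ys)
    case (Cons y ys)
    interpret Y: hom_ideal V "gideal V (map g ys)" using Cons.prems by (intro hom) simp
    show ?case using Cons Y.gen_mem_adjoin[of "g y"] Y.adjoin_superset[of "g y"] by auto
  qed simp
  have "b \<le> HF (gideal V (map g xs)) t \<longleftrightarrow> nullity_ge ?A (mons V t) (\<lambda>i. coef (r i)) b"
  proof (rule HF_ge_iff_nullity_ge[OF finA])
    fix i assume i: "i \<in> ?A"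
    then obtain x m where xm: "i = (x, m)" "x \<in> set xs" "set_mset m \<subseteq> V" "size m + e x \<le> t"
      by (auto simp: row_index_def mons_def)
    show "r i \<in> gideal V (map g xs)" using gen[OF xm(2)] by (simp add: r_def xm(1) mult_mem')
    show "supp (r i) \<subseteq> mons V t" using supp_r[OF xm(2-4)] by (simp add: r_def xm(1))
  next
    fix f assume "f \<in> gideal V (map g xs)" "supp f \<subseteq> mons V t"
    then have "f \<in> span_rows ?A r" using span[of f xs] by (simp add: proj_eq)
    then show "\<exists>c. f = (\<Sum>i\<in>?A. Cst (c i) * r i)" by (simp add: span_rows_def)
  qed
  moreover have "(\<lambda>i. coef (r i)) = (\<lambda>(x, m) n. coef (g x * mon m 1) n)" by (simp add: r_def fun_eq_iff)
  ultimately show ?thesis by simp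
qed

section \<open>The varieties \<open>W\<close> over an algebraically closed field\<close>

text \<open>A monomial without \<open>i\<close> contributes 0 through the factor
  \<open>count m i\<close>, so the truncated \<open>m - {#i#}\<close> does no harm.\<close>

definition pd :: "nat \<Rightarrow> 'a::comm_ring_1 mpoly \<Rightarrow> 'a mpoly"
  where "pd i f = (\<Sum>m\<in>supp f. mon (m - {#i#}) (of_nat (count m i) * coef f m))"

lemma coef_pd: "coef (pd i f) m = of_nat (Suc (count m i)) * coef f (add_mset i m)"
proof -
  have "coef (pd i f) m = (\<Sum>n\<in>supp f. if n = add_mset i m then of_nat (count n i) * coef f n else 0)"
    unfolding pd_def lookup_sum
  proof (rule sum.cong)
    fix n
    show "coef (mon (n - {#i#}) (of_nat (count n i) * coef f n)) m =
      (if n = add_mset i m then of_nat (count n i) * coef f n else 0)"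
    proof (cases "i \<in># n")
      case True
      then have "n - {#i#} = m \<longleftrightarrow> n = add_mset i m" by (metis add_mset_remove_trivial insert_DiffM)
      then show ?thesis by (simp add: lookup_single when_def)
    next
      case False
      then have "count n i = 0" "n \<noteq> add_mset i m" by (auto simp: not_in_iff)
      then show ?thesis by simp
    qed
  qed simp
  then show ?thesis by (auto simp: in_keys_iff)
qed

definition imap :: "int mpoly \<Rightarrow> 'a::comm_ring_1 mpoly"
  where "imap f = (\<Sum>m\<in>supp f. mon m (of_int (coef f m)))"

lemma coef_imap: "coef (imap f :: 'a::comm_ring_1 mpoly) m = of_int (coef f m)"
proof -
  have "coef (imap f :: 'a mpoly) m = (\<Sum>n\<in>supp f. if n = m then of_int (coef f n) else 0)"
    by (simp add: imap_def lookup_sum lookup_single when_def)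
  then show ?thesis by (auto simp: in_keys_iff)
qed

lemma ev_imap: "ev x (imap f) = iev x f"
  by (simp add: imap_def hom_eval_def[of of_int])

lemma homog_imap: "homog d f \<Longrightarrow> homog d (imap f)"
  by (simp add: homog_iff coef_imap)

lemma vars_in_imap: "vars_in V f \<Longrightarrow> vars_in V (imap f)"
  by (auto simp: vars_in_def in_keys_iff coef_imap)

lemma homog_pd: "homog d f \<Longrightarrow> homog (d - 1) (pd i f)"
  by (auto simp: homog_iff coef_pd)

lemma vars_in_pd: "vars_in V f \<Longrightarrow> vars_in V (pd i f)"
  unfolding vars_in_def
proof
  fix m assume f: "\<forall>m\<in>supp f. set_mset m \<subseteq> V" and "m \<in> supp (pd i f)"
  then have "add_mset i m \<in> supp f" by (auto simp: in_keys_iff coef_pd)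
  then have "set_mset (add_mset i m) \<subseteq> V" using f by blast
  then show "set_mset m \<subseteq> V" by simp
qed

lemma hom_eval_cong_vars:
  assumes "vars_in V f" "\<And>i. i \<in> V \<Longrightarrow> x i = y i"
  shows "hom_eval \<phi> x f = hom_eval \<phi> y f"
  unfolding hom_eval_def
proof (rule sum.cong)
  fix m assume "m \<in> supp f"
  then have "set_mset m \<subseteq> V" using assms(1) by (simp add: vars_in_def)
  then have "image_mset x m = image_mset y m" using assms(2) by (intro image_mset_cong) blast
  then show "\<phi> (coef f m) * (\<Prod>i\<in>#m. x i) = \<phi> (coef f m) * (\<Prod>i\<in>#m. y i)" by simp
qed simp

section \<open>The equations of a fibre and its rank conditions\<close>

definition wvar :: "nat \<Rightarrow> int mpoly \<Rightarrow> (nat \<Rightarrow> 'a::comm_ring_1) \<Rightarrow> (nat \<Rightarrow> 'a) set"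
  where "wvar n F h = {y \<in> pts {1..n}. iev y F = 0 \<and>
    (\<forall>i\<in>{1..n}. \<forall>j\<in>{1..n}. h i * iev y (pd j F) = h j * iev y (pd i F))}"

text \<open>\<open>None\<close> stands for \<open>F\<close> itself, \<open>Some (i, j)\<close> for a
  minor of the matrix whose two rows are \<open>h\<close> and the gradient of
  \<open>F\<close>.\<close>

definition gen :: "int mpoly \<Rightarrow> (nat \<Rightarrow> 'a::comm_ring_1) \<Rightarrow> (nat \<times> nat) option \<Rightarrow> 'a mpoly"
  where "gen F h x = (case x of None \<Rightarrow> imap F
    | Some (i, j) \<Rightarrow> Cst (h i) * imap (pd j F) - Cst (h j) * imap (pd i F))"

definition gen_degree :: "nat \<Rightarrow> (nat \<times> nat) option \<Rightarrow> nat"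
  where "gen_degree d x = (case x of None \<Rightarrow> d | Some _ \<Rightarrow> d - 1)"

definition gen_index :: "nat \<Rightarrow> (nat \<times> nat) option list"
  where "gen_index n = None # map Some (List.product [1..<Suc n] [1..<Suc n])"

lemma set_gen_index: "set (gen_index n) = insert None (Some ` ({1..n} \<times> {1..n}))"
proof -
  have "set [1..<Suc n] = {1..n}" by auto
  then show ?thesis unfolding gen_index_def by simp
qed

definition wideal :: "nat \<Rightarrow> int mpoly \<Rightarrow> (nat \<Rightarrow> 'a::comm_ring_1) \<Rightarrow> 'a mpoly set"
  where "wideal n F h = gideal {1..n} (map (gen F h) (gen_index n))"

text \<open>The entry of the Macaulay matrix in row \<open>(x, m)\<close> and column
  \<open>n\<close>, with the coordinates of \<open>h\<close> replaced by variables: an integral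
  polynomial, the same in all characteristics.\<close>

definition gen_entry :: "int mpoly \<Rightarrow> (nat \<times> nat) option \<times> nat multiset \<Rightarrow> nat multiset \<Rightarrow> int mpoly"
  where "gen_entry F xm n = (case xm of (x, m) \<Rightarrow> if m \<subseteq># n then
    (case x of None \<Rightarrow> Cst (coef F (n - m))
      | Some (i, j) \<Rightarrow> Var i * Cst (coef (pd j F) (n - m)) - Var j * Cst (coef (pd i F) (n - m))) else 0)"

text \<open>Their vanishing at \<open>h\<close> says that the Hilbert function of
  \<open>wideal n F h\<close> at \<open>t\<close> is at least that of affine
  \<open>j\<close>-space.\<close>

definition rank_polys :: "nat \<Rightarrow> nat \<Rightarrow> int mpoly \<Rightarrow> nat \<Rightarrow> nat \<Rightarrow> int mpoly set"
  where "rank_polys n d F j t =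
    elim_polys (card (row_index {1..n} t (gen_index n) (gen_degree d)))
      (row_index {1..n} t (gen_index n) (gen_degree d)) (mons {1..n} t) (gen_entry F) ((t + j) choose j)"

context
  fixes n d :: nat and F :: "int mpoly"
  assumes F: "homog d F" "vars_in {1..n} F"
begin

lemma homog_gen: "homog (gen_degree d x) (gen F h x)"
proof -
  have "homog (d - Suc 0) (pd i F)" for i using homog_pd[OF F(1)] by simp
  then show ?thesis using F(1) unfolding gen_def gen_degree_def
    by (auto split: option.split intro!: homog_diff homog_Cst_mult homog_imap)
qed

lemma vars_in_gen: "vars_in {1..n} (gen F h x)"
  using F(2) unfolding gen_def
  by (auto split: option.split intro!: vars_in_diff vars_in_mult vars_in_mon vars_in_imap vars_in_pd)

lemma hom_ideal_wideal: "hom_ideal {1..n} (wideal n F (h :: nat \<Rightarrow> 'a::field))"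
  unfolding wideal_def using homog_gen by (intro hom_ideal_gideal) auto

lemma zeros_wideal: "zeros {1..n} (wideal n F h) = wvar n F (h :: nat \<Rightarrow> 'a::field)"
proof -
  have "zeros {1..n} (wideal n F h) = {x \<in> pts {1..n}. \<forall>g\<in>set (map (gen F h) (gen_index n)). ev x g = 0}"
    unfolding wideal_def using homog_gen by (intro zeros_gideal) auto
  then show ?thesis
    by (auto simp: set_gen_index wvar_def gen_def ev_imap)
qed

lemma iev_gen_entry: "iev h (gen_entry F (x, m) k) = coef (gen F h x * mon m 1) k" for h :: "nat \<Rightarrow> 'a::field"
  unfolding gen_entry_def gen_def coef_mult_mon
  by (auto simp: coef_imap lookup_minus split: option.split)

lemma HF_wideal_ge_iff:
  fixes h :: "nat \<Rightarrow> 'a::field"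
  shows "(t + j) choose j \<le> HF (wideal n F h) t \<longleftrightarrow> (\<forall>P\<in>rank_polys n d F j t. iev h P = 0)"
proof -
  let ?A = "row_index {1..n} t (gen_index n) (gen_degree d)"
  let ?M = "gen_entry F"
  have "(t + j) choose j \<le> HF (wideal n F h) t \<longleftrightarrow>
      nullity_ge ?A (mons {1..n} t) (\<lambda>(x, m) k. coef (gen F h x * mon m 1) k) ((t + j) choose j)"
    unfolding wideal_def using homog_gen vars_in_gen by (intro HF_gideal_ge_iff) auto
  also have "\<dots> \<longleftrightarrow> nullity_ge ?A (mons {1..n} t) (\<lambda>i k. iev h (?M i k)) ((t + j) choose j)"
  proof -
    have "(\<lambda>(x, m) k. coef (gen F h x * mon m 1) k) = (\<lambda>i k. iev h (?M i k))"
      by (auto simp: fun_eq_iff iev_gen_entry)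
    then show ?thesis by simp
  qed
  also have "\<dots> \<longleftrightarrow> (\<forall>P\<in>elim_polys (card ?A) ?A (mons {1..n} t) ?M ((t + j) choose j). iev h P = 0)"
    by (rule nullity_ge_iff_elim_polys) (simp_all add: finite_row_index)
  also have "\<dots> \<longleftrightarrow> (\<forall>P\<in>rank_polys n d F j t. iev h P = 0)"
    unfolding rank_polys_def by simp
  finally show ?thesis .
qed

lemma vars_in_rank_polys: "P \<in> rank_polys n d F j t \<Longrightarrow> vars_in {1..n} P"
  unfolding rank_polys_def
proof (rule vars_in_elim_polys)
  fix i k assume i: "i \<in> row_index {1..n} t (gen_index n) (gen_degree d)"
  obtain x m where xm: "i = (x, m)" by (cases i)
  then have "x \<in> insert None (Some ` ({1..n} \<times> {1..n}))" using i by (simp add: row_index_def set_gen_index)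
  then show "vars_in {1..n} (gen_entry F i k)"
    unfolding xm gen_entry_def by (auto intro!: vars_in_diff vars_in_mult vars_in_mon)
qed

text \<open>The dimension of the fibre is at least \<open>j\<close> iff its Hilbert function never drops below that of
  \<open>j\<close>-dimensional affine space, and this is a condition on ranks of matrices.\<close>

theorem has_chain_wvar_iff:
  fixes h :: "nat \<Rightarrow> 'a::alg_closed_field"
  shows "has_chain {1..n} j (wvar n F h) \<longleftrightarrow> (\<forall>t. \<forall>P\<in>rank_polys n d F j t. iev h P = 0)"
proof -
  interpret hom_ideal "{1..n}" "wideal n F h" by (rule hom_ideal_wideal)
  have "has_chain {1..n} j (wvar n F h) \<longleftrightarrow> (\<forall>t. (t + j) choose j \<le> HF (wideal n F h) t)"
  proof
    assume "has_chain {1..n} j (wvar n F h)"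
    then obtain Y where Y: "irr_chain {1..n} j Y" "Y j \<subseteq> zeros {1..n} (wideal n F h)"
      unfolding has_chain_def zeros_wideal by (elim exE conjE)
    have "wideal n F h \<subseteq> vanish (Y j)" using Y(2) by (auto simp: zeros_def vanish_def)
    from irr_chain_HF_ge[OF finV Y(1) var_ideal_axioms this]
    show "\<forall>t. (t + j) choose j \<le> HF (wideal n F h) t" by simp
  next
    assume ge: "\<forall>t. (t + j) choose j \<le> HF (wideal n F h) t"
    show "has_chain {1..n} j (wvar n F h)"
    proof (rule ccontr)
      assume "\<not> ?thesis"
      then have "\<not> has_chain {1..n} j (zeros {1..n} (wideal n F h))" unfolding zeros_wideal .
      from HF_small_of_no_chain[OF hom_ideal_axioms this]
      obtain t where "HF (wideal n F h) t < (t + j) choose j" by (rule exE)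
      then show False using spec[OF ge, of t] by simp
    qed
  qed
  then show ?thesis by (simp only: HF_wideal_ge_iff)
qed

end

section \<open>The codimension bound\<close>

lemma exponent_le_of_power_bound:
  assumes "\<And>t :: nat. (t + 1) ^ a \<le> K * (t + 1) ^ b" shows "a \<le> b"
proof (rule ccontr)
  assume "\<not> ?thesis"
  then obtain c where c: "a = b + Suc c" by (metis add_Suc_right less_imp_Suc_add not_le)
  \<comment> \<open>The assumed bound is contradictory at \<open>t = K\<close>.\<close>
  have "K + 1 \<le> (K + 1) ^ Suc c" by (rule self_le_power) simp_all
  then have "(K + 1) ^ b * (K + 1) \<le> (K + 1) ^ b * (K + 1) ^ Suc c" by (rule mult_le_mono2)
  also have "\<dots> = (K + 1) ^ a" by (simp only: c power_add)
  also have "\<dots> \<le> (K + 1) ^ b * K" using assms[of K] by (simp add: mult.commute)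
  finally have "K + 1 \<le> K" by (rule iffD1[OF nat_mult_le_cancel1, rotated]) simp
  then show False by simp
qed

lemma card_mons_le: "finite V \<Longrightarrow> card (mons V t) \<le> (t + 1) ^ card V"
proof -
  assume V: "finite V"
  have "mons V t \<subseteq> {m. set_mset m \<subseteq> V \<and> (\<forall>i\<in>V. count m i \<le> t)}"
  proof
    fix m assume "m \<in> mons V t"
    moreover have "count m i \<le> size m" for i by (rule count_le_size)
    ultimately show "m \<in> {m. set_mset m \<subseteq> V \<and> (\<forall>i\<in>V. count m i \<le> t)}"
      by (auto simp: mons_def intro: le_trans)
  qed
  then have "card (mons V t) \<le> card {m. set_mset m \<subseteq> V \<and> (\<forall>i\<in>V. count m i \<le> t)}"
    by (intro card_mono card_bounded_multisets(1)[OF V])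
  also have "\<dots> \<le> (\<Prod>i\<in>V. t + 1)" by (rule card_bounded_multisets(2)[OF V])
  finally show ?thesis by simp
qed

text \<open>A Hilbert function never exceeds the number of all monomials, which is of order
  \<open>t ^ card V\<close>.\<close>

lemma irr_chain_length_le:
  fixes Y :: "nat \<Rightarrow> (nat \<Rightarrow> 'a::field) set"
  assumes V: "finite V" and Y: "irr_chain V k Y"
  shows "k \<le> card V"
proof (rule exponent_le_of_power_bound)
  fix t
  have "irred V (Y k)" using Y by (simp add: irr_chain_def)
  then have vi: "var_ideal V (vanish (Y k))" by (intro var_ideal_vanish V irred_pts)
  have "(t + 1) ^ k \<le> k ^ k * ((t + k) choose k)" by (rule power_le_binomial)
  also have "\<dots> \<le> k ^ k * HF (vanish (Y k)) t" using irr_chain_HF_ge[OF V Y vi] by (intro mult_le_mono2) simp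
  also have "\<dots> \<le> k ^ k * (t + 1) ^ card V"
    using le_trans[OF var_ideal.HF_le_mons[OF vi] card_mons_le[OF V]] by (intro mult_le_mono2)
  finally show "(t + 1) ^ k \<le> k ^ k * (t + 1) ^ card V" .
qed

text \<open>Some coordinate \<open>i\<close> is not identically zero on the top of the chain. If
  \<open>f\<close> vanishes off the origin, then \<open>Var i * f\<close> vanishes on the top, and
  primality removes the factor \<open>Var i\<close>.\<close>

lemma HF_ge_without_origin:
  fixes Y :: "nat \<Rightarrow> (nat \<Rightarrow> 'a::field) set"
  assumes V: "finite V" and Y: "irr_chain V (Suc j) Y" "Y (Suc j) \<subseteq> Z" and Z: "Z \<subseteq> pts V"
  shows "(t + Suc j) choose Suc j \<le> HF (vanish (Z - {\<lambda>i. 0})) t"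
proof -
  have irr: "irred V (Y (Suc j))" using Y(1) by (simp add: irr_chain_def)
  obtain x i where x: "x \<in> Y (Suc j)" "i \<in> V" "x i \<noteq> 0"
    using irr_chain_nonzero_point[OF Y(1)] by (elim bexE)
  have "vanish (Z - {\<lambda>i. 0}) \<subseteq> vanish (Y (Suc j))"
  proof
    fix f assume f: "f \<in> vanish (Z - {\<lambda>i. 0})"
    have "ev y (Var i * f) = 0" if "y \<in> Y (Suc j)" for y
    proof (cases "y = (\<lambda>i. 0)")
      case False
      then have "ev y f = 0" using f that Y(2) unfolding vanish_def by blast
      then show ?thesis by simp
    qed simp
    then have "Var i * f \<in> vanish (Y (Suc j))" by (simp add: vanish_def)
    then have "Var i \<in> vanish (Y (Suc j)) \<or> f \<in> vanish (Y (Suc j))" by (rule irred_vanish_prime[OF irr])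
    moreover have "Var i \<notin> vanish (Y (Suc j))" using x by (auto simp: vanish_def)
    ultimately show "f \<in> vanish (Y (Suc j))" by blast
  qed
  moreover have "var_ideal V (vanish (Z - {\<lambda>i. 0}))" using Z by (intro var_ideal_vanish V) blast
  ultimately show ?thesis by (intro irr_chain_HF_ge[OF V Y(1)])
qed

text \<open>An irreducible set is the union of the finitely many subsets on which a map into a finite set is
  constant, so one of these subsets is dense.\<close>

lemma irred_dense_fibre:
  fixes Y :: "(nat \<Rightarrow> 'a::field) set"
  assumes irr: "irred V Y" and fin: "finite \<B>" and g: "\<And>h. h \<in> Y \<Longrightarrow> g h \<in> \<B>"
  shows "\<exists>B\<in>\<B>. vanish {h \<in> Y. g h = B} \<subseteq> vanish Y"
proof (rule ccontr)
  assume "\<not> ?thesis"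
  then have "\<forall>B\<in>\<B>. \<exists>f. f \<in> vanish {h \<in> Y. g h = B} \<and> f \<notin> vanish Y" by (simp add: subset_iff)
  from bchoice[OF this] obtain f where f: "\<forall>B\<in>\<B>. f B \<in> vanish {h \<in> Y. g h = B} \<and> f B \<notin> vanish Y" by (rule exE)
  have "prod f \<B> \<in> vanish Y"
  proof (rule prod_vanishI[OF fin])
    fix h assume h: "h \<in> Y"
    then have "f (g h) \<in> vanish {h' \<in> Y. g h' = g h}" using f g by simp
    then have "ev h (f (g h)) = 0" using h by (simp add: vanish_def)
    then show "\<exists>B\<in>\<B>. ev h (f B) = 0" using g[OF h] by (rule bexI)
  qed
  from irred_vanish_prime_prod[OF irr fin this] f show False by blast
qed

lemma dle_prod_mset:
  fixes g :: "nat \<Rightarrow> 'a::comm_ring_1 mpoly"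
  assumes "\<And>i. i \<in># u \<Longrightarrow> dle e (g i)" shows "dle (size u * e) (\<Prod>i\<in>#u. g i)"
  using assms
proof (induction u)
  case (add i u)
  then have "dle (e + size u * e) (g i * (\<Prod>i\<in>#u. g i))" by (intro dle_mult) simp_all
  then show ?case by simp
qed simp

text \<open>Off the origin, the incidence variety of the pairs \<open>(h, y)\<close> with \<open>y \<in> W h\<close> is parametrised by
  \<open>(\<lambda>, y) \<mapsto> (\<lambda> \<nabla>F(y), y)\<close> with \<open>F(y) = 0\<close>, so it has dimension at most \<open>n\<close>; the Hilbert functions of its
  base and of its fibres multiply. Here \<open>\<lambda>\<close> is the variable with index \<open>0\<close>.\<close>

theorem fibre_codimension:
  fixes F :: "int mpoly" and Y :: "nat \<Rightarrow> (nat \<Rightarrow> 'a::field) set"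
  assumes F: "homog d F" "vars_in {1..n} F" and nz: "(imap F :: 'a mpoly) \<noteq> 0"
    and smooth: "\<And>y :: nat \<Rightarrow> 'a. y \<in> pts {1..n} \<Longrightarrow> y \<noteq> (\<lambda>i. 0) \<Longrightarrow> iev y F = 0 \<Longrightarrow>
      \<exists>i\<in>{1..n}. iev y (pd i F) \<noteq> 0"
    and Y: "irr_chain {1..n} k Y" and fib: "\<And>h. h \<in> Y k \<Longrightarrow> has_chain {1..n} (Suc j) (wvar n F h)"
  shows "k + Suc j \<le> n"
proof -
  define V where "V = {1..n}"
  define V0 where "V0 = insert 0 V"
  have V: "finite V" "finite V0" "card V0 = Suc n" by (simp_all add: V_def V0_def)
  define Q where "Q = {x \<in> pts V0. iev x F = (0 :: 'a)}"
  have "Q \<subseteq> pts V0" by (auto simp: Q_def)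
  then interpret Q: var_ideal V0 "vanish Q" by (intro var_ideal_vanish V)
  have irr: "irred V (Y k)" using Y by (simp add: irr_chain_def V_def)
  interpret H: var_ideal V "vanish (Y k)" by (intro var_ideal_vanish V irred_pts irr)
  obtain e where e: "e > 0" "\<And>t. (t + k) choose k \<le> HF (vanish (Y k)) (e * t)"
    using irr_chain_HF[OF V(1) Y[folded V_def]] by (elim exE conjE) simp
  \<comment> \<open>The pullback of the coordinate \<open>h i\<close> to the parameter space, a
    polynomial of degree at most \<open>d + 1\<close>.\<close>
  define \<sigma> where "\<sigma> i = Var 0 * (imap (pd i F) :: 'a mpoly)" for i
  have dsigma: "dle (d + 1) (\<sigma> i)" for i
  proof -
    have "dle (1 + (d - 1)) (Var 0 * (imap (pd i F) :: 'a mpoly))"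
      by (intro dle_mult homog_imp_dle[OF homog_imap[OF homog_pd[OF F(1)]]] dle_mon) simp
    then show ?thesis unfolding \<sigma>_def by (rule dle_mono) simp
  qed
  define W where "W h = wvar n F h - {\<lambda>i. (0 :: 'a)}" for h
  have WV: "W h \<subseteq> pts V" for h by (auto simp: W_def wvar_def V_def)
  have WI: "var_ideal V (vanish (W h))" for h by (intro var_ideal_vanish V WV)
  have HW: "(s + Suc j) choose Suc j \<le> HF (vanish (W h)) s" if h: "h \<in> Y k" for h s
  proof -
    obtain Z where "irr_chain V (Suc j) Z" "Z (Suc j) \<subseteq> wvar n F h"
      using fib[OF h] unfolding has_chain_def V_def by (elim exE conjE)
    then show ?thesis unfolding W_def by (intro HF_ge_without_origin[OF V(1)]) (auto simp: wvar_def V_def)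
  qed
  have param: "\<exists>x\<in>Q. (\<forall>i\<in>V. x i = y i) \<and> (\<forall>i\<in>V. h i = x 0 * iev y (pd i F))" if y: "y \<in> W h" for h y
  proof -
    have y': "y \<in> pts {1..n}" "y \<noteq> (\<lambda>i. 0)" "iev y F = 0"
      and par: "\<And>i j. i \<in> V \<Longrightarrow> j \<in> V \<Longrightarrow> h i * iev y (pd j F) = h j * iev y (pd i F)"
      using y by (auto simp: W_def wvar_def V_def)
    obtain i where i: "i \<in> V" "iev y (pd i F) \<noteq> 0" using smooth[OF y'] unfolding V_def by (rule bexE)
    define l where "l = h i / iev y (pd i F)"
    define x where "x = y(0 := l)"
    have x: "x m = y m" if "m \<in> V" for m using that by (auto simp: x_def V_def)
    have "iev x F = iev y F" using F(2) x unfolding V_def by (rule hom_eval_cong_vars)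
    moreover have "x \<in> pts V0" using y'(1) by (auto simp: x_def pts_def V0_def V_def)
    ultimately have "x \<in> Q" using y'(3) by (simp add: Q_def)
    moreover have "h m = x 0 * iev y (pd m F)" if m: "m \<in> V" for m
      using par[OF i(1) m] i(2) by (simp add: x_def l_def nonzero_eq_divide_eq mult.commute)
    ultimately show ?thesis using x by (intro bexI[of _ x] conjI ballI) simp_all
  qed
  \<comment> \<open>For each \<open>h\<close>, \<open>b\<close> standard monomials of the fibre are
    chosen; on a dense subset of \<open>Y k\<close> the choice is the same set \<open>B\<close>. A
    relation on \<open>Q\<close> between products of pulled back standard monomials of
    \<open>Y k\<close> with members of \<open>B\<close> restricts, for \<open>h\<close> in this
    subset, to a relation between members of \<open>B\<close> on the fibre. So its coefficients, as
    polynomials in \<open>h\<close>, vanish there, by density on all of \<open>Y k\<close>, and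
    hence identically.\<close>
  have key: "HF (vanish (Y k)) r * ((s + Suc j) choose Suc j) \<le> HF (vanish Q) (r * (d + 1) + s)" for r s
  proof -
    define b where "b = (s + Suc j) choose Suc j"
    have "\<forall>h\<in>Y k. \<exists>B. B \<subseteq> stdm (vanish (W h)) s \<and> card B = b"
    proof
      fix h assume "h \<in> Y k"
      from HW[OF this, of s] have "b \<le> card (stdm (vanish (W h)) s)" by (simp add: b_def HF_def)
      then obtain B where "B \<subseteq> stdm (vanish (W h)) s" "card B = b" by (rule obtain_subset_with_card_n)
      then show "\<exists>B. B \<subseteq> stdm (vanish (W h)) s \<and> card B = b" by (intro exI conjI)
    qed
    from bchoice[OF this] obtain g
      where g: "\<forall>h\<in>Y k. g h \<subseteq> stdm (vanish (W h)) s \<and> card (g h) = b" by (rule exE)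
    have gP: "g h \<in> Pow (mons V s)" if h: "h \<in> Y k" for h
    proof -
      have "g h \<subseteq> stdm (vanish (W h)) s" using bspec[OF g h] by simp
      then have "g h \<subseteq> mons V s" using var_ideal.stdm_subset[OF WI] by (rule subset_trans)
      then show ?thesis by simp
    qed
    have "finite (Pow (mons V s))" using V(1) by simp
    from irred_dense_fibre[OF irr this gP] obtain B
      where B': "B \<in> Pow (mons V s)" "vanish {h \<in> Y k. g h = B} \<subseteq> vanish (Y k)" by (rule bexE)
    then have B: "B \<subseteq> mons V s" "vanish {h \<in> Y k. g h = B} \<subseteq> vanish (Y k)" by simp_all
    have finB: "finite B" using B(1) finite_mons[OF V(1)] by (rule finite_subset)
    have "card B = b"
    proof -
      have "1 \<notin> vanish (Y k)" using irr by (auto simp: irred_def vanish_def)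
      then have "1 \<notin> vanish {h \<in> Y k. g h = B}" using B(2) by blast
      then have "{h \<in> Y k. g h = B} \<noteq> {}" by (auto simp: vanish_def)
      then obtain h where h: "h \<in> Y k" "g h = B" by blast
      show ?thesis using bspec[OF g h(1)] h(2) by simp
    qed
    define A where "A = stdm (vanish (Y k)) r \<times> B"
    define f where "f = (\<lambda>(u, m). (\<Prod>i\<in>#u. \<sigma> i) * mon m (1 :: 'a))"
    have "card A \<le> HF (vanish Q) (r * (d + 1) + s)"
    proof (rule Q.indep_card_le)
      show "finite A" using finB by (simp add: A_def)
      fix a assume a: "a \<in> A"
      obtain u m where um: "a = (u, m)" by (cases a)
      have sz: "size u \<le> r" "size m \<le> s" using a B(1) by (auto simp: um A_def stdm_def mons_def)
      have "dle (size u * (d + 1) + size m) ((\<Prod>i\<in>#u. \<sigma> i) * mon m 1)"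
        by (intro dle_mult dle_prod_mset dsigma dle_mon) simp
      then show "dle (r * (d + 1) + s) (f a)"
        unfolding f_def um prod.case by (rule dle_mono) (intro add_mono mult_le_mono1 sz)
    next
      fix c a assume sum: "(\<Sum>a\<in>A. Cst (c a) * f a) \<in> vanish Q" and a: "a \<in> A"
      define p where "p m = (\<Sum>u\<in>stdm (vanish (Y k)) r. mon u (c (u, m)))" for m
      have "ev h (p m) = 0" if h: "h \<in> Y k" "g h = B" and m: "m \<in> B" for h m
      proof -
        define q where "q = (\<Sum>m\<in>B. mon m (ev h (p m)))"
        have "ev y q = 0" if y: "y \<in> W h" for y
        proof -
          obtain x where x: "x \<in> Q" "\<forall>i\<in>V. x i = y i" "\<forall>i\<in>V. h i = x 0 * iev y (pd i F)"
            using param[OF y] by (elim bexE conjE)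
          have pdx: "iev x (pd i F) = iev y (pd i F)" for i
            using vars_in_pd[OF F(2)] x(2) unfolding V_def by (intro hom_eval_cong_vars) auto
          have fx: "ev x (f (u, m)) = (\<Prod>i\<in>#u. h i) * (\<Prod>i\<in>#m. y i)"
            if u: "u \<in> stdm (vanish (Y k)) r" and m: "m \<in> B" for u m
          proof -
            have uV: "set_mset u \<subseteq> V" using u H.stdm_subset[of r] by (auto simp: mons_def)
            have mV: "set_mset m \<subseteq> V" using m B(1) by (auto simp: mons_def)
            have "image_mset (\<lambda>i. ev x (\<sigma> i)) u = image_mset h u"
            proof (rule image_mset_cong)
              fix i assume "i \<in># u"
              then have "i \<in> V" using uV by blast
              then show "ev x (\<sigma> i) = h i" using x(3) by (simp add: \<sigma>_def ev_imap pdx)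
            qed
            moreover have "image_mset x m = image_mset y m" using x(2) mV by (intro image_mset_cong) blast
            ultimately show ?thesis by (simp add: f_def multiset.map_comp o_def)
          qed
          have "ev x (\<Sum>a\<in>A. Cst (c a) * f a) = 0" using sum x(1) unfolding vanish_def by blast
          then have "0 = (\<Sum>a\<in>A. c a * ev x (f a))" by simp
          also have "\<dots> = (\<Sum>u\<in>stdm (vanish (Y k)) r. \<Sum>m\<in>B. c (u, m) * ev x (f (u, m)))"
            unfolding A_def by (simp add: sum.cartesian_product)
          also have "\<dots> = (\<Sum>u\<in>stdm (vanish (Y k)) r. \<Sum>m\<in>B. c (u, m) * ((\<Prod>i\<in>#u. h i) * (\<Prod>i\<in>#m. y i)))"
            using fx by (intro sum.cong) simp_all
          also have "\<dots> = (\<Sum>m\<in>B. \<Sum>u\<in>stdm (vanish (Y k)) r. c (u, m) * ((\<Prod>i\<in>#u. h i) * (\<Prod>i\<in>#m. y i)))"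
            by (rule sum.swap)
          also have "\<dots> = ev y q"
            by (simp add: q_def p_def sum_distrib_right mult.assoc)
          finally show ?thesis by simp
        qed
        then have qI: "q \<in> vanish (W h)" by (simp add: vanish_def)
        have BS: "B \<subseteq> stdm (vanish (W h)) s" using bspec[OF g h(1)] h(2) by simp
        have "supp q \<subseteq> B" using supp_sum[of "\<lambda>m. mon m (ev h (p m))" B] unfolding q_def by (auto split: if_splits)
        then have "supp q \<inter> LM (vanish (W h)) = {}" using BS by (auto simp: stdm_def)
        then have "q = 0" by (rule var_ideal.std_indep[OF WI qI])
        then have "coef q m = 0" by simp
        then show ?thesis using m finB by (simp add: q_def lookup_sum lookup_single when_def)
      qed
      then have "p m \<in> vanish {h \<in> Y k. g h = B}" if "m \<in> B" for m using that by (simp add: vanish_def)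
      then have pI: "p m \<in> vanish (Y k)" if "m \<in> B" for m using that B(2) by blast
      obtain u m where um: "a = (u, m)" "u \<in> stdm (vanish (Y k)) r" "m \<in> B" using a by (auto simp: A_def)
      from pI[OF um(3)] have "(\<Sum>u\<in>stdm (vanish (Y k)) r. mon u (c (u, m))) \<in> vanish (Y k)" unfolding p_def .
      from H.std_sum_indep[OF this um(2)] show "c a = 0" unfolding um(1) .
    qed
    then show ?thesis unfolding A_def card_cartesian_product \<open>card B = b\<close> HF_def b_def .
  qed
  \<comment> \<open>The leading monomial of \<open>F\<close>, of degree \<open>d\<close>, is not
    standard. So the dichotomy applies with \<open>j = n + 1\<close> and gives growth of order
    \<open>n\<close>, one less than the number of variables.\<close>
  have "HF (vanish Q) d < (d + Suc n) choose Suc n"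
  proof -
    obtain m where m: "is_lm (imap F :: 'a mpoly) m" using ex_is_lm[OF nz] by (rule exE)
    have "imap F \<in> vanish Q" by (simp add: vanish_def Q_def ev_imap)
    then have mLM: "m \<in> LM (vanish Q)" using m unfolding LM_def by blast
    have ms: "m \<in> supp (imap F :: 'a mpoly)" using m by (simp add: is_lm_def)
    then have "size m = d" using homog_imap[OF F(1)] unfolding homog_def by blast
    moreover have "set_mset m \<subseteq> {1..n}" using vars_in_imap[OF F(2)] ms unfolding vars_in_def by blast
    ultimately have "m \<in> mons V0 d" by (auto simp: mons_def V0_def V_def)
    moreover have "m \<notin> stdm (vanish Q) d" using mLM by (simp add: stdm_def)
    ultimately have "stdm (vanish Q) d \<subset> mons V0 d" using Q.stdm_subset[of d] by blast
    from psubset_card_mono[OF finite_mons[OF V(2)] this] show ?thesis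
      by (simp only: HF_def card_mons[OF V(2)] V(3))
  qed
  note growth = Q.HF_growth[OF this]
  define K where "K = 2 ^ card V0 * (d + 1) ^ card V0"
  have K: "HF (vanish Q) s * (s + 1) \<le> K * (s + 1) ^ Suc n" for s unfolding K_def by (rule growth)
  have KQ: "HF (vanish Q) s \<le> K * (s + 1) ^ n" for s
  proof -
    have "(s + 1) * HF (vanish Q) s \<le> (s + 1) * (K * (s + 1) ^ n)" using K[of s] by (simp add: mult_ac)
    then show ?thesis by (rule iffD1[OF nat_mult_le_cancel1, rotated]) simp
  qed
  \<comment> \<open>For \<open>r = e * t\<close> and \<open>s = t\<close> the degree that occurs in
    \<open>key\<close> is \<open>L * t\<close>.\<close>
  define L where "L = e * (d + 1) + 1"
  show ?thesis
  proof (rule exponent_le_of_power_bound)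
    fix t :: nat
    have "(t + 1) ^ (k + Suc j) = (t + 1) ^ k * (t + 1) ^ Suc j" by (rule power_add)
    also have "\<dots> \<le> (k ^ k * ((t + k) choose k)) * (Suc j ^ Suc j * ((t + Suc j) choose Suc j))"
      by (intro mult_le_mono power_le_binomial)
    also have "\<dots> = (k ^ k * Suc j ^ Suc j) * (((t + k) choose k) * ((t + Suc j) choose Suc j))"
      by (simp only: mult_ac)
    also have "\<dots> \<le> (k ^ k * Suc j ^ Suc j) * (HF (vanish (Y k)) (e * t) * ((t + Suc j) choose Suc j))"
      using e(2)[of t] by (intro mult_le_mono2 mult_le_mono1)
    also have "\<dots> \<le> (k ^ k * Suc j ^ Suc j) * HF (vanish Q) (e * t * (d + 1) + t)"
      by (intro mult_le_mono2 key)
    also have "e * t * (d + 1) + t = L * t" by (simp add: L_def algebra_simps)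
    also have "(k ^ k * Suc j ^ Suc j) * HF (vanish Q) (L * t) \<le> (k ^ k * Suc j ^ Suc j) * (K * (L * t + 1) ^ n)"
      by (intro mult_le_mono2 KQ)
    also have "\<dots> \<le> (k ^ k * Suc j ^ Suc j) * (K * (L * (t + 1)) ^ n)"
      by (intro mult_le_mono2 power_mono) (simp_all add: L_def)
    also have "\<dots> = (k ^ k * Suc j ^ Suc j * K * L ^ n) * (t + 1) ^ n" by (simp only: power_mult_distrib mult_ac)
    finally show "(t + 1) ^ (k + Suc j) \<le> (k ^ k * Suc j ^ Suc j * K * L ^ n) * (t + 1) ^ n" .
  qed
qed

section \<open>Rational points and Hilbert functions\<close>

text \<open>On a finite grid every function is a polynomial of bounded degree, so the number of grid points of
  a variety is at most the dimension of the space of polynomial functions of that degree on it.\<close>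

lemma (in var_ideal) card_grid_points_le_HF:
  assumes S: "finite S" and Z: "finite Z" "Z \<subseteq> zeros V I" "\<And>x i. x \<in> Z \<Longrightarrow> i \<in> V \<Longrightarrow> x i \<in> S"
  shows "card Z \<le> HF I (card V * card S)"
proof (rule ccontr)
  define t where "t = card V * card S"
  assume "\<not> ?thesis"
  then have less: "card (stdm I t) < card Z" by (simp add: HF_def t_def)
  \<comment> \<open>With more points than standard monomials there are nontrivial weights on the
    points under which every polynomial of degree at most \<open>t\<close> sums to zero.\<close>
  obtain c where c: "\<exists>x\<in>Z. c x \<noteq> 0" "\<forall>m\<in>stdm I t. (\<Sum>x\<in>Z. c x * (\<Prod>i\<in>#m. x i)) = 0"
    using underdetermined_system[OF Z(1) finite_stdm less, of "\<lambda>x m. \<Prod>i\<in>#m. x i"] by (elim exE conjE)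
  have zero: "(\<Sum>x\<in>Z. c x * ev x f) = 0" if f: "dle t f" for f
  proof -
    obtain d where d: "f - (\<Sum>m\<in>stdm I t. mon m (d m)) \<in> I" using normal_form_dle[OF f] by (rule exE)
    have evf: "ev x f = (\<Sum>m\<in>stdm I t. d m * (\<Prod>i\<in>#m. x i))" if x: "x \<in> Z" for x
    proof -
      have "x \<in> zeros V I" using Z(2) x by (rule subsetD)
      then have "ev x (f - (\<Sum>m\<in>stdm I t. mon m (d m))) = 0" using d unfolding zeros_def by blast
      then show ?thesis by simp
    qed
    have "(\<Sum>x\<in>Z. c x * ev x f) = (\<Sum>x\<in>Z. \<Sum>m\<in>stdm I t. d m * (c x * (\<Prod>i\<in>#m. x i)))"
      by (rule sum.cong) (simp_all add: evf sum_distrib_left mult.left_commute)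
    also have "\<dots> = (\<Sum>m\<in>stdm I t. d m * (\<Sum>x\<in>Z. c x * (\<Prod>i\<in>#m. x i)))"
      by (subst sum.swap) (simp add: sum_distrib_left)
    also have "\<dots> = 0" using c(2) by (intro sum.neutral) simp
    finally show ?thesis .
  qed
  obtain y where y: "y \<in> Z" "c y \<noteq> 0" using c(1) by (rule bexE)
  \<comment> \<open>The Lagrange polynomial that singles out \<open>y\<close> in the grid; its
    degree accounts for \<open>card V * card S\<close>.\<close>
  define f where "f = (\<Prod>i\<in>V. \<Prod>b\<in>S - {y i}. Var i - Cst b)"
  have "dle (\<Sum>i\<in>V. \<Sum>b\<in>S - {y i}. 1) f"
    unfolding f_def by (intro dle_prod dle_diff dle_mon) simp_all
  moreover have "(\<Sum>i\<in>V. \<Sum>b\<in>S - {y i}. 1) \<le> t"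
  proof -
    have "(\<Sum>i\<in>V. \<Sum>b\<in>S - {y i}. 1) \<le> (\<Sum>i\<in>V. card S)"
      using S by (intro sum_mono) (simp add: card_mono)
    then show ?thesis by (simp add: t_def)
  qed
  ultimately have dle: "dle t f" by (rule dle_mono)
  have evf: "ev x f = (\<Prod>i\<in>V. \<Prod>b\<in>S - {y i}. x i - b)" for x by (simp add: f_def)
  have other: "ev x f = 0" if x: "x \<in> Z" "x \<noteq> y" for x
  proof -
    have xy: "x \<in> pts V" "y \<in> pts V" using Z(2) x(1) y(1) by (auto simp: zeros_def)
    have "\<exists>i\<in>V. x i \<noteq> y i"
    proof (rule ccontr)
      assume "\<not> ?thesis"
      then have "x i = y i" for i using xy by (cases "i \<in> V") (auto simp: pts_def)
      then show False using x(2) by blast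
    qed
    then obtain i where i: "i \<in> V" "x i \<noteq> y i" by (rule bexE)
    have "x i \<in> S - {y i}" using Z(3)[OF x(1) i(1)] i(2) by simp
    then have "(\<Prod>b\<in>S - {y i}. x i - b) = 0" using S by (intro prod_zero) auto
    then show ?thesis unfolding evf using finV i(1) by (intro prod_zero) auto
  qed
  have "ev y f \<noteq> 0" unfolding evf using S finV by (simp add: prod_zero_iff)
  moreover have "(\<Sum>x\<in>Z. c x * ev x f) = c y * ev y f"
    using other by (subst sum.remove[OF Z(1) y(1)]) (simp add: sum.neutral)
  ultimately show False using zero[OF dle] y(2) by simp
qed

section \<open>The exponential sum modulo \<open>p\<^sup>2\<close>\<close>

definition chr :: "nat \<Rightarrow> int \<Rightarrow> complex"
  where "chr q z = exp (2 * of_real pi * \<i> * (of_int z / of_nat q))"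

lemma chr_add: "chr q (x + y) = chr q x * chr q y"
  by (simp add: chr_def add_divide_distrib distrib_left exp_add)

lemma norm_chr [simp]: "norm (chr q z) = 1"
proof -
  have "chr q z = cis (2 * pi * (of_int z / of_nat q))"
    by (simp add: chr_def cis_conv_exp mult_ac)
  then show ?thesis by simp
qed

lemma chr_eq_1_iff: "q > 0 \<Longrightarrow> chr q z = 1 \<longleftrightarrow> int q dvd z"
proof -
  assume q: "q > 0"
  have "chr q z = 1 \<longleftrightarrow> (\<exists>k::int. 2 * pi * (of_int z / of_nat q) = of_int (2 * k) * pi)"
    unfolding chr_def exp_eq_1 by (simp add: mult_ac)
  also have "\<dots> \<longleftrightarrow> (\<exists>k::int. of_int z = (of_int (k * int q) :: real))"
    using q by (intro ex_cong1) (auto simp: field_simps)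
  also have "\<dots> \<longleftrightarrow> int q dvd z" by (metis dvd_triv_right dvdE mult.commute of_int_eq_iff)
  finally show ?thesis .
qed

lemma chr_cong:
  assumes "q > 0" "int q dvd x - y" shows "chr q x = chr q y"
proof -
  have "chr q x = chr q (x - y) * chr q y" by (simp flip: chr_add)
  then show ?thesis using assms chr_eq_1_iff by simp
qed

lemma chr_scale: "p > 0 \<Longrightarrow> chr (p * p) (int p * z) = chr p z"
  by (simp add: chr_def)

text \<open>First order Taylor expansion at \<open>a\<close> in direction \<open>p * b\<close>. The
  sum is the derivative of the monomial, which changes by the product rule when a factor is
  added.\<close>

lemma taylor_monomial:
  fixes a b :: "nat \<Rightarrow> int"
  assumes V: "finite V" and m: "set_mset m \<subseteq> V"
  shows "p\<^sup>2 dvd (\<Prod>i\<in>#m. a i + p * b i) - (\<Prod>i\<in>#m. a i)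
    - p * (\<Sum>i\<in>V. b i * (of_nat (count m i) * (\<Prod>k\<in>#m - {#i#}. a k)))"
  using m
proof (induction m)
  case (add j m)
  define D where "D m = (\<Sum>i\<in>V. b i * (of_nat (count m i) * (\<Prod>k\<in>#m - {#i#}. a k)))" for m
  have j: "j \<in> V" using add.prems by simp
  have tm: "b i * (of_nat (count (add_mset j m) i) * (\<Prod>k\<in>#add_mset j m - {#i#}. a k))
      = a j * (b i * (of_nat (count m i) * (\<Prod>k\<in>#m - {#i#}. a k))) + (if i = j then b j * (\<Prod>k\<in>#m. a k) else 0)" for i
  proof (cases "i = j")
    case True
    have "of_nat (count m j) * (\<Prod>k\<in>#m. a k) = a j * (of_nat (count m j) * (\<Prod>k\<in>#m - {#j#}. a k))"
    proof (cases "j \<in># m")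
      case True
      then obtain m' where "m = add_mset j m'" by (metis mset_add)
      then show ?thesis by simp
    next
      case False
      then show ?thesis by (simp add: not_in_iff)
    qed
    then show ?thesis using True by (simp add: algebra_simps)
  next
    case False
    show ?thesis
    proof (cases "i \<in># m")
      case True
      then have "add_mset j m - {#i#} = add_mset j (m - {#i#})" using False by simp
      then show ?thesis using False by simp
    next
      case not: False
      then show ?thesis using False by (simp add: not_in_iff)
    qed
  qed
  have D: "D (add_mset j m) = a j * D m + b j * (\<Prod>k\<in>#m. a k)"
    unfolding D_def tm using V j by (simp add: sum.distrib sum_distrib_left)
  obtain k where k: "(\<Prod>i\<in>#m. a i + p * b i) - (\<Prod>i\<in>#m. a i) - p * D m = p\<^sup>2 * k"
    using add by (auto simp: D_def elim: dvdE)
  then have eq: "(\<Prod>i\<in>#m. a i + p * b i) = (\<Prod>i\<in>#m. a i) + p * D m + p\<^sup>2 * k" by simp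
  have "(\<Prod>i\<in>#add_mset j m. a i + p * b i) - (\<Prod>i\<in>#add_mset j m. a i) - p * D (add_mset j m)
      = p\<^sup>2 * (b j * D m + (a j + p * b j) * k)"
    unfolding D by (simp add: eq algebra_simps power2_eq_square)
  then show ?case unfolding D_def by simp
qed simp

lemma taylor_mod_square:
  fixes a b :: "nat \<Rightarrow> int"
  assumes V: "finite V" and F: "vars_in V F"
  shows "p\<^sup>2 dvd iev (\<lambda>i. a i + p * b i) F - iev a F - p * (\<Sum>i\<in>V. b i * iev a (pd i F))"
proof -
  have pd: "iev a (pd i F) = (\<Sum>m\<in>supp F. coef F m * (of_nat (count m i) * (\<Prod>k\<in>#m - {#i#}. a k)))" for i
    by (simp add: pd_def mult_ac)
  have "(\<Sum>i\<in>V. b i * iev a (pd i F))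
      = (\<Sum>m\<in>supp F. coef F m * (\<Sum>i\<in>V. b i * (of_nat (count m i) * (\<Prod>k\<in>#m - {#i#}. a k))))"
    unfolding pd sum_distrib_left by (subst sum.swap) (simp add: mult.left_commute)
  then have "iev (\<lambda>i. a i + p * b i) F - iev a F - p * (\<Sum>i\<in>V. b i * iev a (pd i F))
      = (\<Sum>m\<in>supp F. coef F m * ((\<Prod>i\<in>#m. a i + p * b i) - (\<Prod>i\<in>#m. a i)
          - p * (\<Sum>i\<in>V. b i * (of_nat (count m i) * (\<Prod>k\<in>#m - {#i#}. a k)))))"
    by (simp only: hom_eval_def of_int_eq_id id_apply right_diff_distrib sum_subtractf
        sum_distrib_left[of p] mult.left_commute[of p])
  also have "p\<^sup>2 dvd \<dots>"
    using F by (intro dvd_sum dvd_mult taylor_monomial[OF V]) (simp add: vars_in_def)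
  finally show ?thesis .
qed

definition grid :: "nat set \<Rightarrow> nat \<Rightarrow> (nat \<Rightarrow> int) set"
  where "grid V p = V \<rightarrow>\<^sub>E {0..<int p}"

lemma finite_grid [simp]: "finite V \<Longrightarrow> finite (grid V p)"
  unfolding grid_def by (intro finite_PiE) auto

lemma card_grid: "finite V \<Longrightarrow> card (grid V p) = p ^ card V"
  unfolding grid_def by (simp add: card_PiE)

text \<open>Translating by \<open>v\<close> multiplies the sum by a nontrivial root of unity.\<close>

lemma character_sum_eq_0:
  fixes h v :: "nat \<Rightarrow> int"
  assumes V: "finite V" and p: "p > 0"
    and inv: "\<And>b b'. \<Phi> b \<Longrightarrow> (\<And>i. i \<in> V \<Longrightarrow> int p dvd b' i - (b i + v i)) \<Longrightarrow> \<Phi> b'"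
    and inv': "\<And>b b'. \<Phi> b \<Longrightarrow> (\<And>i. i \<in> V \<Longrightarrow> int p dvd b' i - (b i - v i)) \<Longrightarrow> \<Phi> b'"
    and hv: "\<not> int p dvd (\<Sum>i\<in>V. h i * v i)"
  shows "(\<Sum>b\<in>{b \<in> grid V p. \<Phi> b}. chr p (\<Sum>i\<in>V. h i * b i)) = 0"
proof -
  \<comment> \<open>Translation by \<open>w\<close>, brought back to representatives in the
    grid.\<close>
  define \<tau> where "\<tau> w b = (\<lambda>i\<in>V. (b i + w i) mod int p)" for w b :: "nat \<Rightarrow> int"
  have tau_grid: "\<tau> w b \<in> grid V p" for w b using p by (auto simp: \<tau>_def grid_def)
  have tau_dvd: "int p dvd \<tau> w b i - (b i + w i)" if "i \<in> V" for w b i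
    using that by (simp add: \<tau>_def mod_eq_dvd_iff[symmetric])
  have tau_inv: "\<tau> w (\<tau> w' b) = b" if b: "b \<in> grid V p" and w: "\<And>i. w i = - w' i" for b w w'
  proof
    fix i show "\<tau> w (\<tau> w' b) i = b i"
    proof (cases "i \<in> V")
      case True
      then have "b i \<in> {0..<int p}" using b by (auto simp: grid_def)
      then show ?thesis using True by (simp add: \<tau>_def w mod_diff_left_eq mod_pos_pos_trivial)
    next
      case False
      then have "b i = undefined" using b unfolding grid_def by (blast intro: PiE_arb)
      then show ?thesis using False by (simp add: \<tau>_def)
    qed
  qed
  let ?C = "{b \<in> grid V p. \<Phi> b}"
  let ?e = "\<lambda>b. chr p (\<Sum>i\<in>V. h i * b i)"
  have shift: "?e (\<tau> v b) = ?e b * chr p (\<Sum>i\<in>V. h i * v i)" for b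
  proof -
    have "int p dvd (\<Sum>i\<in>V. h i * (\<tau> v b i - (b i + v i)))" using tau_dvd by (intro dvd_sum dvd_mult)
    then have "int p dvd (\<Sum>i\<in>V. h i * \<tau> v b i) - ((\<Sum>i\<in>V. h i * b i) + (\<Sum>i\<in>V. h i * v i))"
      by (simp only: right_diff_distrib distrib_left sum_subtractf sum.distrib)
    from chr_cong[OF p this] show ?thesis by (simp only: chr_add)
  qed
  have "(\<Sum>b\<in>?C. ?e b) = (\<Sum>b\<in>?C. ?e (\<tau> v b))"
  proof (rule sum.reindex_bij_witness[where i = "\<tau> v" and j = "\<tau> (\<lambda>i. - v i)"])
    fix b assume b: "b \<in> ?C"
    show "\<tau> v (\<tau> (\<lambda>i. - v i) b) = b" using b by (intro tau_inv) simp_all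
    show "\<tau> (\<lambda>i. - v i) (\<tau> v b) = b" using b by (intro tau_inv) simp_all
    have "\<Phi> b" using b by simp
    have "\<Phi> (\<tau> (\<lambda>i. - v i) b)"
      by (rule inv'[OF \<open>\<Phi> b\<close>]) (use tau_dvd[of _ "\<lambda>i. - v i" b] in simp)
    then show "\<tau> (\<lambda>i. - v i) b \<in> ?C" using tau_grid by simp
    have "\<Phi> (\<tau> v b)" by (rule inv[OF \<open>\<Phi> b\<close>]) (rule tau_dvd)
    then show "\<tau> v b \<in> ?C" using tau_grid by simp
    show "?e (\<tau> v (\<tau> (\<lambda>i. - v i) b)) = ?e b"
      using b by (subst tau_inv) simp_all
  qed
  also have "\<dots> = (\<Sum>b\<in>?C. ?e b) * chr p (\<Sum>i\<in>V. h i * v i)"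
    by (simp add: shift sum_distrib_right)
  finally have "(\<Sum>b\<in>?C. ?e b) * (chr p (\<Sum>i\<in>V. h i * v i) - 1) = 0" by (simp add: right_diff_distrib)
  moreover have "chr p (\<Sum>i\<in>V. h i * v i) \<noteq> 1" using hv chr_eq_1_iff[OF p] by simp
  ultimately show ?thesis by simp
qed

text \<open>Forgetting the coordinate \<open>k\<close> is injective: two solutions that agree
  elsewhere are congruent at \<open>k\<close>, since \<open>g k\<close> is invertible modulo
  \<open>p\<close>.\<close>

lemma card_hyperplane_le:
  fixes g :: "nat \<Rightarrow> int"
  assumes V: "finite V" and p: "prime p" and k: "k \<in> V" "\<not> int p dvd g k"
  shows "card {b \<in> grid V p. int p dvd c + (\<Sum>i\<in>V. b i * g i)} \<le> p ^ (card V - 1)"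
proof -
  let ?C = "{b \<in> grid V p. int p dvd c + (\<Sum>i\<in>V. b i * g i)}"
  let ?r = "\<lambda>b. restrict b (V - {k})"
  have "inj_on ?r ?C"
  proof (rule inj_onI)
    fix b b' assume b: "b \<in> ?C" "b' \<in> ?C" "?r b = ?r b'"
    have same: "b i = b' i" if "i \<in> V" "i \<noteq> k" for i using fun_cong[OF b(3), of i] that by simp
    have "int p dvd (c + (\<Sum>i\<in>V. b i * g i)) - (c + (\<Sum>i\<in>V. b' i * g i))" using b by (intro dvd_diff) simp_all
    also have "(c + (\<Sum>i\<in>V. b i * g i)) - (c + (\<Sum>i\<in>V. b' i * g i)) = (\<Sum>i\<in>V. (b i - b' i) * g i)"
      by (simp add: left_diff_distrib sum_subtractf)
    also have "\<dots> = (b k - b' k) * g k"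
      using same by (subst sum.remove[OF V k(1)]) (simp add: sum.neutral)
    finally have "int p dvd b k - b' k" using k(2) p by (simp add: prime_dvd_mult_iff)
    moreover have "b k \<in> {0..<int p}" "b' k \<in> {0..<int p}" using b k(1) by (auto simp: grid_def)
    ultimately have "b k = b' k" by (simp add: mod_eq_dvd_iff[symmetric] mod_pos_pos_trivial)
    then show "b = b'" using same b by (intro ext) (metis (no_types, lifting) PiE_arb grid_def mem_Collect_eq)
  qed
  moreover have "?r ` ?C \<subseteq> grid (V - {k}) p"
    unfolding grid_def image_subset_iff restrict_PiE_iff by (blast dest: PiE_mem)
  moreover have "finite (grid (V - {k}) p)" using V by simp
  ultimately have "card ?C \<le> card (grid (V - {k}) p)" by (rule card_inj_on_le)
  then show ?thesis using V k(1) by (simp add: card_grid)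
qed

section \<open>Lifting solutions from \<open>p\<close> to \<open>p * p\<close>\<close>

definition sols :: "nat set \<Rightarrow> nat \<Rightarrow> int mpoly \<Rightarrow> (nat \<Rightarrow> int) set"
  where "sols V q F = {x \<in> grid V q. int q dvd iev x F}"

definition psum :: "nat set \<Rightarrow> nat \<Rightarrow> int mpoly \<Rightarrow> (nat \<Rightarrow> int) \<Rightarrow> complex"
  where "psum V q F h = (\<Sum>x\<in>sols V q F. chr q (\<Sum>i\<in>V. h i * x i))"

definition fibre_sum :: "nat set \<Rightarrow> nat \<Rightarrow> int mpoly \<Rightarrow> (nat \<Rightarrow> int) \<Rightarrow> (nat \<Rightarrow> int) \<Rightarrow> complex"
  where "fibre_sum V p F h a =
    (\<Sum>b\<in>{b \<in> grid V p. int (p * p) dvd iev (\<lambda>i. a i + int p * b i) F}. chr p (\<Sum>i\<in>V. h i * b i))"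

lemma dvd_iev_lift_iff:
  fixes a b :: "nat \<Rightarrow> int"
  assumes "finite V" "vars_in V F"
  shows "int p dvd iev (\<lambda>i. a i + int p * b i) F \<longleftrightarrow> int p dvd iev a F"
proof -
  have "int p dvd (int p)\<^sup>2" by (simp add: power2_eq_square)
  from dvd_trans[OF this taylor_mod_square[OF assms, of "int p" a b]]
  have "int p dvd iev (\<lambda>i. a i + int p * b i) F - iev a F - int p * (\<Sum>i\<in>V. b i * iev a (pd i F))" .
  from dvd_add[OF this, of "int p * (\<Sum>i\<in>V. b i * iev a (pd i F))"]
  have "int p dvd iev (\<lambda>i. a i + int p * b i) F - iev a F" by simp
  then have "iev (\<lambda>i. a i + int p * b i) F mod int p = iev a F mod int p" by (simp only: mod_eq_dvd_iff)
  then show ?thesis by (simp only: dvd_eq_mod_eq_0)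
qed

text \<open>Hensel lifting to first order: above a solution modulo \<open>p\<close>, the condition
  modulo \<open>p * p\<close> is affine linear in \<open>b\<close>, with the gradient at
  \<open>a\<close> as coefficients.\<close>

lemma dvd_square_iev_lift_iff:
  fixes a b :: "nat \<Rightarrow> int"
  assumes V: "finite V" "vars_in V F" and p: "p > 0" and c: "iev a F = int p * c"
  shows "int (p * p) dvd iev (\<lambda>i. a i + int p * b i) F \<longleftrightarrow> int p dvd c + (\<Sum>i\<in>V. b i * iev a (pd i F))"
proof -
  have "int p * int p dvd iev (\<lambda>i. a i + int p * b i) F - int p * (c + (\<Sum>i\<in>V. b i * iev a (pd i F)))"
    using taylor_mod_square[OF V, of "int p" a b] unfolding c by (simp only: power2_eq_square distrib_left diff_diff_eq)
  then have "iev (\<lambda>i. a i + int p * b i) F mod (int p * int p)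
      = int p * (c + (\<Sum>i\<in>V. b i * iev a (pd i F))) mod (int p * int p)" by (simp only: mod_eq_dvd_iff)
  then have "int p * int p dvd iev (\<lambda>i. a i + int p * b i) F \<longleftrightarrow>
      int p * int p dvd int p * (c + (\<Sum>i\<in>V. b i * iev a (pd i F)))" by (simp only: dvd_eq_mod_eq_0)
  then show ?thesis using p by simp
qed

lemma psum_square_decompose:
  fixes h :: "nat \<Rightarrow> int"
  assumes V: "finite V" "vars_in V F" and p: "p > 0"
  shows "psum V (p * p) F h = (\<Sum>a\<in>sols V p F. chr (p * p) (\<Sum>i\<in>V. h i * a i) * fibre_sum V p F h a)"
proof -
  define B where "B a = {b \<in> grid V p. int (p * p) dvd iev (\<lambda>i. a i + int p * b i) F}" for a
  have fin: "finite (sols V p F)" "finite (B a)" for a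
    unfolding sols_def B_def using V(1) by simp_all
  have "psum V (p * p) F h = (\<Sum>(a, b)\<in>Sigma (sols V p F) B. chr (p * p) (\<Sum>i\<in>V. h i * a i) * chr p (\<Sum>i\<in>V. h i * b i))"
    unfolding psum_def
  \<comment> \<open>The maps split each coordinate into its two base \<open>p\<close> digits and
    join them again; the restriction to \<open>V\<close> keeps them inverse to each other outside
    \<open>V\<close>.\<close>
  proof (rule sum.reindex_bij_witness
      [where i = "\<lambda>(a, b). \<lambda>i\<in>V. a i + int p * b i" and j = "\<lambda>x. (\<lambda>i\<in>V. x i mod int p, \<lambda>i\<in>V. x i div int p)"])
    fix x assume x: "x \<in> sols V (p * p) F"
    have x': "x i \<in> {0..<int p * int p}" if "i \<in> V" for i using x that by (auto simp: sols_def grid_def)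
    have ext: "x i = undefined" if "i \<notin> V" for i
      using x that unfolding sols_def grid_def by (blast intro: PiE_arb)
    show "(case (\<lambda>i\<in>V. x i mod int p, \<lambda>i\<in>V. x i div int p) of (a, b) \<Rightarrow> \<lambda>i\<in>V. a i + int p * b i) = x"
      using ext by (simp add: fun_eq_iff restrict_def)
    have lift: "iev (\<lambda>i. (\<lambda>i\<in>V. x i mod int p) i + int p * (\<lambda>i\<in>V. x i div int p) i) F = iev x F"
      by (rule hom_eval_cong_vars[OF V(2)]) simp
    have "int p dvd iev x F" using x dvd_mult_left[of "int p" "int p"] by (simp add: sols_def)
    then have "int p dvd iev (\<lambda>i\<in>V. x i mod int p) F" by (simp only: lift[symmetric] dvd_iev_lift_iff[OF V])
    moreover have "(\<lambda>i\<in>V. x i mod int p) \<in> grid V p" using p by (simp add: grid_def)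
    moreover have "(\<lambda>i\<in>V. x i div int p) \<in> grid V p"
      unfolding grid_def
    proof (rule restrict_PiE_iff[THEN iffD2], rule ballI)
      fix i assume i: "i \<in> V"
      have "int p * (x i div int p) \<le> x i"
        using pos_mod_sign[of "int p" "x i"] p unfolding minus_mod_eq_mult_div[symmetric] by simp
      also have "\<dots> < int p * int p" using x'[OF i] by simp
      finally have "x i div int p < int p" using p by (simp add: mult_less_cancel_left)
      then show "x i div int p \<in> {0..<int p}"
        using x'[OF i] p by (simp add: pos_imp_zdiv_nonneg_iff)
    qed
    moreover have "int (p * p) dvd iev x F" using x by (simp add: sols_def)
    ultimately show "(\<lambda>i\<in>V. x i mod int p, \<lambda>i\<in>V. x i div int p) \<in> Sigma (sols V p F) B"
      by (simp only: sols_def B_def lift mem_Sigma_iff mem_Collect_eq simp_thms)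
    have "(\<Sum>i\<in>V. h i * x i) = (\<Sum>i\<in>V. h i * (x i mod int p)) + int p * (\<Sum>i\<in>V. h i * (x i div int p))"
      unfolding sum_distrib_left sum.distrib[symmetric]
      by (rule sum.cong[OF refl]) (simp add: mult.left_commute[of "int p"] distrib_left[symmetric])
    then show "(case (\<lambda>i\<in>V. x i mod int p, \<lambda>i\<in>V. x i div int p) of (a, b) \<Rightarrow>
        chr (p * p) (\<Sum>i\<in>V. h i * a i) * chr p (\<Sum>i\<in>V. h i * b i)) = chr (p * p) (\<Sum>i\<in>V. h i * x i)"
      using p by (simp add: chr_add chr_scale)
  next
    fix ab assume ab: "ab \<in> Sigma (sols V p F) B"
    obtain a b where ab': "ab = (a, b)" by (cases ab)
    have a: "a \<in> grid V p" "int p dvd iev a F" and b: "b \<in> grid V p"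
      and dvd: "int (p * p) dvd iev (\<lambda>i. a i + int p * b i) F"
      using ab by (simp_all add: ab' sols_def B_def)
    have ai: "a i \<in> {0..<int p}" "b i \<in> {0..<int p}" if "i \<in> V" for i
      using a(1) b that by (auto simp: grid_def)
    have ext: "a i = undefined" "b i = undefined" if "i \<notin> V" for i
      using a(1) b that unfolding grid_def by (blast intro: PiE_arb)+
    have "(\<lambda>i\<in>V. (\<lambda>i\<in>V. a i + int p * b i) i mod int p) = a"
      "(\<lambda>i\<in>V. (\<lambda>i\<in>V. a i + int p * b i) i div int p) = b"
      using ext ai p by (auto simp: fun_eq_iff restrict_def)
    then show "(\<lambda>i\<in>V. (case ab of (a, b) \<Rightarrow> \<lambda>i\<in>V. a i + int p * b i) i mod int p,
        \<lambda>i\<in>V. (case ab of (a, b) \<Rightarrow> \<lambda>i\<in>V. a i + int p * b i) i div int p) = ab"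
      by (simp add: ab')
    have "iev (\<lambda>i\<in>V. a i + int p * b i) F = iev (\<lambda>i. a i + int p * b i) F"
      by (rule hom_eval_cong_vars[OF V(2)]) simp
    moreover have "(\<lambda>i\<in>V. a i + int p * b i) \<in> grid V (p * p)"
      unfolding grid_def
    proof (rule restrict_PiE_iff[THEN iffD2], rule ballI)
      fix i assume i: "i \<in> V"
      have "int p * b i \<le> int p * (int p - 1)" using ai[OF i] p by (intro mult_left_mono) simp_all
      then show "a i + int p * b i \<in> {0..<int (p * p)}"
        using ai[OF i] p by (simp add: algebra_simps)
    qed
    ultimately show "(case ab of (a, b) \<Rightarrow> \<lambda>i\<in>V. a i + int p * b i) \<in> sols V (p * p) F"
      using dvd by (simp add: ab' sols_def)
  qed
  also have "\<dots> = (\<Sum>a\<in>sols V p F. \<Sum>b\<in>B a. chr (p * p) (\<Sum>i\<in>V. h i * a i) * chr p (\<Sum>i\<in>V. h i * b i))"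
    using fin by (subst sum.Sigma) simp_all
  finally show ?thesis by (simp add: fibre_sum_def B_def sum_distrib_left)
qed

text \<open>The lifts of \<open>a\<close> are invariant under translation by a vector
  \<open>v\<close> that is tangent modulo \<open>p\<close>, and the character is nontrivial on
  \<open>v\<close>.\<close>

lemma fibre_sum_eq_0:
  fixes a h v :: "nat \<Rightarrow> int"
  assumes V: "finite V" "vars_in V F" and p: "p > 0" and a: "int p dvd iev a F"
    and v: "int p dvd (\<Sum>i\<in>V. v i * iev a (pd i F))" "\<not> int p dvd (\<Sum>i\<in>V. h i * v i)"
  shows "fibre_sum V p F h a = 0"
  unfolding fibre_sum_def
proof (rule character_sum_eq_0[OF V(1) p])
  obtain c where c: "iev a F = int p * c" using a by (rule dvdE)
  note iff = dvd_square_iev_lift_iff[OF V p c]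
  have shift: "int (p * p) dvd iev (\<lambda>i. a i + int p * b' i) F"
    if b: "int (p * p) dvd iev (\<lambda>i. a i + int p * b i) F"
      and w: "int p dvd (\<Sum>i\<in>V. w i * iev a (pd i F))" and b': "\<And>i. i \<in> V \<Longrightarrow> int p dvd b' i - (b i + w i)"
    for b b' w :: "nat \<Rightarrow> int"
  proof -
    have 1: "int p dvd c + (\<Sum>i\<in>V. b i * iev a (pd i F))" using b by (simp only: iff)
    have 2: "int p dvd (\<Sum>i\<in>V. (b' i - (b i + w i)) * iev a (pd i F))" using b' by (intro dvd_sum dvd_mult2)
    have "c + (\<Sum>i\<in>V. b' i * iev a (pd i F)) = (c + (\<Sum>i\<in>V. b i * iev a (pd i F)))
        + ((\<Sum>i\<in>V. w i * iev a (pd i F)) + (\<Sum>i\<in>V. (b' i - (b i + w i)) * iev a (pd i F)))"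
      by (simp add: left_diff_distrib distrib_right sum_subtractf sum.distrib)
    then show ?thesis unfolding iff using dvd_add[OF 1 dvd_add[OF w 2]] by (simp only:)
  qed
  fix b b' :: "nat \<Rightarrow> int"
  assume b: "int (p * p) dvd iev (\<lambda>i. a i + int p * b i) F"
  show "int (p * p) dvd iev (\<lambda>i. a i + int p * b' i) F" if "\<And>i. i \<in> V \<Longrightarrow> int p dvd b' i - (b i + v i)"
    by (rule shift[OF b v(1) that])
  show "int (p * p) dvd iev (\<lambda>i. a i + int p * b' i) F" if "\<And>i. i \<in> V \<Longrightarrow> int p dvd b' i - (b i - v i)"
  proof (rule shift[OF b, where w = "\<lambda>i. - v i"])
    show "int p dvd (\<Sum>i\<in>V. - v i * iev a (pd i F))" using v(1) by (simp add: sum_negf)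
    show "int p dvd b' i - (b i + - v i)" if i: "i \<in> V" for i using \<open>\<And>i. i \<in> V \<Longrightarrow> int p dvd b' i - (b i - v i)\<close>[OF i] by simp
  qed
qed (rule v(2))

lemma norm_fibre_sum_le_card:
  "norm (fibre_sum V p F h a) \<le> card {b \<in> grid V p. int (p * p) dvd iev (\<lambda>i. a i + int p * b i) F}"
  unfolding fibre_sum_def by (rule order_trans[OF norm_sum]) simp

lemma norm_fibre_sum_le:
  fixes a h :: "nat \<Rightarrow> int"
  assumes V: "finite V" "vars_in V F" and p: "prime p" and a: "int p dvd iev a F"
    and k: "k \<in> V" "\<not> int p dvd iev a (pd k F)"
  shows "norm (fibre_sum V p F h a) \<le> p ^ (card V - 1)"
proof -
  have p0: "p > 0" using p by (rule prime_gt_0_nat)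
  obtain c where c: "iev a F = int p * c" using a by (rule dvdE)
  have "card {b \<in> grid V p. int (p * p) dvd iev (\<lambda>i. a i + int p * b i) F} \<le> p ^ (card V - 1)"
    using card_hyperplane_le[where g = "\<lambda>k. iev a (pd k F)" and c = c, OF V(1) p k] by (simp only: dvd_square_iev_lift_iff[OF V p0 c])
  then show ?thesis using norm_fibre_sum_le_card[of V p F h a] by linarith
qed

text \<open>Representatives of the points of \<open>W h\<close> over the prime field.\<close>

definition crit :: "nat set \<Rightarrow> nat \<Rightarrow> int mpoly \<Rightarrow> (nat \<Rightarrow> int) \<Rightarrow> (nat \<Rightarrow> int) set"
  where "crit V p F h = {a \<in> sols V p F. \<forall>i\<in>V. \<forall>j\<in>V.
    int p dvd h i * iev a (pd j F) - h j * iev a (pd i F)}"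

text \<open>A solution with nonzero gradient contributes nothing unless it is critical, and then at
  most \<open>p ^ (card V - 1)\<close>. By smoothness the origin is the only other possibility;
  there every direction is tangent, so the contribution is zero unless \<open>p\<close> divides
  \<open>h\<close>.\<close>

lemma norm_psum_le:
  fixes h :: "nat \<Rightarrow> int"
  assumes V: "finite V" "vars_in V F" and p: "prime p"
    and smooth: "\<And>a i. a \<in> sols V p F \<Longrightarrow> (\<And>i. i \<in> V \<Longrightarrow> int p dvd iev a (pd i F)) \<Longrightarrow> i \<in> V \<Longrightarrow> a i = 0"
  shows "norm (psum V (p * p) F h) \<le> card (crit V p F h) * p ^ (card V - 1)
    + (if (\<forall>i\<in>V. int p dvd h i) \<and> crit V p F h \<noteq> {} then p ^ card V else 0)"
proof -
  have p0: "p > 0" using p by (rule prime_gt_0_nat)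
  define z :: "nat \<Rightarrow> int" where "z = (\<lambda>i\<in>V. 0)"
  \<comment> \<open>Where the origin contributes it is itself critical. So the term can be confined
    to nonempty \<open>crit\<close>, which keeps the bound at 0 when there are no critical
    points.\<close>
  define e :: nat where "e = (if (\<forall>i\<in>V. int p dvd h i) \<and> crit V p F h \<noteq> {} then p ^ card V else 0)"
  have fin: "finite (sols V p F)" unfolding sols_def using V(1) by simp
  have pt: "norm (chr (p * p) (\<Sum>i\<in>V. h i * a i) * fibre_sum V p F h a) \<le>
      (if a \<in> crit V p F h then real (p ^ (card V - 1)) else 0) + (if a = z then real e else 0)"
    if a: "a \<in> sols V p F" for a
  proof (cases "\<exists>k\<in>V. \<not> int p dvd iev a (pd k F)")
    case True
    then obtain k where k: "k \<in> V" "\<not> int p dvd iev a (pd k F)" by (rule bexE)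
    have aF: "int p dvd iev a F" using a by (simp add: sols_def)
    show ?thesis
    proof (cases "a \<in> crit V p F h")
      case True
      have "norm (fibre_sum V p F h a) \<le> real (p ^ (card V - 1)) + (if a = z then real e else 0)"
        using norm_fibre_sum_le[OF V p aF k, of h] by (rule order_trans) simp
      then show ?thesis using True by (simp only: norm_mult norm_chr if_True mult_1)
    next
      case False
      then obtain i j where ij: "i \<in> V" "j \<in> V" "\<not> int p dvd h i * iev a (pd j F) - h j * iev a (pd i F)"
        using a unfolding crit_def by blast
      then have "i \<noteq> j" by auto
      \<comment> \<open>Orthogonal to the gradient, while its product with \<open>h\<close> is the
        minor that \<open>p\<close> does not divide.\<close>
      define v where "v l = (if l = i then iev a (pd j F) else 0) - (if l = j then iev a (pd i F) else 0)" for l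
      have "(\<Sum>l\<in>V. v l * iev a (pd l F)) = 0"
        unfolding v_def using V(1) ij(1,2) by (simp add: left_diff_distrib sum_subtractf if_distrib[of "\<lambda>x. x * _"] cong: if_cong)
      moreover have "(\<Sum>l\<in>V. h l * v l) = h i * iev a (pd j F) - h j * iev a (pd i F)"
        unfolding v_def using V(1) ij(1,2) by (simp add: right_diff_distrib sum_subtractf if_distrib[of "\<lambda>x. _ * x"] cong: if_cong)
      ultimately have "fibre_sum V p F h a = 0"
        using ij(3) by (intro fibre_sum_eq_0[OF V p0 aF, of v]) simp_all
      then show ?thesis by simp
    qed
  next
    case False
    then have grad: "int p dvd iev a (pd i F)" if "i \<in> V" for i using that by blast
    have "a i = z i" for i
    proof (cases "i \<in> V")
      case True
      then show ?thesis using smooth[OF a grad] by (simp add: z_def)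
    next
      case False
      then have "a i = undefined" using a unfolding sols_def grid_def by (blast intro: PiE_arb)
      then show ?thesis using False by (simp add: z_def)
    qed
    then have az: "a = z" by (rule ext)
    have aF: "int p dvd iev a F" using a by (simp add: sols_def)
    show ?thesis
    proof (cases "\<forall>i\<in>V. int p dvd h i")
      case True
      have "card {b \<in> grid V p. int (p * p) dvd iev (\<lambda>i. a i + int p * b i) F} \<le> card (grid V p)"
        using V(1) by (intro card_mono) auto
      also have "\<dots> = e"
      proof -
        have "a \<in> crit V p F h" unfolding crit_def using a True by simp
        then show ?thesis using True V(1) by (auto simp: card_grid e_def)
      qed
      finally have "norm (fibre_sum V p F h a) \<le> e" using norm_fibre_sum_le_card[of V p F h a] by linarith
      then have "norm (fibre_sum V p F h a) \<le> (if a \<in> crit V p F h then real (p ^ (card V - 1)) else 0) + real e"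
        by (rule order_trans) simp
      then show ?thesis using az by (simp only: norm_mult norm_chr if_True mult_1 refl)
    next
      case False
      then obtain k where k: "k \<in> V" "\<not> int p dvd h k" by blast
      \<comment> \<open>The gradient vanishes modulo \<open>p\<close>, so a unit vector is
        tangent.\<close>
      define v :: "nat \<Rightarrow> int" where "v l = (if l = k then 1 else 0)" for l
      have "(\<Sum>l\<in>V. v l * iev a (pd l F)) = iev a (pd k F)"
        unfolding v_def using V(1) k(1) by (simp add: if_distrib[of "\<lambda>x. x * _"] cong: if_cong)
      moreover have "(\<Sum>l\<in>V. h l * v l) = h k"
        unfolding v_def using V(1) k(1) by (simp add: if_distrib[of "\<lambda>x. _ * x"] cong: if_cong)
      ultimately have "fibre_sum V p F h a = 0"
        using grad k by (intro fibre_sum_eq_0[OF V p0 aF, of v]) simp_all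
      then show ?thesis by simp
    qed
  qed
  have "norm (psum V (p * p) F h) \<le> (\<Sum>a\<in>sols V p F.
      (if a \<in> crit V p F h then real (p ^ (card V - 1)) else 0) + (if a = z then real e else 0))"
    unfolding psum_square_decompose[OF V p0] by (rule sum_norm_le) (rule pt)
  also have "\<dots> = card (crit V p F h) * p ^ (card V - 1) + (if z \<in> sols V p F then real e else 0)"
  proof -
    have "sols V p F \<inter> crit V p F h = crit V p F h" unfolding crit_def by blast
    then show ?thesis using fin by (simp add: sum.distrib sum.If_cases Collect_mem_eq)
  qed
  also have "\<dots> \<le> card (crit V p F h) * p ^ (card V - 1) + real e" by simp
  finally show ?thesis unfolding e_def by simp
qed

section \<open>From residues modulo \<open>p\<close> to a field of characteristic
  \<open>p\<close>\<close>

lemma of_int_iev: "of_int (iev x f) = (iev (\<lambda>i. of_int (x i)) f :: 'a::comm_ring_1)"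
proof -
  have "of_int (\<Prod>i\<in>#m. x i) = (\<Prod>i\<in>#m. of_int (x i) :: 'a)" for m by (induction m) simp_all
  then show ?thesis by (induction f rule: mpoly_induct) auto
qed

lemma iev_scale_homog: "homog e f \<Longrightarrow> iev (\<lambda>i. c * x i) f = c ^ e * iev x f" for x :: "nat \<Rightarrow> 'a::comm_ring_1"
  using ev_scale_homog[of e "imap f :: 'a mpoly" c x] by (simp add: ev_imap homog_imap)

definition pt_of_int :: "nat set \<Rightarrow> (nat \<Rightarrow> int) \<Rightarrow> nat \<Rightarrow> 'a::ring_1"
  where "pt_of_int V a i = (if i \<in> V then of_int (a i) else 0)"

lemma pt_of_int_pts [simp]: "pt_of_int V a \<in> pts V"
  by (simp add: pts_def pt_of_int_def)

lemma iev_pt_of_int: "vars_in V f \<Longrightarrow> iev (pt_of_int V a) f = (of_int (iev a f) :: 'a::comm_ring_1)"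
proof -
  assume f: "vars_in V f"
  have "iev (pt_of_int V a) f = (iev (\<lambda>i. of_int (a i)) f :: 'a)"
    by (rule hom_eval_cong_vars[OF f]) (simp add: pt_of_int_def)
  then show ?thesis by (simp only: of_int_iev)
qed

lemma inj_on_pt_of_int:
  assumes "CHAR('a::ring_1) = p"
  shows "inj_on (pt_of_int V :: _ \<Rightarrow> nat \<Rightarrow> 'a) (grid V p)"
proof (rule inj_onI)
  fix a b assume ab: "a \<in> grid V p" "b \<in> grid V p" "pt_of_int V a = (pt_of_int V b :: nat \<Rightarrow> 'a)"
  show "a = b"
  proof
    fix i show "a i = b i"
    proof (cases "i \<in> V")
      case True
      have "(of_int (a i) :: 'a) = of_int (b i)" using fun_cong[OF ab(3), of i] True by (simp add: pt_of_int_def)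
      then have "(of_int (a i - b i) :: 'a) = 0" by simp
      then have "int p dvd a i - b i" using assms by (simp only: of_int_eq_0_iff_char_dvd)
      then have "a i mod int p = b i mod int p" by (simp only: mod_eq_dvd_iff)
      moreover have "a i \<in> {0..<int p}" "b i \<in> {0..<int p}" using ab True by (auto simp: grid_def)
      ultimately show ?thesis by simp
    next
      case False
      then have "a i = undefined" "b i = undefined" using ab(1,2) unfolding grid_def by (blast intro: PiE_arb)+
      then show ?thesis by simp
    qed
  qed
qed

text \<open>If there were no nonzero zero in the plane of the first two coordinates,
  \<open>iev (pt r 1) F\<close> and \<open>iev (pt 1 r) F\<close> would be polynomials in
  \<open>r\<close> without roots, hence constants. They agree at \<open>r = 1\<close>, but
  homogeneity relates them by a factor \<open>s ^ d\<close>, which can be chosen different from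
  1.\<close>

lemma ex_nonzero_zero:
  fixes F :: "int mpoly"
  assumes n: "n \<ge> 2" and d: "d > 0" and F: "homog d F"
  shows "\<exists>x :: nat \<Rightarrow> 'a::alg_closed_field. x \<in> pts {1..n} \<and> iev x F = 0 \<and> (\<exists>i. x i \<noteq> 0)"
proof -
  define pt :: "'a \<Rightarrow> 'a \<Rightarrow> nat \<Rightarrow> 'a" where "pt r s i = (if i = 1 then r else if i = 2 then s else 0)" for r s i
  have pts: "pt r s \<in> pts {1..n}" for r s using n by (auto simp: pts_def pt_def)
  have scale: "iev (pt (c * r) (c * s)) F = c ^ d * iev (pt r s) F" for c r s
  proof -
    have "pt (c * r) (c * s) = (\<lambda>i. c * pt r s i)" by (auto simp: pt_def fun_eq_iff)
    then show ?thesis using iev_scale_homog[OF F, of c "pt r s"] by simp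
  qed
  show ?thesis
  proof (rule ccontr)
    assume no: "\<not> ?thesis"
    have "pt r 1 2 \<noteq> 0" "pt 1 r 1 \<noteq> 0" for r by (simp_all add: pt_def)
    then have nz: "iev (pt r 1) F \<noteq> 0" "iev (pt 1 r) F \<noteq> 0" for r
      using no pts[of r 1] pts[of 1 r] by blast+
    have const: "\<exists>c. \<forall>r. iev (g r) F = c"
      if g: "\<And>r. g r = (\<lambda>i. poly (G i) r)" and nz: "\<And>r. iev (g r) F \<noteq> 0" for g :: "'a \<Rightarrow> nat \<Rightarrow> 'a" and G
    proof -
      define q :: "'a poly" where "q = hom_eval of_int G F"
      have q: "poly q r = iev (g r) F" for r
        unfolding q_def by (induction F rule: mpoly_induct)
          (auto simp: g poly_prod_mset image_mset.compositionality o_def)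
      have "degree q = 0"
      proof (rule ccontr)
        assume "degree q \<noteq> 0"
        then obtain r where "poly q r = 0" using alg_closed_imp_poly_has_root by blast
        then show False using nz q by simp
      qed
      then obtain c where "q = [:c:]" by (rule degree_eq_zeroE)
      then show ?thesis using q by (metis poly_const_conv)
    qed
    have "pt r 1 = (\<lambda>i. poly (if i = 1 then [:0, 1:] else if i = 2 then 1 else 0) r)" for r
      by (auto simp: pt_def fun_eq_iff)
    from const[OF this nz(1)] obtain c where c: "\<forall>r. iev (pt r 1) F = c" by (rule exE)
    have "pt 1 r = (\<lambda>i. poly (if i = 1 then 1 else if i = 2 then [:0, 1:] else 0) r)" for r
      by (auto simp: pt_def fun_eq_iff)
    from const[OF this nz(2)] obtain c' where c': "\<forall>r. iev (pt 1 r) F = c'" by (rule exE)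
    have "infinite (UNIV :: 'a set)" by (rule alg_closed_infinite)
    then obtain u :: 'a where u: "u \<notin> {0, 1}" using ex_new_if_finite[of "{0, 1}"] by auto
    obtain s where s: "s ^ d = u" using nth_root_exists[OF d, of u] by (rule exE)
    have "s \<noteq> 0" using s u d by (auto simp: zero_power)
    then have "iev (pt 1 s) F = u * iev (pt (inverse s) 1) F"
      using scale[of s "inverse s" 1] s by simp
    then have "c' = u * c" using c c' by simp
    moreover have "c = c'" using c c' by metis
    moreover have "c \<noteq> 0" using c nz(1) by metis
    ultimately show False using u by simp
  qed
qed

text \<open>A nonvanishing rank polynomial means that the Hilbert function of the fibre drops below
  the bound at some \<open>t \<le> T\<close>, whence growth of order \<open>j - 1\<close> with a
  constant in terms of \<open>T\<close>. The critical points lie in a grid with \<open>p\<close>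
  values per coordinate, so the Hilbert function at \<open>n * p\<close> bounds their
  number.\<close>

theorem norm_psum_le_of_rank:
  fixes F :: "int mpoly" and h :: "nat \<Rightarrow> int" and T :: nat
  assumes n: "n \<ge> 2" and p: "prime p" "CHAR('a::alg_closed_field) = p"
    and F: "homog d F" "vars_in {1..n} F" and nz: "(imap F :: 'a mpoly) \<noteq> 0"
    and smooth: "\<And>y :: nat \<Rightarrow> 'a. y \<in> pts {1..n} \<Longrightarrow> y \<noteq> (\<lambda>i. 0) \<Longrightarrow> iev y F = 0 \<Longrightarrow>
      \<exists>i\<in>{1..n}. iev y (pd i F) \<noteq> 0"
    and P: "t \<le> T" "P \<in> rank_polys n d F j t" "\<not> int p dvd iev h P"
  shows "norm (psum {1..n} (p * p) F h) \<le> real (2 ^ n * (T + 1) ^ n * (n + 1) ^ j + 1) * real p ^ (n + j - 2)"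
proof -
  define V where "V = {1..n}"
  have V: "finite V" "vars_in V F" "card V = n" using F(2) by (simp_all add: V_def)
  have p0: "p > 0" using p(1) by (rule prime_gt_0_nat)
  have dvd_iff: "int p dvd x \<longleftrightarrow> (of_int x :: 'a) = 0" for x using p(2) by (simp add: of_int_eq_0_iff_char_dvd)
  define h' :: "nat \<Rightarrow> 'a" where "h' = pt_of_int V h"
  define I where "I = wideal n F h'"
  interpret hom_ideal V I unfolding V_def I_def by (rule hom_ideal_wideal[OF F])
  have zeros: "zeros V I = wvar n F h'" unfolding V_def I_def by (rule zeros_wideal[OF F])
  have "iev h' P \<noteq> 0"
    using P(3) vars_in_rank_polys[OF F P(2)] unfolding h'_def V_def by (simp add: iev_pt_of_int dvd_iff)
  then have HFt: "HF I t < (t + j) choose j"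
    using P(2) HF_wideal_ge_iff[OF F, of t j h'] unfolding I_def by (meson not_le)
  define K where "K = 2 ^ n * (T + 1) ^ n"
  have growth: "HF I s * (s + 1) \<le> K * (s + 1) ^ j" for s
  proof -
    have "HF I s * (s + 1) \<le> 2 ^ n * (t + 1) ^ n * (s + 1) ^ j" using HF_growth[OF HFt] unfolding V(3) .
    also have "\<dots> \<le> K * (s + 1) ^ j"
      unfolding K_def using P(1) by (intro mult_le_mono1 mult_le_mono2 power_mono) simp_all
    finally show ?thesis .
  qed
  let ?Z = "(pt_of_int V :: _ \<Rightarrow> nat \<Rightarrow> 'a) ` crit V p F h"
  have crit_grid: "crit V p F h \<subseteq> grid V p" by (auto simp: crit_def sols_def)
  then have fin: "finite (crit V p F h)" using finite_grid[OF V(1)] by (rule finite_subset)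
  have Z: "?Z \<subseteq> wvar n F h'"
  proof
    fix x assume "x \<in> ?Z"
    then obtain a where a: "a \<in> crit V p F h" "x = pt_of_int V a" by (elim imageE)
    have e1: "of_int (iev a F) = (0::'a)" using a(1) unfolding crit_def sols_def by (simp add: dvd_iff)
    have e2: "of_int (h i * iev a (pd j F) - h j * iev a (pd i F)) = (0::'a)" if "i \<in> V" "j \<in> V" for i j
      using a(1) that unfolding crit_def dvd_iff by blast
    show "x \<in> wvar n F h'"
      unfolding wvar_def a(2) V_def[symmetric] mem_Collect_eq
    proof (intro conjI ballI)
      show "iev (pt_of_int V a) F = (0 :: 'a)" using e1 V(2) by (simp only: iev_pt_of_int)
      fix i j assume ij: "i \<in> V" "j \<in> V"
      show "h' i * iev (pt_of_int V a) (pd j F) = h' j * iev (pt_of_int V a) (pd i F)"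
        using e2[OF ij] ij V(2) by (simp add: iev_pt_of_int vars_in_pd h'_def pt_of_int_def)
    qed simp
  qed
  have card_crit: "card (crit V p F h) \<le> HF I (n * p)"
  proof -
    have "card (crit V p F h) = card ?Z"
      using inj_on_subset[OF inj_on_pt_of_int[OF p(2)] crit_grid] by (simp add: card_image)
    also have "\<dots> \<le> HF I (card V * card ((of_int :: int \<Rightarrow> 'a) ` {0..<int p}))"
    proof (rule card_grid_points_le_HF)
      show "?Z \<subseteq> zeros V I" using Z zeros by simp
      fix x i assume "x \<in> ?Z" and i: "i \<in> V"
      then obtain a where a: "a \<in> crit V p F h" "x = pt_of_int V a" by (elim imageE)
      have "a \<in> grid V p" using a(1) crit_grid by blast
      then have "a i \<in> {0..<int p}" using i by (auto simp: grid_def)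
      then show "x i \<in> of_int ` {0..<int p}" using i a(2) by (simp add: pt_of_int_def)
    qed (use fin in simp_all)
    also have "\<dots> \<le> HF I (n * p)"
      unfolding V(3) by (intro HF_mono mult_le_mono2 order_trans[OF card_image_le]) simp_all
    finally show ?thesis .
  qed
  have psum: "norm (psum V (p * p) F h) \<le> card (crit V p F h) * p ^ (n - 1)
    + (if (\<forall>i\<in>V. int p dvd h i) \<and> crit V p F h \<noteq> {} then p ^ n else 0)"
    unfolding V(3)[symmetric]
  proof (rule norm_psum_le[OF V(1,2) p(1)])
    fix a i assume a: "a \<in> sols V p F" "\<And>i. i \<in> V \<Longrightarrow> int p dvd iev a (pd i F)" and i: "i \<in> V"
    show "a i = 0"
    proof -
      have "pt_of_int V a = (\<lambda>i. 0 :: 'a)"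
      proof (rule ccontr)
        assume "pt_of_int V a \<noteq> (\<lambda>i. 0 :: 'a)"
        moreover have "iev (pt_of_int V a) F = (0 :: 'a)"
          using a(1) V(2) by (simp add: iev_pt_of_int sols_def dvd_iff)
        ultimately obtain i where "i \<in> V" "iev (pt_of_int V a) (pd i F) \<noteq> (0 :: 'a)"
          using smooth[of "pt_of_int V a"] unfolding V_def by (metis pt_of_int_pts)
        then show False using a(2)[of i] V(2) by (simp add: iev_pt_of_int vars_in_pd dvd_iff)
      qed
      from fun_cong[OF this, of i] have "int p dvd a i" using i by (simp add: pt_of_int_def dvd_iff)
      moreover have "a i \<in> {0..<int p}" using a(1) i by (auto simp: sols_def grid_def)
      ultimately show ?thesis by (simp add: zdvd_not_zless dvd_imp_le_int order.strict_iff_order) (metis zdvd_not_zless order_le_less atLeastLessThan_iff)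
    qed
  qed
  show ?thesis
  proof (cases "crit V p F h = {}")
    case True
    then show ?thesis using psum unfolding V_def by simp
  next
    case False
    then obtain a where a: "a \<in> crit V p F h" by blast
    \<comment> \<open>For \<open>j = 0\<close> the growth bound forces the Hilbert function to
      vanish, so that there would be no critical points.\<close>
    have j0: "j \<noteq> 0"
    proof
      assume "j = 0"
      then have "HF I (max K (n * p)) * (max K (n * p) + 1) \<le> K" using growth by simp
      then have "HF I (max K (n * p)) = 0" by (cases "HF I (max K (n * p))") auto
      then have "HF I (n * p) = 0" using HF_mono[of "n * p" "max K (n * p)"] by simp
      then show False using card_crit fin False by simp
    qed
    \<comment> \<open>If \<open>p\<close> divides \<open>h\<close>, the fibre is the whole
      hypersurface. It contains the line through a nonzero zero, so that \<open>j \<ge> 2\<close>;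
      hence \<open>n \<le> n + j - 2\<close>.\<close>
    have e: "real (if (\<forall>i\<in>V. int p dvd h i) \<and> crit V p F h \<noteq> {} then p ^ n else 0) \<le> real p ^ (n + j - 2)"
    proof (cases "\<forall>i\<in>V. int p dvd h i")
      case True
      then have h0: "h' = (\<lambda>i. 0)" unfolding h'_def by (auto simp: pt_of_int_def dvd_iff fun_eq_iff)
      have "d > 0"
      proof (rule ccontr)
        assume "\<not> d > 0"
        then have m: "m = {#}" if "m \<in> supp F" for m using F(1) that by (simp add: homog_def)
        then have FC: "F = Cst (coef F {#})"
          by (intro poly_mapping_eqI) (auto simp: lookup_single when_def in_keys_iff)
        have "iev a F = coef F {#}" by (subst FC) simp
        then have "of_int (coef F {#}) = (0::'a)" using a unfolding crit_def sols_def by (simp add: dvd_iff)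
        then have "imap F = (0 :: 'a mpoly)" using m by (intro poly_mapping_eqI) (metis coef_imap in_keys_iff lookup_zero of_int_0)
        then show False using nz by simp
      qed
      from ex_nonzero_zero[OF n this F(1)]
      obtain x :: "nat \<Rightarrow> 'a" and i where x: "x \<in> pts {1..n}" "iev x F = 0" "x i \<noteq> 0" by (elim exE conjE)
      have "x \<in> zeros V I" unfolding zeros wvar_def h0 using x by simp
      from has_chain_1_of_nonzero_zero[OF alg_closed_infinite this x(3)]
      have "has_chain V (Suc 0) (wvar n F h')" unfolding zeros .
      then have "has_chain {1..n} (Suc 0) (wvar n F h')" unfolding V_def .
      then have "(t + 1) choose 1 \<le> HF I t"
        using has_chain_wvar_iff[OF F, of "Suc 0" h'] HF_wideal_ge_iff[OF F, of t 1 h'] unfolding I_def by simp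
      then have "j \<noteq> 1" using HFt by (intro notI) simp
      then have "n \<le> n + j - 2" using j0 by simp
      then have "p ^ n \<le> p ^ (n + j - 2)" using p0 by (intro power_increasing) simp_all
      then show ?thesis by simp
    next
      case False
      then show ?thesis by auto
    qed
    have "card (crit V p F h) \<le> K * (n + 1) ^ j * p ^ (j - 1)"
    proof -
      obtain k where k: "j = Suc k" using j0 by (cases j) auto
      have "(n * p + 1) * HF I (n * p) \<le> (n * p + 1) * (K * (n * p + 1) ^ k)"
        using growth[of "n * p"] unfolding k power_Suc by (simp only: mult_ac)
      then have "HF I (n * p) \<le> K * (n * p + 1) ^ k" by (simp only: nat_mult_le_cancel1)
      \<comment> \<open>The inequality \<open>n * p + 1 \<le> (n + 1) * p\<close> is the origin of
        the powers of \<open>n + 1\<close> in the constant.\<close>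
      also have "\<dots> \<le> K * ((n + 1) * p) ^ k" using p0 by (intro mult_le_mono2 power_mono) (simp_all add: Suc_le_eq)
      also have "\<dots> = K * (n + 1) ^ k * p ^ k" by (simp only: power_mult_distrib mult.assoc)
      also have "\<dots> \<le> K * (n + 1) ^ j * p ^ k" by (intro mult_le_mono1 mult_le_mono2 power_increasing) (simp_all add: k)
      finally show ?thesis using card_crit by (simp add: k)
    qed
    then have "card (crit V p F h) * p ^ (n - 1) \<le> K * (n + 1) ^ j * p ^ (j - 1) * p ^ (n - 1)" by (rule mult_le_mono1)
    also have "\<dots> = K * (n + 1) ^ j * p ^ (n + j - 2)"
    proof -
      have "(j - 1) + (n - 1) = n + j - 2" using j0 n by simp
      then show ?thesis by (simp only: mult.assoc power_add[symmetric])
    qed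
    finally have "real (card (crit V p F h) * p ^ (n - 1)) \<le> real (K * (n + 1) ^ j * p ^ (n + j - 2))" by (simp only: of_nat_le_iff)
    then have "norm (psum V (p * p) F h) \<le> real (K * (n + 1) ^ j * p ^ (n + j - 2)) + real p ^ (n + j - 2)"
      using psum e by (simp only: of_nat_add)
    also have "\<dots> = real (2 ^ n * (T + 1) ^ n * (n + 1) ^ j + 1) * real p ^ (n + j - 2)"
      unfolding K_def by (simp add: distrib_right add_ac)
    finally show ?thesis unfolding V_def .
  qed
qed

section \<open>Indexed polynomials over a ring\<close>

text \<open>A description by supports makes the inductively generated polynomials comparable with
  \<open>mpoly\<close>. Conversely, a function is rebuilt from its finite support one monomial at a
  time.\<close>

lemma (in ring) indexed_pset_iff:
  "P \<in> indexed_pset I (carrier R) \<longleftrightarrow>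
    finite {m. P m \<noteq> \<zero>} \<and> (\<forall>m. P m \<in> carrier R) \<and> (\<forall>m. P m \<noteq> \<zero> \<longrightarrow> set_mset m \<subseteq> I)"
proof
  assume "P \<in> indexed_pset I (carrier R)"
  then show "finite {m. P m \<noteq> \<zero>} \<and> (\<forall>m. P m \<in> carrier R) \<and> (\<forall>m. P m \<noteq> \<zero> \<longrightarrow> set_mset m \<subseteq> I)"
  proof (induction rule: indexed_pset.induct)
    case (indexed_const k)
    have "finite {m. indexed_const k m \<noteq> \<zero>}"
      by (rule finite_subset[of _ "{{#}}"]) (auto simp: indexed_const_def)
    then show ?case using indexed_const by (auto simp: indexed_const_def)
  next
    case (indexed_padd P Q)
    have "finite {m. indexed_padd P Q m \<noteq> \<zero>}"
      by (rule finite_subset[of _ "{m. P m \<noteq> \<zero>} \<union> {m. Q m \<noteq> \<zero>}"]) (use indexed_padd in \<open>auto simp: indexed_padd_def\<close>)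
    moreover have "set_mset m \<subseteq> I" if "indexed_padd P Q m \<noteq> \<zero>" for m
    proof -
      have "P m \<noteq> \<zero> \<or> Q m \<noteq> \<zero>" using that by (auto simp: indexed_padd_def)
      then show ?thesis using indexed_padd by blast
    qed
    ultimately show ?case using indexed_padd by (simp add: indexed_padd_def)
  next
    case (indexed_pmult P i)
    have "finite {m. indexed_pmult P i m \<noteq> \<zero>}"
    proof (rule finite_subset)
      show "{m. indexed_pmult P i m \<noteq> \<zero>} \<subseteq> add_mset i ` {m. P m \<noteq> \<zero>}"
        by (auto simp: indexed_pmult_def split: if_splits intro!: image_eqI[of _ _ "_ - {#i#}"])
    qed (use indexed_pmult in simp)
    moreover have "set_mset m \<subseteq> I" if "indexed_pmult P i m \<noteq> \<zero>" for m
    proof -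
      have m: "i \<in># m" "P (m - {#i#}) \<noteq> \<zero>" using that by (auto simp: indexed_pmult_def split: if_splits)
      obtain m' where m': "m = add_mset i m'" using m(1) by (metis mset_add)
      then have "set_mset m' \<subseteq> I" using m(2) indexed_pmult.IH by auto
      then show ?thesis using m' indexed_pmult.hyps by simp
    qed
    ultimately show ?case using indexed_pmult by (simp add: indexed_pmult_def)
  qed
next
  define mn where "mn m c = (\<lambda>m'. if m' = m then c else \<zero>)" for m :: "'c multiset" and c
  have mn: "mn m c \<in> indexed_pset I (carrier R)" if "c \<in> carrier R" "set_mset m \<subseteq> I" for m c
    using that(2)
  proof (induction m)
    case empty
    have "mn {#} c = indexed_const c" by (simp add: mn_def indexed_const_def)
    then show ?case using that(1) by (simp add: indexed_pset.indexed_const)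
  next
    case (add i m)
    have "mn (add_mset i m) c = indexed_pmult (mn m c) i"
    proof
      fix m' show "mn (add_mset i m) c m' = indexed_pmult (mn m c) i m'"
      proof (cases "i \<in># m'")
        case True
        then obtain m'' where "m' = add_mset i m''" by (metis mset_add)
        then show ?thesis by (simp add: mn_def indexed_pmult_def)
      next
        case False
        then show ?thesis by (auto simp: mn_def indexed_pmult_def)
      qed
    qed
    then show ?case using add by (simp add: indexed_pset.indexed_pmult)
  qed
  have "finite A \<Longrightarrow> {m. P m \<noteq> \<zero>} = A \<Longrightarrow> (\<forall>m. P m \<in> carrier R) \<Longrightarrow> (\<forall>m. P m \<noteq> \<zero> \<longrightarrow> set_mset m \<subseteq> I) \<Longrightarrow>
      P \<in> indexed_pset I (carrier R)" for A P
  proof (induction A arbitrary: P rule: finite_induct)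
    case empty
    then have "P = indexed_const \<zero>" by (auto simp: indexed_const_def fun_eq_iff)
    then show ?case by (simp add: indexed_pset.indexed_const)
  next
    case (insert m A)
    define Q where "Q = P(m := \<zero>)"
    have "Q \<in> indexed_pset I (carrier R)"
      using insert.prems insert.hyps by (intro insert.IH) (auto simp: Q_def)
    moreover have "P m \<noteq> \<zero>" using insert.prems(1) by blast
    then have "mn m (P m) \<in> indexed_pset I (carrier R)" using insert.prems by (intro mn) simp_all
    moreover have "P = indexed_padd (mn m (P m)) Q"
      using insert.prems(2) by (auto simp: indexed_padd_def mn_def Q_def)
    ultimately show ?case by (metis indexed_pset.indexed_padd)
  qed
  then show "finite {m. P m \<noteq> \<zero>} \<and> (\<forall>m. P m \<in> carrier R) \<and> (\<forall>m. P m \<noteq> \<zero> \<longrightarrow> set_mset m \<subseteq> I) \<Longrightarrow>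
      P \<in> indexed_pset I (carrier R)" by blast
qed

lemma polys_iff:
  assumes "ring R"
  shows "P \<in> polys R n \<longleftrightarrow> finite {m. P m \<noteq> \<zero>\<^bsub>R\<^esub>} \<and> (\<forall>m. P m \<in> carrier R) \<and>
    (\<forall>m. P m \<noteq> \<zero>\<^bsub>R\<^esub> \<longrightarrow> set_mset m \<subseteq> {1..n})"
  unfolding polys_def by (rule ring.indexed_pset_iff[OF assms])

text \<open>Injectivity is not demanded, so that the locale covers both the reduction of integers
  modulo \<open>q\<close> and the identification of a field type with a field given as a
  record.\<close>

locale ring_rep = cring R for R :: "('b, 'r) ring_scheme" (structure) +
  fixes \<phi> :: "'a::comm_ring_1 \<Rightarrow> 'b"
  assumes rep_closed [simp]: "\<phi> a \<in> carrier R"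
    and rep_add: "\<phi> (a + b) = \<phi> a \<oplus> \<phi> b"
    and rep_mult: "\<phi> (a * b) = \<phi> a \<otimes> \<phi> b"
    and rep_one: "\<phi> 1 = \<one>"
begin

lemma rep_zero: "\<phi> 0 = \<zero>"
  using rep_add[of 0 0] l_zero[of "\<phi> 0"] by (metis add.right_cancel rep_closed add.right_neutral add.l_cancel_one)

lemma rep_sum: "finite A \<Longrightarrow> \<phi> (sum f A) = (\<Oplus>a\<in>A. \<phi> (f a))"
  by (induction A rule: finite_induct) (auto simp: rep_zero rep_add)

lemma rep_prod: "finite A \<Longrightarrow> \<phi> (prod f A) = (\<Otimes>a\<in>A. \<phi> (f a))"
  by (induction A rule: finite_induct) (auto simp: rep_one rep_mult)

lemma rep_power: "\<phi> (a ^ k) = \<phi> a [^] k"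
  by (induction k) (auto simp: rep_one rep_mult m_comm)

lemma rep_of_nat: "\<phi> (of_nat k * a) = [k] \<cdot> \<phi> a"
proof (induction k)
  case 0
  then show ?case by (simp add: rep_zero)
next
  case (Suc k)
  have "\<phi> (of_nat (Suc k) * a) = \<phi> a \<oplus> [k] \<cdot> \<phi> a" by (simp add: distrib_right rep_add Suc)
  also have "\<dots> = [Suc k] \<cdot> \<phi> a" by (rule add.nat_pow_Suc2[symmetric]) simp
  finally show ?case .
qed

lemma rep_prod_mset: "\<phi> (\<Prod>i\<in>#m. y i) = (\<Otimes>i\<in>set_mset m. \<phi> (y i) [^] count m i)"
  by (simp add: image_prod_mset_multiplicity rep_prod rep_power)

lemma poly_value_rep:
  assumes "vars_in V f" "\<And>i. i \<in> V \<Longrightarrow> x i = \<phi> (y i)"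
  shows "poly_value R (\<lambda>m. \<phi> (coef f m)) x = \<phi> (ev y f)"
proof -
  have "\<phi> (ev y f) = (\<Oplus>m\<in>supp f. \<phi> (coef f m) \<otimes> (\<Otimes>i\<in>set_mset m. \<phi> (y i) [^] count m i))"
    by (simp add: hom_eval_def rep_sum rep_mult rep_prod_mset)
  also have "\<dots> = (\<Oplus>m\<in>{m. \<phi> (coef f m) \<noteq> \<zero>}. \<phi> (coef f m) \<otimes> (\<Otimes>i\<in>set_mset m. x i [^] count m i))"
  proof (rule add.finprod_mono_neutral_cong_right)
    show "{m. \<phi> (coef f m) \<noteq> \<zero>} \<subseteq> supp f" by (auto simp: in_keys_iff rep_zero)
    fix m assume m: "m \<in> {m. \<phi> (coef f m) \<noteq> \<zero>}"
    then have "m \<in> supp f" by (auto simp: in_keys_iff rep_zero)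
    then have "set_mset m \<subseteq> V" using assms(1) by (simp add: vars_in_def)
    then show "\<phi> (coef f m) \<otimes> (\<Otimes>i\<in>set_mset m. \<phi> (y i) [^] count m i)
        = \<phi> (coef f m) \<otimes> (\<Otimes>i\<in>set_mset m. x i [^] count m i)"
      using assms(2) by (intro arg_cong2[where f = "(\<otimes>)"] finprod_cong') auto
  qed (auto intro!: finprod_closed)
  finally show ?thesis by (simp add: poly_value_def)
qed

lemma partial_rep: "partial R i (\<lambda>m. \<phi> (coef f m)) = (\<lambda>m. \<phi> (coef (pd i f) m))"
  by (simp only: partial_def coef_pd rep_of_nat)

lemma rep_in_polys: "vars_in {1..n} f \<Longrightarrow> (\<lambda>m. \<phi> (coef f m)) \<in> polys R n"
  unfolding polys_iff[OF ring_axioms]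
proof (intro conjI allI impI)
  have sub: "{m. \<phi> (coef f m) \<noteq> \<zero>} \<subseteq> supp f" by (auto simp: in_keys_iff rep_zero)
  then show "finite {m. \<phi> (coef f m) \<noteq> \<zero>}" by (rule finite_subset) simp
  assume f: "vars_in {1..n} f"
  fix m assume "\<phi> (coef f m) \<noteq> \<zero>"
  then have "m \<in> supp f" using sub by blast
  then show "set_mset m \<subseteq> {1..n}" using f by (simp add: vars_in_def)
qed simp

end

definition vres :: "nat set \<Rightarrow> 'a::comm_ring_1 mpoly \<Rightarrow> 'a mpoly"
  where "vres V f = (\<Sum>m\<in>{m \<in> supp f. set_mset m \<subseteq> V}. mon m (coef f m))"

lemma coef_vres: "coef (vres V f) m = (if set_mset m \<subseteq> V then coef f m else 0)"
proof -
  have "coef (vres V f) m = (\<Sum>n\<in>{m \<in> supp f. set_mset m \<subseteq> V}. if n = m then coef f n else 0)"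
    by (simp add: vres_def lookup_sum lookup_single when_def)
  then show ?thesis by (simp add: in_keys_iff)
qed

lemma vars_in_vres: "vars_in V (vres V f)"
  by (auto simp: vars_in_def in_keys_iff coef_vres split: if_splits)

lemma ev_vres: "x \<in> pts V \<Longrightarrow> ev x (vres V f) = ev x f"
proof -
  assume x: "x \<in> pts V"
  have z: "(\<Prod>i\<in>#m. x i) = 0" if "\<not> set_mset m \<subseteq> V" for m
  proof -
    obtain i where "i \<in># m" "i \<notin> V" using \<open>\<not> set_mset m \<subseteq> V\<close> by blast
    then show ?thesis using x by (auto simp: pts_def dest: multi_member_split)
  qed
  have "ev x (vres V f) = (\<Sum>m\<in>{m \<in> supp f. set_mset m \<subseteq> V}. coef f m * (\<Prod>i\<in>#m. x i))"
    by (simp add: vres_def)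
  also have "\<dots> = ev x f"
    unfolding hom_eval_def using z by (intro sum.mono_neutral_left) auto
  finally show ?thesis .
qed

section \<open>Closed sets and dimension over an algebraically closed field given as a record\<close>

locale field_rep = ring_rep L rep for L :: "('b, 'r) ring_scheme" (structure) and rep :: "'a::field \<Rightarrow> 'b" +
  assumes bij: "bij_betw rep UNIV (carrier L)"
begin

lemma rep_inject [simp]: "rep a = rep b \<longleftrightarrow> a = b"
  using bij by (auto simp: bij_betw_def inj_eq)

lemma rep_eq_zero [simp]: "rep a = \<zero> \<longleftrightarrow> a = 0"
  using rep_zero rep_inject by metis

lemma rep_surj: "b \<in> carrier L \<Longrightarrow> \<exists>a. b = rep a"
  using bij by (auto simp: bij_betw_def)

text \<open>Outside \<open>{1..n}\<close> a point is 0 on the side of the type and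
  \<open>undefined\<close> on the side of the record.\<close>

definition lift :: "nat \<Rightarrow> (nat \<Rightarrow> 'a) \<Rightarrow> nat \<Rightarrow> 'b"
  where "lift n y = (\<lambda>i\<in>{1..n}. rep (y i))"

lemma lift_apply: "i \<in> {1..n} \<Longrightarrow> lift n y i = rep (y i)"
  by (simp add: lift_def)

lemma lift_inj: "inj_on (lift n) (pts {1..n})"
proof (rule inj_onI)
  fix x y assume xy: "x \<in> pts {1..n}" "y \<in> pts {1..n}" "lift n x = lift n y"
  show "x = y"
  proof
    fix i show "x i = y i"
    proof (cases "i \<in> {1..n}")
      case True
      then show ?thesis using fun_cong[OF xy(3), of i] by (simp only: lift_apply rep_inject)
    next
      case False
      then show ?thesis using xy(1,2) unfolding pts_def by simp
    qed
  qed
qed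

lemma lift_image: "lift n ` pts {1..n} = affine_space L n"
proof
  show "lift n ` pts {1..n} \<subseteq> affine_space L n" by (auto simp: lift_def affine_space_def)
  show "affine_space L n \<subseteq> lift n ` pts {1..n}"
  proof
    fix x assume x: "x \<in> affine_space L n"
    have "\<exists>a. x i = rep a" if "i \<in> {1..n}" for i
    proof -
      have "x i \<in> carrier L" using x that unfolding affine_space_def by (rule PiE_mem)
      then show ?thesis by (rule rep_surj)
    qed
    then have "\<forall>i\<in>{1..n}. \<exists>a. x i = rep a" by blast
    from bchoice[OF this] obtain a where a: "\<forall>i\<in>{1..n}. x i = rep (a i)" by (rule exE)
    define y where "y i = (if i \<in> {1..n} then a i else 0)" for i
    have "x i = lift n y i" for i
    proof (cases "i \<in> {1..n}")
      case True
      then show ?thesis using a by (simp add: lift_def y_def)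
    next
      case False
      then have "x i = undefined" using x unfolding affine_space_def by (blast intro: PiE_arb)
      then show ?thesis using False by (simp only: lift_def restrict_def if_False)
    qed
    then have "x = lift n y" by (rule ext)
    moreover have "y \<in> pts {1..n}" by (simp add: pts_def y_def)
    ultimately show "x \<in> lift n ` pts {1..n}" by (rule image_eqI)
  qed
qed

lemma polys_eq: "P \<in> polys L n \<Longrightarrow> \<exists>f. vars_in {1..n} f \<and> P = (\<lambda>m. rep (coef f m))"
proof -
  assume P: "P \<in> polys L n"
  then have fin: "finite {m. P m \<noteq> \<zero>}" and car: "\<forall>m. P m \<in> carrier L"
    and vars: "\<forall>m. P m \<noteq> \<zero> \<longrightarrow> set_mset m \<subseteq> {1..n}" unfolding polys_iff[OF ring_axioms] by blast+
  have "\<forall>m. \<exists>a. P m = rep a" using car rep_surj by blast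
  from choice[OF this] obtain g where g: "\<forall>m. P m = rep (g m)" by (rule exE)
  have "finite {m. g m \<noteq> 0}" using fin g by simp
  then have coef: "coef (Abs_poly_mapping g) = g" by (rule lookup_Abs_poly_mapping)
  show ?thesis
  proof (intro exI conjI)
    show "vars_in {1..n} (Abs_poly_mapping g)"
      unfolding vars_in_def
    proof
      fix m assume "m \<in> supp (Abs_poly_mapping g)"
      then have "P m \<noteq> \<zero>" using g by (simp add: in_keys_iff coef)
      then show "set_mset m \<subseteq> {1..n}" using vars by blast
    qed
    show "P = (\<lambda>m. rep (coef (Abs_poly_mapping g) m))" using g by (simp add: coef fun_eq_iff)
  qed
qed

lemma poly_value_lift: "vars_in {1..n} f \<Longrightarrow> poly_value L (\<lambda>m. rep (coef f m)) (lift n y) = rep (ev y f)"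
  by (rule poly_value_rep[where V = "{1..n}"], assumption, rule lift_apply)

lemma zero_locus_lift:
  assumes "\<And>f. f \<in> T \<Longrightarrow> vars_in {1..n} f"
  shows "zero_locus L n ((\<lambda>f m. rep (coef f m)) ` T) = lift n ` zeros {1..n} T"
proof -
  have "zero_locus L n ((\<lambda>f m. rep (coef f m)) ` T)
      = {x \<in> lift n ` pts {1..n}. \<forall>f\<in>T. poly_value L (\<lambda>m. rep (coef f m)) x = \<zero>}"
    unfolding zero_locus_def lift_image by simp
  also have "\<dots> = lift n ` {y \<in> pts {1..n}. \<forall>f\<in>T. poly_value L (\<lambda>m. rep (coef f m)) (lift n y) = \<zero>}"
    by blast
  also have "{y \<in> pts {1..n}. \<forall>f\<in>T. poly_value L (\<lambda>m. rep (coef f m)) (lift n y) = \<zero>} = zeros {1..n} T"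
    unfolding zeros_def using assms poly_value_lift by auto
  finally show ?thesis .
qed

lemma zariski_closed_iff: "zariski_closed L n Z \<longleftrightarrow> (\<exists>Z'. zclosed {1..n} Z' \<and> Z = lift n ` Z')"
proof
  assume "zariski_closed L n Z"
  then obtain S where S: "S \<subseteq> polys L n" "Z = zero_locus L n S" unfolding zariski_closed_def by (elim exE conjE)
  define T where "T = {f. vars_in {1..n} f \<and> (\<lambda>m. rep (coef f m)) \<in> S}"
  have "S = (\<lambda>f m. rep (coef f m)) ` T" unfolding T_def using S(1) polys_eq by blast
  then have "Z = lift n ` zeros {1..n} T" using zero_locus_lift[of T n] S(2) by (simp add: T_def)
  then show "\<exists>Z'. zclosed {1..n} Z' \<and> Z = lift n ` Z'" unfolding zclosed_def by blast
next
  assume "\<exists>Z'. zclosed {1..n} Z' \<and> Z = lift n ` Z'"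
  then obtain T where T: "Z = lift n ` zeros {1..n} T" unfolding zclosed_def by blast
  have "zeros {1..n} T = zeros {1..n} (vres {1..n} ` T)" unfolding zeros_def by (auto simp: ev_vres)
  then have "Z = zero_locus L n ((\<lambda>f m. rep (coef f m)) ` vres {1..n} ` T)"
    using zero_locus_lift[of "vres {1..n} ` T" n] vars_in_vres T by auto
  moreover have "(\<lambda>f m. rep (coef f m)) ` vres {1..n} ` T \<subseteq> polys L n"
    using rep_in_polys vars_in_vres by blast
  ultimately show "zariski_closed L n Z" unfolding zariski_closed_def by blast
qed

lemma lift_image_eq_iff: "A \<subseteq> pts {1..n} \<Longrightarrow> B \<subseteq> pts {1..n} \<Longrightarrow> lift n ` A = lift n ` B \<longleftrightarrow> A = B"
  by (rule inj_on_image_eq_iff[OF lift_inj])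

lemma irreducible_closed_iff:
  "irreducible_closed L n Z \<longleftrightarrow> (\<exists>Y. irred {1..n} Y \<and> Z = lift n ` Y)"
proof -
  have pts: "Y \<subseteq> pts {1..n}" if "zclosed {1..n} Y" for Y :: "(nat \<Rightarrow> 'a) set"
    using that by (auto simp: zclosed_def zeros_def)
  show ?thesis
  proof
    assume Z: "irreducible_closed L n Z"
    then have "zariski_closed L n Z" by (simp add: irreducible_closed_def)
    then obtain Y where Y: "zclosed {1..n} Y" "Z = lift n ` Y" unfolding zariski_closed_iff by (elim exE conjE)
    have "irred {1..n} Y"
      unfolding irred_def
    proof (intro conjI allI impI)
      show "Y \<noteq> {}" using Z Y(2) by (auto simp: irreducible_closed_def)
      fix A B assume AB: "zclosed {1..n} A \<and> zclosed {1..n} B \<and> Y = A \<union> B"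
      then have "Z = lift n ` A \<union> lift n ` B" using Y(2) by blast
      moreover have "zariski_closed L n (lift n ` A)" "zariski_closed L n (lift n ` B)"
        using AB unfolding zariski_closed_iff by blast+
      ultimately have "Z = lift n ` A \<or> Z = lift n ` B" using Z unfolding irreducible_closed_def by blast
      then show "Y = A \<or> Y = B" unfolding Y(2) using lift_image_eq_iff pts Y(1) AB by metis
    qed (rule Y(1))
    then show "\<exists>Y. irred {1..n} Y \<and> Z = lift n ` Y" using Y(2) by blast
  next
    assume "\<exists>Y. irred {1..n} Y \<and> Z = lift n ` Y"
    then obtain Y where Y: "irred {1..n} Y" "Z = lift n ` Y" by (elim exE conjE)
    have Yc: "zclosed {1..n} Y" using Y(1) by (simp add: irred_def)
    show "irreducible_closed L n Z"
      unfolding irreducible_closed_def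
    proof (intro conjI allI impI)
      show "zariski_closed L n Z" unfolding zariski_closed_iff using Yc Y(2) by blast
      show "Z \<noteq> {}" using Y by (auto simp: irred_def)
      fix A B assume "zariski_closed L n A \<and> zariski_closed L n B \<and> Z = A \<union> B"
      then obtain A' B' where AB: "zclosed {1..n} A'" "A = lift n ` A'" "zclosed {1..n} B'" "B = lift n ` B'"
        and eq: "Z = A \<union> B" unfolding zariski_closed_iff by blast
      have "lift n ` Y = lift n ` (A' \<union> B')" using eq Y(2) AB by blast
      then have "Y = A' \<union> B'" using lift_image_eq_iff[of Y n "A' \<union> B'"] pts[OF Yc] pts[OF AB(1)] pts[OF AB(3)] by simp
      then have "Y = A' \<or> Y = B'" using Y(1) AB unfolding irred_def by blast
      then show "Z = A \<or> Z = B" using Y(2) AB by blast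
    qed
  qed
qed

lemma chain_iff:
  assumes Z: "Z \<subseteq> pts {1..n}"
  shows "(\<exists>Y. (\<forall>i\<le>k. irreducible_closed L n (Y i) \<and> Y i \<subseteq> lift n ` Z) \<and> (\<forall>i<k. Y i \<subset> Y (Suc i)))
    \<longleftrightarrow> has_chain {1..n} k Z"
proof
  assume "\<exists>Y. (\<forall>i\<le>k. irreducible_closed L n (Y i) \<and> Y i \<subseteq> lift n ` Z) \<and> (\<forall>i<k. Y i \<subset> Y (Suc i))"
  then obtain Y where Y: "\<forall>i\<le>k. irreducible_closed L n (Y i) \<and> Y i \<subseteq> lift n ` Z" "\<forall>i<k. Y i \<subset> Y (Suc i)"
    by (elim exE conjE)
  have "\<forall>i\<in>{..k}. \<exists>T. irred {1..n} T \<and> Y i = lift n ` T" using Y(1) irreducible_closed_iff by blast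
  from bchoice[OF this] obtain T where T: "\<forall>i\<in>{..k}. irred {1..n} (T i) \<and> Y i = lift n ` T i" by (rule exE)
  have pts: "T i \<subseteq> pts {1..n}" if "i \<le> k" for i using T that irred_pts by blast
  have "T i \<subset> T (Suc i)" if i: "i < k" for i
  proof -
    have "lift n ` T i \<subset> lift n ` T (Suc i)" using Y(2) T i by (metis Suc_leI atMost_iff less_imp_le)
    then show ?thesis using pts[of i] pts[of "Suc i"] i
      by (metis Suc_leI inj_on_image_subset_iff[OF lift_inj] less_imp_le psubset_eq)
  qed
  moreover have "T k \<subseteq> Z"
  proof -
    have "lift n ` T k \<subseteq> lift n ` Z" using Y(1) T by auto
    then show ?thesis using inj_on_image_subset_iff[OF lift_inj pts[of k] Z] by simp
  qed
  ultimately show "has_chain {1..n} k Z" unfolding has_chain_def irr_chain_def using T by (intro exI[of _ T]) auto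
next
  assume "has_chain {1..n} k Z"
  then obtain T where T: "\<forall>i\<le>k. irred {1..n} (T i)" "\<forall>i<k. T i \<subset> T (Suc i)" "T k \<subseteq> Z"
    unfolding has_chain_def irr_chain_def by (elim exE conjE)
  have sub: "T i \<subseteq> Z" if "i \<le> k" for i
    using that T(3)
  proof (induction rule: inc_induct)
    case (step m)
    then show ?case using T(2) by blast
  qed simp
  have pts: "T i \<subseteq> pts {1..n}" if "i \<le> k" for i using sub[OF that] Z by blast
  show "\<exists>Y. (\<forall>i\<le>k. irreducible_closed L n (Y i) \<and> Y i \<subseteq> lift n ` Z) \<and> (\<forall>i<k. Y i \<subset> Y (Suc i))"
  proof (intro exI[of _ "\<lambda>i. lift n ` T i"] conjI allI impI)
    fix i assume i: "i \<le> k"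
    show "irreducible_closed L n (lift n ` T i)" using T(1) i irreducible_closed_iff by blast
    show "lift n ` T i \<subseteq> lift n ` Z" using sub[OF i] by blast
  next
    fix i assume i: "i < k"
    then have "T i \<subset> T (Suc i)" using T(2) by blast
    moreover have "T i \<subseteq> pts {1..n}" "T (Suc i) \<subseteq> pts {1..n}" using pts i by simp_all
    ultimately show "lift n ` T i \<subset> lift n ` T (Suc i)"
      using lift_image_eq_iff[of "T i" n "T (Suc i)"] by blast
  qed
qed

lemma dimension_lift:
  assumes "Z \<subseteq> pts {1..n}" "Z \<noteq> {}"
  shows "Defs.dimension L n (lift n ` Z) = (SUP k \<in> {k. has_chain {1..n} k Z}. ereal (real k))"
  unfolding Defs.dimension_def chain_iff[OF assms(1)] using assms(2) by simp

end

lemma has_chain_le: "has_chain V k Z \<Longrightarrow> j \<le> k \<Longrightarrow> has_chain V j Z"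
proof -
  assume "has_chain V k Z" and j: "j \<le> k"
  then obtain Y where Y: "\<forall>i\<le>k. irred V (Y i)" "\<forall>i<k. Y i \<subset> Y (Suc i)" "Y k \<subseteq> Z"
    unfolding has_chain_def irr_chain_def by (elim exE conjE)
  have "Y j \<subseteq> Z"
    using j Y(3)
  proof (induction rule: inc_induct)
    case (step m)
    then show ?case using Y(2) by blast
  qed simp
  then show ?thesis unfolding has_chain_def irr_chain_def using Y(1,2) j by (intro exI[of _ Y]) auto
qed

lemma has_chain_0_of_nonempty: "Z \<subseteq> pts V \<Longrightarrow> Z \<noteq> {} \<Longrightarrow> has_chain V 0 (Z :: (nat \<Rightarrow> 'a::field) set)"
  unfolding has_chain_0_iff using irred_singleton by blast

context field_rep
begin

lemma dimension_ge_iff: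
  assumes Z: "Z \<subseteq> pts {1..n}"
  shows "Defs.dimension L n (lift n ` Z) \<ge> ereal (real j) \<longleftrightarrow> has_chain {1..n} j Z"
proof (cases "Z = {}")
  case True
  have "\<not> has_chain {1..n} j ({} :: (nat \<Rightarrow> 'a) set)"
    by (auto simp: has_chain_def irr_chain_def irred_def)
  then show ?thesis using True by (simp add: Defs.dimension_def one_ereal_def)
next
  case False
  show ?thesis
  proof
    assume "has_chain {1..n} j Z"
    then show "Defs.dimension L n (lift n ` Z) \<ge> ereal (real j)"
      unfolding dimension_lift[OF Z False] by (intro SUP_upper) simp
  next
    assume ge: "Defs.dimension L n (lift n ` Z) \<ge> ereal (real j)"
    show "has_chain {1..n} j Z"
    proof (rule ccontr)
      assume no: "\<not> has_chain {1..n} j Z"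
      \<comment> \<open>A nonempty set has a chain of length 0. For positive \<open>j\<close>,
        chains can be shortened, so without one of length \<open>j\<close> all lengths are at most
        \<open>j - 1\<close>.\<close>
      have j: "j \<noteq> 0" using no has_chain_0_of_nonempty[OF Z False] by metis
      have "k \<le> j - 1" if "has_chain {1..n} k Z" for k
        using no has_chain_le[OF that, of j] j by linarith
      then have "Defs.dimension L n (lift n ` Z) \<le> ereal (real (j - 1))"
        unfolding dimension_lift[OF Z False] by (intro SUP_least) simp
      with ge have "ereal (real j) \<le> ereal (real (j - 1))" by (rule order_trans)
      then show False using j by simp
    qed
  qed
qed

lemma codimension_lift_ge:
  assumes Z: "Z \<subseteq> pts {1..n}" and bound: "\<And>k. has_chain {1..n} k Z \<Longrightarrow> k + j \<le> n"
  shows "codimension L n (lift n ` Z) \<ge> ereal (real j)"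
proof (cases "Z = {}")
  case True
  then show ?thesis by (simp add: codimension_def)
next
  case False
  have "j \<le> n" using bound[OF has_chain_0_of_nonempty[OF Z False]] by simp
  have "Defs.dimension L n (lift n ` Z) \<le> ereal (real (n - j))"
    unfolding dimension_lift[OF Z False]
  proof (rule SUP_least)
    fix k assume "k \<in> {k. has_chain {1..n} k Z}"
    then have "k + j \<le> n" using bound by simp
    then show "ereal (real k) \<le> ereal (real (n - j))" by simp
  qed
  then have "ereal (real n) - ereal (real (n - j)) \<le> ereal (real n) - Defs.dimension L n (lift n ` Z)"
    by (rule ereal_minus_mono[OF order_refl])
  moreover have "ereal (real n) - ereal (real (n - j)) = ereal (real j)" using \<open>j \<le> n\<close> by (simp add: of_nat_diff)
  ultimately show ?thesis using False by (simp add: codimension_def)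
qed

end

section \<open>Reduction modulo a prime\<close>

lemma ring_rep_residue_ring: "q > 1 \<Longrightarrow> ring_rep (residue_ring (int q)) (\<lambda>z. z mod int q)"
proof -
  assume q: "q > 1"
  interpret residues "int q" "residue_ring (int q)" using q by unfold_locales simp_all
  show ?thesis
    using q by unfold_locales (simp_all add: residue_ring_def mod_simps)
qed

lemma zero_locus_residue_ring:
  assumes q: "q > 1" and F: "vars_in {1..n} F"
  shows "zero_locus (residue_ring (int q)) n {reduce_mod q (coef F)} = sols {1..n} q F"
proof -
  interpret ring_rep "residue_ring (int q)" "\<lambda>z. z mod int q" by (rule ring_rep_residue_ring[OF q])
  have carrier: "carrier (residue_ring (int q)) = {0..<int q}" by (auto simp: residue_ring_def)
  have zero: "\<zero>\<^bsub>residue_ring (int q)\<^esub> = 0" by (simp add: residue_ring_def)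
  have "poly_value (residue_ring (int q)) (reduce_mod q (coef F)) x = \<zero>\<^bsub>residue_ring (int q)\<^esub> \<longleftrightarrow> int q dvd iev x F"
    if x: "x \<in> grid {1..n} q" for x
  proof -
    have "x i = x i mod int q" if "i \<in> {1..n}" for i
    proof -
      have "x i \<in> {0..<int q}" using x that unfolding grid_def by (rule PiE_mem)
      then show ?thesis by simp
    qed
    from poly_value_rep[OF F this]
    have "poly_value (residue_ring (int q)) (reduce_mod q (coef F)) x = ev x F mod int q"
      by (simp add: reduce_mod_def)
    moreover have "iev x F = ev x F" by (simp add: hom_eval_def)
    ultimately show ?thesis unfolding zero by (simp only: dvd_eq_mod_eq_0)
  qed
  then show ?thesis unfolding zero_locus_def sols_def affine_space_def grid_def carrier by blast
qed

lemma exp_sum_eq_psum: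
  assumes "q > 1" "vars_in {1..n} F"
  shows "exp_sum n (coef F) h q = psum {1..n} q F h"
  unfolding exp_sum_def psum_def zero_locus_residue_ring[OF assms] chr_def by simp

text \<open>If \<open>F\<close> became zero in the field, so would its derivatives, and smoothness
  would fail at the first unit vector.\<close>

lemma imap_ne_0_of_smooth:
  fixes F :: "int mpoly"
  assumes n: "n \<ge> 1"
    and smooth: "\<And>y :: nat \<Rightarrow> 'a::field. y \<in> pts {1..n} \<Longrightarrow> y \<noteq> (\<lambda>i. 0) \<Longrightarrow> iev y F = 0 \<Longrightarrow>
      \<exists>i\<in>{1..n}. iev y (pd i F) \<noteq> 0"
  shows "(imap F :: 'a mpoly) \<noteq> 0"
proof
  assume z: "(imap F :: 'a mpoly) = 0"
  have c: "of_int (coef F m) = (0 :: 'a)" for m using z coef_imap[of F m, where 'a = 'a] by simp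
  define y :: "nat \<Rightarrow> 'a" where "y i = (if i = 1 then 1 else 0)" for i
  have "y \<in> pts {1..n}" using n by (auto simp: y_def pts_def)
  moreover have "y \<noteq> (\<lambda>i. 0)" by (auto simp: y_def fun_eq_iff)
  moreover have "iev y F = 0" by (simp add: ev_imap[symmetric] z)
  ultimately obtain i where "iev y (pd i F) \<noteq> 0" using smooth by blast
  moreover have "(imap (pd i F) :: 'a mpoly) = 0" by (rule poly_mapping_eqI) (simp add: coef_imap coef_pd c)
  then have "iev y (pd i F) = 0" by (simp add: ev_imap[symmetric])
  ultimately show False by simp
qed

text \<open>The last assumption makes the embedding of the prime field into its closure agree with
  \<open>of_int\<close>; so reducing an integral polynomial and then extending scalars amounts to
  \<open>imap\<close>.\<close>

locale closure_rep = field_rep "F_p_closure p" rep for p :: nat and rep :: "'a::alg_closed_field \<Rightarrow> F_p_bar" +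
  assumes prime_p: "prime p" and char: "CHAR('a) = p"
    and const: "ring.indexed_const (F_p p) (z mod int p) = rep (of_int z)"
begin

abbreviation L :: "F_p_bar ring" where "L \<equiv> F_p_closure p"

lemma extend_reduce: "extend_scalars (F_p p) (reduce_mod p (coef P)) = (\<lambda>m. rep (coef (imap P) m))"
  by (simp only: extend_scalars_def reduce_mod_def const coef_imap)

lemma reduce_point_eq: "reduce_point n p h = lift n (pt_of_int {1..n} h)"
  unfolding reduce_point_def lift_def by (rule restrict_ext) (simp add: const pt_of_int_def)

lemma partial_imap: "partial L i (\<lambda>m. rep (coef (imap F) m)) = (\<lambda>m. rep (coef (imap (pd i F)) m))"
proof -
  have "pd i (imap F) = (imap (pd i F) :: 'a mpoly)" by (rule poly_mapping_eqI) (simp add: coef_pd coef_imap)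
  then show ?thesis by (simp only: partial_rep)
qed

context
  fixes n :: nat and F :: "int mpoly"
  assumes vars: "vars_in {1..n} F"
begin

lemma value_F: "poly_value L (\<lambda>m. rep (coef (imap F) m)) (lift n y) = rep (iev y F)"
  using poly_value_lift[OF vars_in_imap[OF vars]] by (simp only: ev_imap)

lemma value_pd_F: "poly_value L (\<lambda>m. rep (coef (imap (pd i F)) m)) (lift n y) = rep (iev y (pd i F))"
  using poly_value_lift[OF vars_in_imap[OF vars_in_pd[OF vars]]] by (simp only: ev_imap)

lemma W_lift: "W n p (coef F) (lift n h) = lift n ` wvar n F h"
proof -
  have zl: "zero_locus L n {\<lambda>m. rep (coef (imap F) m)} = lift n ` zeros {1..n} {imap F}"
    using zero_locus_lift[of "{imap F}" n] vars_in_imap[OF vars] by simp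
  have "W n p (coef F) (lift n h) = {y \<in> lift n ` zeros {1..n} {imap F}.
      \<forall>i\<in>{1..n}. \<forall>j\<in>{1..n}. i \<noteq> j \<longrightarrow>
        lift n h i \<otimes>\<^bsub>L\<^esub> poly_value L (\<lambda>m. rep (coef (imap (pd j F)) m)) y =
        lift n h j \<otimes>\<^bsub>L\<^esub> poly_value L (\<lambda>m. rep (coef (imap (pd i F)) m)) y}"
    unfolding W_def Let_def extend_reduce partial_imap zl ..
  also have "\<dots> = lift n ` {y \<in> zeros {1..n} {imap F}.
      \<forall>i\<in>{1..n}. \<forall>j\<in>{1..n}. i \<noteq> j \<longrightarrow>
        lift n h i \<otimes>\<^bsub>L\<^esub> poly_value L (\<lambda>m. rep (coef (imap (pd j F)) m)) (lift n y) =
        lift n h j \<otimes>\<^bsub>L\<^esub> poly_value L (\<lambda>m. rep (coef (imap (pd i F)) m)) (lift n y)}"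
    by blast
  also have "{y \<in> zeros {1..n} {imap F}.
      \<forall>i\<in>{1..n}. \<forall>j\<in>{1..n}. i \<noteq> j \<longrightarrow>
        lift n h i \<otimes>\<^bsub>L\<^esub> poly_value L (\<lambda>m. rep (coef (imap (pd j F)) m)) (lift n y) =
        lift n h j \<otimes>\<^bsub>L\<^esub> poly_value L (\<lambda>m. rep (coef (imap (pd i F)) m)) (lift n y)} = wvar n F h"
    unfolding value_pd_F wvar_def zeros_def
    by (rule Collect_cong) (auto simp: ev_imap lift_apply rep_mult[symmetric] simp del: One_nat_def)
  finally show ?thesis .
qed

lemma G_lift: "G n p (coef F) j = lift n ` {h \<in> pts {1..n}. has_chain {1..n} j (wvar n F h)}"
proof -
  have sub: "wvar n F h \<subseteq> pts {1..n}" for h :: "nat \<Rightarrow> 'a" by (auto simp: wvar_def)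
  have "G n p (coef F) j = {h \<in> lift n ` pts {1..n}. Defs.dimension L n (W n p (coef F) h) \<ge> ereal (real j)}"
    unfolding G_def lift_image ..
  also have "\<dots> = lift n ` {h \<in> pts {1..n}. Defs.dimension L n (W n p (coef F) (lift n h)) \<ge> ereal (real j)}"
    by blast
  finally show ?thesis unfolding W_lift dimension_ge_iff[OF sub] .
qed

lemma smooth:
  fixes y :: "nat \<Rightarrow> 'a"
  assumes ns: "nonsingular (F_p p) n (reduce_mod p (coef F))"
    and y: "y \<in> pts {1..n}" "y \<noteq> (\<lambda>i. 0)" "iev y F = 0"
  shows "\<exists>i\<in>{1..n}. iev y (pd i F) \<noteq> 0"
proof -
  have "lift n y \<in> affine_space L n" using lift_image y(1) by blast
  then have "lift n y \<in> zero_locus L n {\<lambda>m. rep (coef (imap F) m)}"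
    by (simp add: zero_locus_def value_F y(3))
  moreover have "\<exists>i\<in>{1..n}. lift n y i \<noteq> \<zero>\<^bsub>L\<^esub>"
  proof -
    obtain i where i: "y i \<noteq> 0" using y(2) by auto
    then have "i \<in> {1..n}" using y(1) unfolding pts_def by blast
    then show ?thesis using i by (intro bexI[of _ i]) (simp_all only: lift_apply rep_eq_zero not_False_eq_True)
  qed
  ultimately obtain i where "i \<in> {1..n}"
    "poly_value L (\<lambda>m. rep (coef (imap (pd i F)) m)) (lift n y) \<noteq> \<zero>\<^bsub>L\<^esub>"
    using ns unfolding nonsingular_def Let_def extend_reduce partial_imap by blast
  then show ?thesis unfolding value_pd_F by (intro bexI[of _ i]) simp_all
qed

end

context
  fixes n d :: nat and F :: "int mpoly"
  assumes n: "n \<ge> 2" and F: "homog d F" "vars_in {1..n} F"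
    and ns: "nonsingular (F_p p) n (reduce_mod p (coef F))"
begin

lemma imap_ne_0: "(imap F :: 'a mpoly) \<noteq> 0"
proof (rule imap_ne_0_of_smooth)
  show "1 \<le> n" using n by simp
qed (rule smooth[OF F(2) ns])

lemma G_eq_zeros: "G n p (coef F) j = lift n ` zeros {1..n} (imap ` (\<Union>t. rank_polys n d F j t))"
proof -
  have "{h \<in> pts {1..n}. has_chain {1..n} j (wvar n F (h :: nat \<Rightarrow> 'a))}
      = zeros {1..n} (imap ` (\<Union>t. rank_polys n d F j t))"
    unfolding zeros_def has_chain_wvar_iff[OF F] by (rule Collect_cong) (auto simp: ev_imap)
  then show ?thesis by (simp only: G_lift[OF F(2)])
qed

text \<open>The rank polynomials are integral; their reductions modulo \<open>p\<close> are
  equations over the prime field.\<close>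

lemma variety_over_G: "variety_over (F_p p) n (G n p (coef F) j)"
proof -
  let ?T = "\<Union>t. rank_polys n d F j t"
  let ?S = "(\<lambda>P. reduce_mod p (coef P)) ` ?T"
  have vars: "vars_in {1..n} P" if "P \<in> ?T" for P using that vars_in_rank_polys[OF F] by blast
  interpret R: ring_rep "F_p p" "\<lambda>z. z mod int p" by (rule ring_rep_residue_ring[OF prime_gt_1_nat[OF prime_p]])
  have S: "?S \<subseteq> polys (F_p p) n" using R.rep_in_polys[OF vars] by (auto simp: reduce_mod_def)
  have "extend_scalars (F_p p) ` ?S = (\<lambda>f m. rep (coef f m)) ` imap ` ?T"
    by (simp only: image_image extend_reduce)
  moreover have "vars_in {1..n} f" if "f \<in> imap ` ?T" for f :: "'a mpoly" using that vars vars_in_imap by blast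
  ultimately have "G n p (coef F) j = zero_locus L n (extend_scalars (F_p p) ` ?S)"
    using zero_locus_lift[of "imap ` ?T" n] by (simp only: G_eq_zeros)
  with S show ?thesis unfolding variety_over_def by blast
qed

text \<open>For \<open>d \<ge> 2\<close> the form and its derivatives vanish at the origin, which
  thus lies in every fibre.\<close>

lemma G_0: "d \<ge> 2 \<Longrightarrow> G n p (coef F) 0 = affine_space L n"
proof -
  assume d: "d \<ge> 2"
  have "has_chain {1..n} 0 (wvar n F h)" if "h \<in> pts {1..n}" for h :: "nat \<Rightarrow> 'a"
  proof (rule has_chain_0_of_nonempty)
    show "wvar n F h \<subseteq> pts {1..n}" by (auto simp: wvar_def)
    have z: "iev (\<lambda>i. 0) f = (0 :: 'a)" if "homog e f" "e > 0" for e f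
      using iev_scale_homog[OF that(1), of 0 "\<lambda>i. 0 :: 'a"] that(2) by (simp add: zero_power)
    have "iev (\<lambda>i. 0) F = (0 :: 'a)" using z[OF F(1)] d by simp
    moreover have "iev (\<lambda>i. 0) (pd i F) = (0 :: 'a)" for i using z[OF homog_pd[OF F(1)]] d by simp
    ultimately have "(\<lambda>i. 0) \<in> wvar n F h" by (simp add: wvar_def pts_def)
    then show "wvar n F h \<noteq> {}" by blast
  qed
  then have "{h \<in> pts {1..n}. has_chain {1..n} 0 (wvar n F (h :: nat \<Rightarrow> 'a))} = pts {1..n}" by blast
  then show ?thesis by (simp only: G_lift[OF F(2)] lift_image)
qed

lemma G_antimono: "G n p (coef F) (Suc j) \<subseteq> G n p (coef F) j"
  unfolding G_lift[OF F(2)] using has_chain_le[of "{1..n}" "Suc j" _ j] by auto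

lemma codimension_G: "codimension L n (G n p (coef F) j) \<ge> ereal (real j)"
  unfolding G_lift[OF F(2)]
proof (rule codimension_lift_ge)
  fix k assume "has_chain {1..n} k {h \<in> pts {1..n}. has_chain {1..n} j (wvar n F (h :: nat \<Rightarrow> 'a))}"
  then obtain Y where Y: "irr_chain {1..n} k Y"
    "Y k \<subseteq> {h \<in> pts {1..n}. has_chain {1..n} j (wvar n F (h :: nat \<Rightarrow> 'a))}"
    unfolding has_chain_def[of _ k] by (elim exE conjE)
  show "k + j \<le> n"
  proof (cases j)
    \<comment> \<open>\<open>fibre_codimension\<close> concerns fibres of positive dimension; here
      the length of chains in affine space is all that is at stake.\<close>
    case 0
    then show ?thesis using irr_chain_length_le[OF _ Y(1)] by simp
  next
    case (Suc j')
    show ?thesis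
      unfolding Suc
    proof (rule fibre_codimension[OF F imap_ne_0])
      show "\<exists>i\<in>{1..n}. iev y (pd i F) \<noteq> 0"
        if y: "y \<in> pts {1..n}" "y \<noteq> (\<lambda>i. 0)" "iev y F = 0" for y :: "nat \<Rightarrow> 'a"
        by (rule smooth[OF F(2) ns y])
      show "has_chain {1..n} (Suc j') (wvar n F h)" if "h \<in> Y k" for h using Y(2) that Suc by blast
    qed (rule Y(1))
  qed
qed blast

lemma exp_sum_bound:
  assumes "t \<le> T" "P \<in> rank_polys n d F j t" "\<not> int p dvd iev h P"
  shows "norm (exp_sum n (coef F) h (p\<^sup>2)) \<le> real (2 ^ n * (T + 1) ^ n * (n + 1) ^ j + 1) * real p ^ (n + j - 2)"
proof -
  have "p * p > 1" using prime_gt_1_nat[OF prime_p] by (metis less_1_mult)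
  then have "exp_sum n (coef F) h (p\<^sup>2) = psum {1..n} (p * p) F h"
    unfolding power2_eq_square using F(2) by (rule exp_sum_eq_psum)
  moreover have "norm (psum {1..n} (p * p) F h) \<le> real (2 ^ n * (T + 1) ^ n * (n + 1) ^ j + 1) * real p ^ (n + j - 2)"
  proof (rule norm_psum_le_of_rank[OF n prime_p char F imap_ne_0])
    show "\<exists>i\<in>{1..n}. iev y (pd i F) \<noteq> 0"
      if y: "y \<in> pts {1..n}" "y \<noteq> (\<lambda>i. 0)" "iev y F = 0" for y :: "nat \<Rightarrow> 'a"
      by (rule smooth[OF F(2) ns y])
  qed (rule assms)+
  ultimately show ?thesis by (simp only:)
qed

lemma reduce_point_mem_G:
  assumes "\<And>t P. P \<in> rank_polys n d F j t \<Longrightarrow> int p dvd iev h P"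
  shows "reduce_point n p h \<in> G n p (coef F) j"
proof -
  have "iev (pt_of_int {1..n} h) P = (0 :: 'a)" if "P \<in> rank_polys n d F j t" for t P
  proof -
    have "(of_int (iev h P) :: 'a) = 0" using assms[OF that] char by (simp only: of_int_eq_0_iff_char_dvd)
    then show ?thesis by (simp only: iev_pt_of_int[OF vars_in_rank_polys[OF F that]])
  qed
  then have "pt_of_int {1..n} h \<in> zeros {1..n} (imap ` (\<Union>t. rank_polys n d F j t) :: 'a mpoly set)"
    by (auto simp: zeros_def ev_imap)
  then show ?thesis unfolding reduce_point_eq G_eq_zeros by (rule imageI)
qed

text \<open>Affine \<open>n\<close>-space has no chain of length \<open>n + 1\<close>. This reduces
  the bounds for all \<open>j\<close> to finitely many constants.\<close>

lemma reduce_point_notin_G: "reduce_point n p h \<notin> G n p (coef F) (Suc n)"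
proof
  assume "reduce_point n p h \<in> G n p (coef F) (Suc n)"
  then obtain h' :: "nat \<Rightarrow> 'a" where "has_chain {1..n} (Suc n) (wvar n F h')" unfolding G_lift[OF F(2)] by blast
  then obtain Y :: "nat \<Rightarrow> (nat \<Rightarrow> 'a) set" where "irr_chain {1..n} (Suc n) Y" unfolding has_chain_def by blast
  from irr_chain_length_le[OF _ this] show False by simp
qed

end

end

section \<open>From a single prime to all primes\<close>

text \<open>All that is used about \<open>p\<close>, phrased without any type for the algebraic
  closure, so that the statement can be quantified over primes.\<close>

definition good_prime :: "nat \<Rightarrow> bool"
  where "good_prime p \<longleftrightarrow> (\<forall>n d F. n \<ge> 2 \<longrightarrow> homog d F \<longrightarrow> vars_in {1..n} F \<longrightarrow>
    nonsingular (F_p p) n (reduce_mod p (coef F)) \<longrightarrow>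
      (\<forall>j. variety_over (F_p p) n (G n p (coef F) j)) \<and>
      (d \<ge> 2 \<longrightarrow> G n p (coef F) 0 = affine_space (F_p_closure p) n) \<and>
      (\<forall>j. G n p (coef F) (Suc j) \<subseteq> G n p (coef F) j) \<and>
      (\<forall>j. codimension (F_p_closure p) n (G n p (coef F) j) \<ge> ereal (real j)) \<and>
      (\<forall>j t T P h. t \<le> T \<longrightarrow> P \<in> rank_polys n d F j t \<longrightarrow> \<not> int p dvd iev h P \<longrightarrow>
        norm (exp_sum n (coef F) h (p\<^sup>2)) \<le> real (2 ^ n * (T + 1) ^ n * (n + 1) ^ j + 1) * real p ^ (n + j - 2)) \<and>
      (\<forall>j h. (\<forall>t. \<forall>P\<in>rank_polys n d F j t. int p dvd iev h P) \<longrightarrow> reduce_point n p h \<in> G n p (coef F) j) \<and>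
      (\<forall>h. reduce_point n p h \<notin> G n p (coef F) (Suc n)))"

lemma (in closure_rep) good_prime: "good_prime p"
  unfolding good_prime_def
proof (intro allI impI, intro conjI allI impI)
  fix n d j :: nat and F :: "int mpoly" and h :: "nat \<Rightarrow> int"
  assume *: "n \<ge> 2" "homog d F" "vars_in {1..n} F" "nonsingular (F_p p) n (reduce_mod p (coef F))"
  show "variety_over (F_p p) n (G n p (coef F) j)" by (rule variety_over_G[OF *])
  show "G n p (coef F) 0 = affine_space (F_p_closure p) n" if "d \<ge> 2" by (rule G_0[OF * that])
  show "G n p (coef F) (Suc j) \<subseteq> G n p (coef F) j" by (rule G_antimono[OF *])
  show "codimension (F_p_closure p) n (G n p (coef F) j) \<ge> ereal (real j)" by (rule codimension_G[OF *])
  show "norm (exp_sum n (coef F) h (p\<^sup>2)) \<le> real (2 ^ n * (T + 1) ^ n * (n + 1) ^ j + 1) * real p ^ (n + j - 2)"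
    if "t \<le> T" "P \<in> rank_polys n d F j t" "\<not> int p dvd iev h P" for t T P
    by (rule exp_sum_bound[OF * that])
  show "reduce_point n p h \<in> G n p (coef F) j" if all: "\<forall>t. \<forall>P\<in>rank_polys n d F j t. int p dvd iev h P"
  proof (rule reduce_point_mem_G[OF *])
    show "int p dvd iev h P" if "P \<in> rank_polys n d F j t" for t P using all that by blast
  qed
  show "reduce_point n p h \<notin> G n p (coef F) (Suc n)" by (rule reduce_point_notin_G[OF *])
qed

lemma good_primeD:
  assumes "good_prime p" "n \<ge> 2" "homog d F" "vars_in {1..n} F" "nonsingular (F_p p) n (reduce_mod p (coef F))"
  shows "variety_over (F_p p) n (G n p (coef F) j)"
    and "d \<ge> 2 \<Longrightarrow> G n p (coef F) 0 = affine_space (F_p_closure p) n"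
    and "G n p (coef F) (Suc j) \<subseteq> G n p (coef F) j"
    and "codimension (F_p_closure p) n (G n p (coef F) j) \<ge> ereal (real j)"
    and "t \<le> T \<Longrightarrow> P \<in> rank_polys n d F j t \<Longrightarrow> \<not> int p dvd iev h P \<Longrightarrow>
      norm (exp_sum n (coef F) h (p\<^sup>2)) \<le> real (2 ^ n * (T + 1) ^ n * (n + 1) ^ j + 1) * real p ^ (n + j - 2)"
    and "\<forall>t. \<forall>P\<in>rank_polys n d F j t. int p dvd iev h P \<Longrightarrow> reduce_point n p h \<in> G n p (coef F) j"
    and "reduce_point n p h \<notin> G n p (coef F) (Suc n)"
proof -
  note c = assms(1)[unfolded good_prime_def, THEN spec[of _ n], THEN spec[of _ d], THEN spec[of _ F],
      THEN mp[OF _ assms(2)], THEN mp[OF _ assms(3)], THEN mp[OF _ assms(4)], THEN mp[OF _ assms(5)]]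
  note c1 = c[THEN conjunct1] and r1 = c[THEN conjunct2]
  note c2 = r1[THEN conjunct1] and r2 = r1[THEN conjunct2]
  note c3 = r2[THEN conjunct1] and r3 = r2[THEN conjunct2]
  note c4 = r3[THEN conjunct1] and r4 = r3[THEN conjunct2]
  note c5 = r4[THEN conjunct1] and r5 = r4[THEN conjunct2]
  note c6 = r5[THEN conjunct1] and c7 = r5[THEN conjunct2]
  show "variety_over (F_p p) n (G n p (coef F) j)" by (rule spec[OF c1])
  show "d \<ge> 2 \<Longrightarrow> G n p (coef F) 0 = affine_space (F_p_closure p) n" by (rule mp[OF c2])
  show "G n p (coef F) (Suc j) \<subseteq> G n p (coef F) j" by (rule spec[OF c3])
  show "codimension (F_p_closure p) n (G n p (coef F) j) \<ge> ereal (real j)" by (rule spec[OF c4])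
  show "norm (exp_sum n (coef F) h (p\<^sup>2)) \<le> real (2 ^ n * (T + 1) ^ n * (n + 1) ^ j + 1) * real p ^ (n + j - 2)"
    if "t \<le> T" "P \<in> rank_polys n d F j t" "\<not> int p dvd iev h P"
    by (rule c5[rule_format, OF that])
  show "reduce_point n p h \<in> G n p (coef F) j" if "\<forall>t. \<forall>P\<in>rank_polys n d F j t. int p dvd iev h P"
    by (rule mp[OF spec[OF spec[OF c6]] that])
  show "reduce_point n p h \<notin> G n p (coef F) (Suc n)" by (rule spec[OF c7])
qed

text \<open>A type cannot depend on a prime. But to show \<^const>\<open>good_prime\<close> for all primes it suffices to treat a
  single one, a counterexample if there is any, and its algebraic closure can be made a type.\<close>

definition test_prime :: nat
  where "test_prime = (if \<exists>p. prime p \<and> \<not> good_prime p then SOME p. prime p \<and> \<not> good_prime p else 2)"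

lemma prime_test_prime: "prime test_prime"
  using someI_ex[of "\<lambda>p. prime p \<and> \<not> good_prime p"] by (auto simp: test_prime_def)

lemma good_prime_of_test_prime: "good_prime test_prime \<Longrightarrow> prime p \<Longrightarrow> good_prime p"
  using someI_ex[of "\<lambda>p. prime p \<and> \<not> good_prime p"] by (auto simp: test_prime_def split: if_splits)

section \<open>The algebraic closure of a prime field as a type\<close>

definition L0 :: "F_p_bar ring"
  where "L0 = F_p_closure test_prime"

lemma field_F_p: "prime p \<Longrightarrow> field (F_p p)"
proof -
  assume "prime p"
  then interpret residues_prime p "F_p p" by unfold_locales simp_all
  show ?thesis by (rule is_field)
qed

lemma algebraic_closure_L0:
  "algebraic_closure L0 (ring.indexed_const (F_p test_prime) ` carrier (F_p test_prime))"
  unfolding L0_def by (rule field.alg_closureE(1)[OF field_F_p[OF prime_test_prime]])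

lemma field_L0: "field L0"
proof -
  interpret algebraic_closure L0 "ring.indexed_const (F_p test_prime) ` carrier (F_p test_prime)"
    by (rule algebraic_closure_L0)
  show ?thesis by (rule field_axioms)
qed

typedef closure_type = "carrier L0"
proof -
  interpret field L0 by (rule field_L0)
  show ?thesis using zero_closed by blast
qed

setup_lifting type_definition_closure_type

instantiation closure_type :: field
begin

context
begin

interpretation field L0 by (rule field_L0)

lift_definition zero_closure_type :: closure_type is "\<zero>\<^bsub>L0\<^esub>" by simp
lift_definition one_closure_type :: closure_type is "\<one>\<^bsub>L0\<^esub>" by simp
lift_definition plus_closure_type :: "closure_type \<Rightarrow> closure_type \<Rightarrow> closure_type" is "(\<oplus>\<^bsub>L0\<^esub>)" by simp
lift_definition minus_closure_type :: "closure_type \<Rightarrow> closure_type \<Rightarrow> closure_type" is "a_minus L0" by simp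
lift_definition times_closure_type :: "closure_type \<Rightarrow> closure_type \<Rightarrow> closure_type" is "(\<otimes>\<^bsub>L0\<^esub>)" by simp
lift_definition uminus_closure_type :: "closure_type \<Rightarrow> closure_type" is "a_inv L0" by simp
lift_definition inverse_closure_type :: "closure_type \<Rightarrow> closure_type"
  is "\<lambda>x. if x = \<zero>\<^bsub>L0\<^esub> then \<zero>\<^bsub>L0\<^esub> else inv\<^bsub>L0\<^esub> x"
  by (auto simp: field_Units)
lift_definition divide_closure_type :: "closure_type \<Rightarrow> closure_type \<Rightarrow> closure_type"
  is "\<lambda>x y. if y = \<zero>\<^bsub>L0\<^esub> then \<zero>\<^bsub>L0\<^esub> else x \<otimes>\<^bsub>L0\<^esub> inv\<^bsub>L0\<^esub> y"
  by (auto simp: field_Units)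

end

instance
proof -
  interpret field L0 by (rule field_L0)
  show "OFCLASS(closure_type, field_class)"
  proof (standard, goal_cases)
    case 1 show ?case by transfer (rule m_assoc)
  next
    case 2 show ?case by transfer (rule m_comm)
  next
    case 3 show ?case by transfer (rule l_one)
  next
    case 4 show ?case by transfer (rule a_assoc)
  next
    case 5 show ?case by transfer (rule a_comm)
  next
    case 6 show ?case by transfer (rule l_zero)
  next
    case 7 show ?case by transfer (rule l_neg)
  next
    case 8 show ?case by transfer (rule minus_eq)
  next
    case 9 show ?case by transfer (rule l_distr)
  next
    case 10 show ?case by transfer (rule zero_not_one)
  next
    case 11 then show ?case by transfer (auto simp: field_Units)
  next
    case 12 show ?case by transfer (auto simp: field_Units)
  next
    case 13 show ?case by transfer auto
  qed
qed

end

abbreviation rep0 :: "closure_type \<Rightarrow> F_p_bar" where "rep0 \<equiv> Rep_closure_type"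

lemma field_rep_L0: "field_rep L0 rep0"
proof (intro field_rep.intro ring_rep.intro ring_rep_axioms.intro field_rep_axioms.intro)
  interpret field L0 by (rule field_L0)
  show "cring L0" by (rule cring_axioms)
  fix a b :: closure_type
  show "rep0 a \<in> carrier L0" by (rule Rep_closure_type)
  show "rep0 (a + b) = rep0 a \<oplus>\<^bsub>L0\<^esub> rep0 b" by (rule plus_closure_type.rep_eq)
  show "rep0 (a * b) = rep0 a \<otimes>\<^bsub>L0\<^esub> rep0 b" by (rule times_closure_type.rep_eq)
  show "rep0 1 = \<one>\<^bsub>L0\<^esub>" by (rule one_closure_type.rep_eq)
  show "bij_betw rep0 UNIV (carrier L0)"
    unfolding bij_betw_def using Rep_closure_type Rep_closure_type_inject
    by (auto simp: inj_on_def elim: Rep_closure_type_cases)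
qed

instance closure_type :: alg_closed_field
proof
  interpret L0: algebraic_closure L0 "ring.indexed_const (F_p test_prime) ` carrier (F_p test_prime)"
    by (rule algebraic_closure_L0)
  interpret L0: field_rep L0 rep0 by (rule field_rep_L0)
  fix f :: "closure_type poly" assume f: "Polynomial.lead_coeff f = 1" "Polynomial.degree f > 0"
  \<comment> \<open>Polynomials over the record are lists that begin with the leading coefficient,
    whence the reversal.\<close>
  define P where "P = rev (map rep0 (coeffs f))"
  have deg: "Polynomials.degree P = Polynomial.degree f"
    by (auto simp: P_def degree_eq_length_coeffs)
  have carrier_P: "P \<in> carrier (poly_ring L0)"
    by (auto simp: univ_poly_def polynomial_def P_def hd_map hd_rev last_map last_coeffs_eq_coeff_degree)
  then have "L0.splitted P" by (rule L0.roots_over_carrier)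
  then have "L0.roots P \<noteq> {#}"
    unfolding L0.splitted_def using deg f by auto
  then obtain x where "x \<in># L0.roots P" by blast
  then have x: "L0.is_root P x" using L0.roots_mem_iff_is_root[OF carrier_P] by auto
  then have "x \<in> carrier L0" by (auto simp: L0.is_root_def)
  then obtain y where y: "x = rep0 y" using L0.rep_surj by blast
  have "L0.eval (map rep0 xs) (rep0 y) = rep0 (poly (Poly (rev xs)) y)" for xs
    by (induction xs)
      (auto simp: L0.rep_zero L0.rep_add L0.rep_mult L0.rep_power Poly_append poly_monom L0.a_comm L0.m_comm)
  from this[of "rev (coeffs f)"] have "rep0 (poly f y) = L0.eval P x" by (simp add: P_def rev_map y)
  also have "\<dots> = \<zero>\<^bsub>L0\<^esub>" using x by (auto simp: L0.is_root_def)
  finally show "\<exists>x. poly f x = 0" by auto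
qed

text \<open>Through \<open>rep0\<close> the embedding becomes an additive map on the integers that
  sends 1 to 1, and \<open>of_int\<close> is the only such map.\<close>

lemma indexed_const_eq_rep: "ring.indexed_const (F_p test_prime) (z mod int test_prime) = rep0 (of_int z)"
proof -
  interpret K0: field "F_p test_prime" by (rule field_F_p[OF prime_test_prime])
  interpret L0: field_rep L0 rep0 by (rule field_rep_L0)
  have hom: "K0.indexed_const \<in> ring_hom (F_p test_prime) L0" unfolding L0_def by (rule K0.alg_closureE)
  interpret R: ring_rep "F_p test_prime" "\<lambda>z. z mod int test_prime"
    by (rule ring_rep_residue_ring[OF prime_gt_1_nat[OF prime_test_prime]])
  define g where "g z = (SOME a. K0.indexed_const (z mod int test_prime) = rep0 a)" for z
  have g: "K0.indexed_const (z mod int test_prime) = rep0 (g z)" for z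
    unfolding g_def
    by (rule someI_ex, rule L0.rep_surj, rule ring_hom_closed[OF hom], rule R.rep_closed)
  have add: "g (a + b) = g a + g b" for a b
  proof -
    have "rep0 (g (a + b)) = rep0 (g a + g b)"
      unfolding L0.rep_add g[symmetric] R.rep_add by (rule ring_hom_add[OF hom]) simp_all
    then show ?thesis by simp
  qed
  have one: "g 1 = 1"
  proof -
    have "rep0 (g 1) = rep0 1"
      unfolding L0.rep_one g[symmetric] R.rep_one by (rule ring_hom_one[OF hom])
    then show ?thesis by simp
  qed
  have "g 0 + g 0 = g 0 + 0" using add[of 0 0] by simp
  then have zero: "g 0 = 0" by (rule add_left_imp_eq)
  have "g z = of_int z" for z
  proof (induction z rule: int_induct[of _ 0])
    case (step2 i)
    have "g i = g (i - 1) + g 1" using add[of "i - 1" 1] by simp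
    then show ?case using step2 one by (simp add: algebra_simps)
  qed (simp_all add: add one zero)
  then show ?thesis using g by simp
qed

lemma good_prime: "prime p \<Longrightarrow> good_prime p"
proof (rule good_prime_of_test_prime)
  interpret K0: field "F_p test_prime" by (rule field_F_p[OF prime_test_prime])
  have "of_int z = (0 :: closure_type) \<longleftrightarrow> int test_prime dvd z" for z
  proof -
    have "of_int z = (0 :: closure_type) \<longleftrightarrow> K0.indexed_const (z mod int test_prime) = rep0 0"
      by (simp only: indexed_const_eq_rep Rep_closure_type_inject)
    also have "\<dots> \<longleftrightarrow> K0.indexed_const (z mod int test_prime) = (K0.indexed_const 0 :: F_p_bar)"
      using indexed_const_eq_rep[of 0] by simp
    also have "\<dots> \<longleftrightarrow> z mod int test_prime = 0"
    proof
      assume "K0.indexed_const (z mod int test_prime) = (K0.indexed_const 0 :: F_p_bar)"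
      from fun_cong[OF this, of "{#}"] show "z mod int test_prime = 0" by (simp add: K0.indexed_const_def)
    qed simp
    finally show ?thesis by (simp only: dvd_eq_mod_eq_0)
  qed
  then have "CHAR(closure_type) = test_prime"
    by (intro CHAR_eqI) (metis of_int_of_nat_eq int_dvd_int_iff dvd_refl)+
  then have "closure_rep test_prime rep0"
    using prime_test_prime indexed_const_eq_rep field_rep_L0 unfolding L0_def
    by (intro closure_rep.intro closure_rep_axioms.intro) auto
  then show "good_prime test_prime" by (rule closure_rep.good_prime)
qed

lemma polys_int_ringE:
  assumes "F \<in> polys int_ring n"
  obtains f :: "int mpoly" where "F = coef f" "vars_in {1..n} f"
proof -
  have "ring int_ring" by (rule ring_from_type_algebra)
  then have F: "finite {m. F m \<noteq> 0}" "\<forall>m. F m \<noteq> 0 \<longrightarrow> set_mset m \<subseteq> {1..n}"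
    using assms by (auto simp: polys_iff ring_of_type_algebra_def simp del: One_nat_def)
  have "coef (Abs_poly_mapping F) = F" using F(1) by (rule lookup_Abs_poly_mapping)
  then show ?thesis using F(2) by (intro that[of "Abs_poly_mapping F"]) (auto simp: vars_in_def in_keys_iff)
qed

theorem theorem1:
  fixes n d :: nat and F :: "nat multiset \<Rightarrow> int"
  assumes "n \<ge> 2"
    and "F \<in> polys int_ring n"
    and "homogeneous d F"
    and "nonsingular rat_field n (\<lambda>m. rat_of_int (F m))"
  shows
    "(\<forall>p. prime p \<and> nonsingular (F_p p) n (reduce_mod p F) \<longrightarrow>
        (\<forall>j. variety_over (F_p p) n (G n p F j)) \<and>
        (d \<ge> 2 \<longrightarrow> G n p F 0 = affine_space (F_p_closure p) n) \<and>
        (\<forall>j. G n p F j \<supseteq> G n p F (Suc j)) \<and>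
        (\<forall>j. codimension (F_p_closure p) n (G n p F j) \<ge> ereal (real j))) \<and>
     (\<exists>C. \<forall>p. prime p \<and> nonsingular (F_p p) n (reduce_mod p F) \<longrightarrow>
        (\<forall>j h. reduce_point n p h \<notin> G n p F j \<longrightarrow>
           norm (exp_sum n F h (p\<^sup>2)) \<le> C * real p ^ (n + j - 2)))"
proof -
  obtain f :: "int mpoly" where f: "F = coef f" "vars_in {1..n} f" using assms(2) by (rule polys_int_ringE)
  have hf: "homog d f" using assms(3) by (auto simp: homog_def homogeneous_def in_keys_iff f(1))
  note good = good_primeD[OF good_prime assms(1) hf f(2), folded f(1)]
  \<comment> \<open>The degree up to which the rank polynomials have to be tested is the same for
    all \<open>p\<close> and \<open>h\<close>; it enters the constant \<open>c j\<close>.\<close>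
  have "\<exists>T. \<forall>(p::int) h. (\<forall>t\<le>T. \<forall>P\<in>rank_polys n d f j t. p dvd iev h P) \<longrightarrow>
      (\<forall>t. \<forall>P\<in>rank_polys n d f j t. p dvd iev h P)" for j
    by (rule uniform_divisibility_bound[of "{1..n}"]) (simp_all add: vars_in_rank_polys[OF hf f(2)] del: One_nat_def)
  from choice[OF allI[OF this]] obtain T where T: "\<forall>j. \<forall>(p::int) h.
      (\<forall>t\<le>T j. \<forall>P\<in>rank_polys n d f j t. p dvd iev h P) \<longrightarrow> (\<forall>t. \<forall>P\<in>rank_polys n d f j t. p dvd iev h P)"
    by (rule exE)
  define c where "c j = 2 ^ n * (T j + 1) ^ n * (n + 1) ^ j + 1" for j
  \<comment> \<open>Finitely many \<open>j\<close> suffice, since \<open>reduce_point n p h\<close>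
    never lies in \<open>G n p F (Suc n)\<close>.\<close>
  define C where "C = (\<Sum>j\<le>Suc n. c j)"
  have bound: "norm (exp_sum n F h (p\<^sup>2)) \<le> real (c j) * real p ^ (n + j - 2)"
    if p: "prime p" "nonsingular (F_p p) n (reduce_mod p F)" and h: "reduce_point n p h \<notin> G n p F j" for p j h
  proof -
    have "\<exists>t\<le>T j. \<exists>P\<in>rank_polys n d f j t. \<not> int p dvd iev h P"
    proof (rule ccontr)
      assume "\<not> ?thesis"
      then have "\<forall>t\<le>T j. \<forall>P\<in>rank_polys n d f j t. int p dvd iev h P" by blast
      then have "\<forall>t. \<forall>P\<in>rank_polys n d f j t. int p dvd iev h P" using T by blast
      then have "reduce_point n p h \<in> G n p F j" by (rule good(6)[OF p])
      then show False using h by contradiction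
    qed
    then obtain t P where tP: "t \<le> T j" "P \<in> rank_polys n d f j t" "\<not> int p dvd iev h P" by blast
    then show ?thesis unfolding c_def by (rule good(5)[OF p])
  qed
  have "norm (exp_sum n F h (p\<^sup>2)) \<le> real C * real p ^ (n + j - 2)"
    if p: "prime p" "nonsingular (F_p p) n (reduce_mod p F)" and h: "reduce_point n p h \<notin> G n p F j" for p j h
  proof -
    \<comment> \<open>For \<open>j\<close> beyond \<open>Suc n\<close> the bound for
      \<open>Suc n\<close> applies, and its power of \<open>p\<close> is the smaller one.\<close>
    define i where "i = min j (Suc n)"
    have "reduce_point n p h \<notin> G n p F i" using h good(7)[OF p] by (cases "j \<le> Suc n") (simp_all add: i_def)
    then have "norm (exp_sum n F h (p\<^sup>2)) \<le> real (c i) * real p ^ (n + i - 2)" by (rule bound[OF p])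
    also have "\<dots> \<le> real C * real p ^ (n + j - 2)"
    proof (rule mult_mono)
      have "c i \<le> C" unfolding C_def by (rule member_le_sum) (simp_all add: i_def)
      then show "real (c i) \<le> real C" by simp
      show "real p ^ (n + i - 2) \<le> real p ^ (n + j - 2)"
        using prime_gt_0_nat[OF p(1)] by (intro power_increasing) (simp_all add: i_def)
    qed simp_all
    finally show ?thesis .
  qed
  then have "\<exists>C. \<forall>p. prime p \<and> nonsingular (F_p p) n (reduce_mod p F) \<longrightarrow>
        (\<forall>j h. reduce_point n p h \<notin> G n p F j \<longrightarrow>
           norm (exp_sum n F h (p\<^sup>2)) \<le> C * real p ^ (n + j - 2))" by (intro exI[of _ "real C"]) blast
  moreover have "\<forall>p. prime p \<and> nonsingular (F_p p) n (reduce_mod p F) \<longrightarrow>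
      (\<forall>j. variety_over (F_p p) n (G n p F j)) \<and>
      (d \<ge> 2 \<longrightarrow> G n p F 0 = affine_space (F_p_closure p) n) \<and>
      (\<forall>j. G n p F j \<supseteq> G n p F (Suc j)) \<and>
      (\<forall>j. codimension (F_p_closure p) n (G n p F j) \<ge> ereal (real j))"
    by (intro allI impI conjI; elim conjE; rule good; assumption)
  ultimately show ?thesis by (intro conjI)
qed

end
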